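(* Let $d \ge 2$ and let $A \subset \mathbb{R}^d$ be a measurable set, with Lebesgue measure $|A|$. Let $Y_d$ be the space of affine unimodular lattices in $\mathbb{R}^d$, equipped with its Haar probability measure $\mu = \mu_d$. Then $$\mu\big(\{\Lambda \in Y_d : \Lambda \cap A = \emptyset\}\big) < \frac{1}{1+|A|}.$$
   Context: A unimodular lattice in $\mathbb{R}^d$ is a discrete additive subgroup of covolume $1$, i.e. a set of the form $g\mathbb{Z}^d$ with $g \in SL(d,\mathbb{R})$. An affine unimodular lattice in $\mathbb{R}^d$ is a translate of a unimodular lattice, i.e. a set $\Lambda = g\mathbb{Z}^d + \mathbf{x}$ with $g \in SL(d,\mathbb{R})$ and $\mathbf{x} \in \mathbb{R}^d$ (where $\mathbf{x}$ is well defined modulo $g\mathbb{Z}^d$). The group $SL(d,\mathbb{R}) \ltimes \mathbb{R}^d$ acts on $\mathbb{R}^d$ by affine maps, $(g,\mathbf{x})\cdot v = gv + \mathbf{x}$. The space $Y_d$ of affine unimodular lattices is identified with the homogeneous space $(SL(d,\mathbb{R}) \ltimes \mathbb{R}^d)/(SL(d,\mathbb{Z}) \ltimes \mathbb{Z}^d)$ via $\Lambda = g\mathbb{Z}^d + \mathbf{x} \mapsto (g,\mathbf{x})\,(SL(d,\mathbb{Z}) \ltimes \mathbb{Z}^d)$. The measure $\mu = \mu_d$ is the probability measure on $Y_d$ induced by Haar measure on $SL(d,\mathbb{R}) \ltimes \mathbb{R}^d$.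
   Formalization: The set A is assumed to have positive and finite Lebesgue measure, since the strict inequality fails when |A| = 0 (it reads 1 < 1) and when |A| = ∞ (the right side is 0). *)

theory Defs
  imports "HOL-Probability.Probability"
begin

text \<open>
  The pair \<open>(g, x)\<close> stands for the affine map \<open>v \<mapsto> g v + x\<close>, and \<open>ASL\<close> is the
  group \<open>SL(d, R) \<ltimes> R^d\<close> with \<open>d = CARD('n)\<close>.
\<close>

type_synonym 'n aff = "(real^'n^'n) \<times> (real^'n)"

definition aff_act :: "'n::finite aff \<Rightarrow> real^'n \<Rightarrow> real^'n" where
  "aff_act a v = fst a *v v + snd a"

definition aff_mult :: "'n::finite aff \<Rightarrow> 'n aff \<Rightarrow> 'n aff" where
  "aff_mult a b = (fst a ** fst b, fst a *v snd b + snd a)"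

definition ASL :: "'n::finite aff set" where
  "ASL = {a. det (fst a) = 1}"

definition integer_vectors :: "(real^'n::finite) set" where
  "integer_vectors = {v. \<forall>i. v $ i \<in> \<int>}"

definition ASL_int :: "'n::finite aff set" where
  "ASL_int = {a \<in> ASL. (\<forall>i j. fst a $ i $ j \<in> \<int>) \<and> snd a \<in> integer_vectors}"

definition affine_lattice :: "'n::finite aff \<Rightarrow> (real^'n) set" where
  "affine_lattice a = aff_act a ` integer_vectors"

definition affine_lattices :: "(real^'n::finite) set set" where
  "affine_lattices = affine_lattice ` ASL"

lemma aff_act_mult: "aff_act (aff_mult a b) v = aff_act a (aff_act b v)"
  by (simp add: aff_act_def aff_mult_def matrix_vector_mul_assoc matrix_vector_right_distrib)

lemma affine_lattice_mult: "affine_lattice (aff_mult a b) = aff_act a ` affine_lattice b"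
  by (auto simp: affine_lattice_def aff_act_mult image_image)

lemma det_Ints:
  fixes M :: "real^'n::finite^'n"
  assumes "\<And>i j. M $ i $ j \<in> \<int>"
  shows "det M \<in> \<int>"
  unfolding det_def using assms by (intro Ints_sum Ints_mult Ints_prod) auto

lemma mult_integer_vectors:
  fixes M :: "real^'n::finite^'n"
  assumes "\<And>i j. M $ i $ j \<in> \<int>" "v \<in> integer_vectors"
  shows "M *v v \<in> integer_vectors"
  using assms by (auto simp: integer_vectors_def matrix_vector_mult_def intro!: Ints_sum Ints_mult)

lemma affine_lattice_ASL_int:
  fixes c :: "'n::finite aff"
  assumes "c \<in> ASL_int"
  shows "affine_lattice c = integer_vectors"
proof (intro equalityI subsetI)
  fix v assume "v \<in> affine_lattice c"
  then obtain w where w: "w \<in> integer_vectors" "v = fst c *v w + snd c"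
    by (auto simp: affine_lattice_def aff_act_def)
  have "fst c *v w \<in> integer_vectors"
    using assms w by (intro mult_integer_vectors) (auto simp: ASL_int_def)
  then show "v \<in> integer_vectors"
    using assms w by (auto simp: integer_vectors_def ASL_int_def)
next
  fix v :: "real^'n" assume v: "v \<in> integer_vectors"
  define b where "b = v - snd c"
  have b: "b \<in> integer_vectors"
    using v assms by (auto simp: b_def integer_vectors_def ASL_int_def)
  have d: "det (fst c) = 1" and ci: "\<And>i j. fst c $ i $ j \<in> \<int>"
    using assms by (auto simp: ASL_int_def ASL_def)
  define w :: "real^'n" where
    "w = (\<chi> k. det (\<chi> i j. if j = k then b $ i else fst c $ i $ j) / det (fst c))"
  have "fst c *v w = b"
    using cramer[of "fst c" w b] d by (simp add: w_def)
  moreover have "w \<in> integer_vectors"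
    using b ci d by (auto simp: w_def integer_vectors_def intro!: det_Ints)
  ultimately show "v \<in> affine_lattice c"
    unfolding affine_lattice_def aff_act_def image_iff
    by (intro bexI[of _ w]) (auto simp: b_def)
qed

text \<open>
  The fibres of \<open>affine_lattice\<close> on \<open>ASL\<close> are exactly the cosets of \<open>ASL_int\<close>; this is the
  identification of \<open>affine_lattices\<close> with the homogeneous space \<open>ASL / ASL_int\<close>.
\<close>

lemma affine_lattice_eq_iff:
  fixes a b :: "'n::finite aff"
  assumes "a \<in> ASL" "b \<in> ASL"
  shows "affine_lattice b = affine_lattice a \<longleftrightarrow> (\<exists>c\<in>ASL_int. b = aff_mult a c)"
proof
  assume "\<exists>c\<in>ASL_int. b = aff_mult a c"
  then show "affine_lattice b = affine_lattice a"
    by (auto simp: affine_lattice_mult affine_lattice_ASL_int) (auto simp: affine_lattice_def)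
next
  assume eq: "affine_lattice b = affine_lattice a"
  have "invertible (fst a)"
    using assms by (simp add: ASL_def invertible_det_nz)
  then obtain h where h: "fst a ** h = mat 1" "h ** fst a = mat 1"
    by (auto simp: invertible_def)
  define c where "c = (h ** fst b, h *v (snd b - snd a))"
  have bc: "b = aff_mult a c"
    by (cases b) (simp add: aff_mult_def c_def matrix_mul_assoc matrix_vector_mul_assoc h)
  have "inj (aff_act a)"
  proof (rule injI)
    fix v w assume "aff_act a v = aff_act a w"
    then have "h *v (fst a *v v) = h *v (fst a *v w)" by (simp add: aff_act_def)
    then show "v = w" by (simp add: matrix_vector_mul_assoc h)
  qed
  moreover have "aff_act a ` affine_lattice c = aff_act a ` integer_vectors"
    using eq unfolding bc affine_lattice_mult by (simp add: affine_lattice_def)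
  ultimately have ci: "affine_lattice c = integer_vectors"
    by (simp add: inj_image_eq_iff)
  have act: "fst c *v v + snd c \<in> integer_vectors" if "v \<in> integer_vectors" for v
    using that ci by (auto simp: affine_lattice_def aff_act_def)
  have s: "snd c \<in> integer_vectors"
    using act[of 0] by (simp add: integer_vectors_def)
  have "fst c $ i $ j \<in> \<int>" for i j
  proof -
    have "fst c *v axis j 1 + snd c \<in> integer_vectors"
      by (rule act) (simp add: integer_vectors_def axis_def)
    then have "(fst c *v axis j 1 + snd c) $ i - snd c $ i \<in> \<int>"
      using s unfolding integer_vectors_def by (blast intro: Ints_diff)
    then show ?thesis by (simp add: matrix_vector_mult_basis column_def)
  qed
  moreover have "det (fst c) = 1"
    using assms bc by (simp add: ASL_def aff_mult_def det_mul)
  ultimately have "c \<in> ASL_int"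
    using s by (simp add: ASL_int_def ASL_def)
  with bc show "\<exists>c\<in>ASL_int. b = aff_mult a c" by blast
qed

text \<open>
  Left Haar measures on \<open>ASL\<close>.  Regularity is automatic, since \<open>ASL\<close> is locally compact and
  second countable.
\<close>

definition ASL_haar_measure :: "'n::finite aff measure \<Rightarrow> bool" where
  "ASL_haar_measure m \<longleftrightarrow>
     sets m = sets (restrict_space borel ASL) \<and>
     emeasure m ASL \<noteq> 0 \<and>
     (\<forall>K. compact K \<and> K \<subseteq> ASL \<longrightarrow> emeasure m K < \<infinity>) \<and>
     (\<forall>a\<in>ASL. \<forall>E\<in>sets m. emeasure m (aff_mult a ` E) = emeasure m E)"

text \<open>
  The quotient sigma-algebra; it agrees with the Borel sets of the quotient topology because
  \<open>ASL_int\<close> is discrete.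
\<close>

definition affine_lattice_sets :: "(real^'n::finite) set set set" where
  "affine_lattice_sets =
     {S. S \<subseteq> affine_lattices \<and> {a \<in> ASL. affine_lattice a \<in> S} \<in> sets borel}"

text \<open>
  The probability measure on the quotient induced by Haar measure: Weil's formula for indicator
  functions, with counting measure on the fibres (the cosets of the discrete group \<open>ASL_int\<close>).
  Haar measure is only determined up to a positive factor, and total mass \<open>1\<close> fixes this factor.
\<close>

definition haar_probability :: "(real^'n::finite) set measure \<Rightarrow> bool" where
  "haar_probability \<mu> \<longleftrightarrow>
     prob_space \<mu> \<and>
     space \<mu> = affine_lattices \<and>
     sets \<mu> = affine_lattice_sets \<and>
     (\<exists>m. ASL_haar_measure m \<and>
       (\<forall>E\<in>sets m. emeasure m E =
         (\<integral>\<^sup>+ \<Lambda>. emeasure (count_space ASL) {a \<in> E. affine_lattice a = \<Lambda>} \<partial>\<mu>)))"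

end

theory Submission
  imports Defs "HOL-Real_Asymp.Real_Asymp"
begin

text \<open>
  Let \<open>N\<close> be the number of points of a random affine lattice in \<open>A\<close>, and \<open>\<alpha> = |A|\<close>.  Then
  \<open>E N = \<alpha>\<close> and \<open>E N\<^sup>2 = \<alpha> + \<alpha>\<^sup>2\<close>, so with \<open>c = 1 + \<alpha>\<close> one has \<open>E (N - c)\<^sup>2 = c\<close>, while
  \<open>(N - c)\<^sup>2 \<ge> c\<^sup>2\<close> on \<open>N = 0\<close>; hence \<open>P (N = 0) \<le> 1 / c\<close>.  The inequality is strict because
  \<open>N \<ge> c + 1\<close> has positive probability: by the pair formula, the lattice contains an arithmetic
  progression of any prescribed length inside \<open>A\<close> with positive probability.

  The moments come from averaging over group elements.  Averaging over translations in a growing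
  cube turns the sum over the points into an integral.  For the sum over the nonzero difference
  vectors (Siegel's formula), average over products of two shears, \<open>z\<^sub>i \<mapsto> z\<^sub>i + s z\<^sub>j\<close> with \<open>s \<in> [0, 1]\<close>
  and then \<open>z\<^sub>k \<mapsto> z\<^sub>k + r\<^sub>k z\<^sub>i\<close> (\<open>k \<noteq> i\<close>) with \<open>r\<^sub>k \<in> [S, 2 S]\<close>: for every fixed lattice the averaged sum is a
  Riemann sum at scale \<open>S\<close> and converges to the integral as \<open>S \<rightarrow> \<infinity>\<close>.
\<close>

section \<open>Linear changes of variables and lattice sums\<close>

text \<open>The constant \<open>c = 1 + \<alpha>\<close> minimises \<open>E (N - c)^2 / c^2 =
  (\<alpha> + \<alpha>^2 - 2 c \<alpha> + c^2) / c^2\<close>; the resulting bound is that of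
  Cauchy-Schwarz, \<open>P (N > 0) >= (E N)^2 / E N^2\<close>. Equality would force \<open>N\<close>
  to take only the values 0 and \<open>c\<close> almost surely, so a third value of positive
  probability makes the bound strict. Progressions serve for this because arbitrarily many points
  are then governed by one point and one difference vector, and no moment beyond the second is
  needed.

  Averaging needs a group, whereas \<open>\<mu>\<close> lives on a set of lattices; hence the lift
  to a probability measure on \<open>ASL\<close>. Translations leave difference vectors alone, so
  the two kinds of average can be taken one after the other. For difference vectors one shear is not
  enough: adding multiples of the \<open>i\<close>-th coordinate to the others leaves the
  \<open>i\<close>-th coordinates of a fixed lattice in a countable set. The shear along
  \<open>j\<close> spreads them out.\<close>

abbreviation Zs :: "(real^'n::finite) measure" where
  "Zs \<equiv> count_space integer_vectors"

lemma countable_integer_vectors: "countable (integer_vectors :: (real^'n::finite) set)"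
proof -
  have "integer_vectors \<subseteq> range (\<lambda>f::'n \<Rightarrow> int. \<chi> i. real_of_int (f i))"
  proof
    fix v :: "real^'n" assume "v \<in> integer_vectors"
    then have "v = (\<chi> i. real_of_int (\<lfloor>v $ i\<rfloor>))"
      by (auto simp: integer_vectors_def vec_eq_iff elim!: Ints_cases)
    then show "v \<in> range (\<lambda>f::'n \<Rightarrow> int. \<chi> i. real_of_int (f i))"
      by (intro image_eqI[of _ _ "\<lambda>i. \<lfloor>v $ i\<rfloor>"]) auto
  qed
  then show ?thesis
    by (rule countable_subset) simp
qed

lemma measurable_count_space_sum [measurable (raw)]:
  fixes f :: "'a \<Rightarrow> 'b \<Rightarrow> ennreal"
  assumes "countable I" "\<And>k. k \<in> I \<Longrightarrow> (\<lambda>x. f x k) \<in> borel_measurable M"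
  shows "(\<lambda>x. \<integral>\<^sup>+k. f x k \<partial>count_space I) \<in> borel_measurable M"
proof -
  have [measurable]: "(\<lambda>(k, x). f x k) \<in> borel_measurable (count_space I \<Otimes>\<^sub>M M)"
    by (rule measurable_pair_measure_countable1) (use assms in auto)
  then have [measurable]: "(\<lambda>(x, k). f x k) \<in> borel_measurable (M \<Otimes>\<^sub>M count_space I)"
    by (subst measurable_pair_swap_iff) (simp add: split_beta')
  show ?thesis
    by (rule sigma_finite_measure.borel_measurable_nn_integral
          [OF sigma_finite_measure_count_space_countable[OF assms(1)]]) simp
qed

lemma nn_integral_count_space_swap:
  fixes f :: "'a \<Rightarrow> 'b \<Rightarrow> ennreal"
  assumes "countable I" "\<And>k. k \<in> I \<Longrightarrow> (\<lambda>x. f x k) \<in> borel_measurable M"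
  shows "(\<integral>\<^sup>+x. (\<integral>\<^sup>+k. f x k \<partial>count_space I) \<partial>M) = (\<integral>\<^sup>+k. (\<integral>\<^sup>+x. f x k \<partial>M) \<partial>count_space I)"
  by (rule nn_integral_count_space_nn_integral[OF assms(1)]) (use assms in auto)

lemma nn_integral_translate:
  fixes f :: "'a::euclidean_space \<Rightarrow> ennreal"
  assumes [measurable]: "f \<in> borel_measurable borel"
  shows "(\<integral>\<^sup>+x. f (x + c) \<partial>lborel) = (\<integral>\<^sup>+x. f x \<partial>lborel)"
proof -
  have "(\<integral>\<^sup>+x. f x \<partial>lborel) = (\<integral>\<^sup>+x. f x \<partial>distr lborel borel ((+) c))" by (simp only: lborel_distr_plus)
  also have "\<dots> = (\<integral>\<^sup>+x. f (c + x) \<partial>lborel)" by (subst nn_integral_distr) auto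
  finally show ?thesis by (simp add: add.commute)
qed

section \<open>The unit cube as a fundamental domain of the integer lattice\<close>

definition unit_cube :: "(real^'n::finite) set" where
  "unit_cube = {q. \<forall>i. 0 \<le> q $ i \<and> q $ i < 1}"

lemma unit_cube_borel [measurable]: "unit_cube \<in> sets borel"
  unfolding unit_cube_def by measurable

text \<open>The cube is half-open so that every \<open>x\<close> lies in exactly one integer
  translate of it, the one based at the vector of floors. The indicators of the translates therefore
  sum to 1.\<close>

lemma nn_integral_unit_cube:
  fixes f :: "real^'n::finite \<Rightarrow> ennreal"
  assumes [measurable]: "f \<in> borel_measurable borel"
  shows "(\<integral>\<^sup>+x. f x \<partial>lborel) = (\<integral>\<^sup>+k. \<integral>\<^sup>+q. f (k + q) * indicator unit_cube q \<partial>lborel \<partial>Zs)"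
proof -
  have one: "(\<integral>\<^sup>+k. indicator unit_cube (x - k) \<partial>Zs) = (1::ennreal)" for x :: "real^'n"
  proof -
    define c :: "real^'n" where "c = (\<chi> i. real_of_int \<lfloor>x $ i\<rfloor>)"
    have c: "c \<in> integer_vectors" by (auto simp: c_def integer_vectors_def)
    have "indicator unit_cube (x - k) = (indicator {c} k :: ennreal)" if "k \<in> integer_vectors" for k
    proof -
      have "x - k \<in> unit_cube \<longleftrightarrow> k = c"
      proof
        assume u: "x - k \<in> unit_cube"
        show "k = c" unfolding vec_eq_iff
        proof
          fix i
          have "k $ i \<in> \<int>" "0 \<le> x $ i - k $ i" "x $ i - k $ i < 1"
            using that u by (auto simp: integer_vectors_def unit_cube_def)
          then show "k $ i = c $ i"
            by (auto simp: c_def elim!: Ints_cases) linarith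
        qed
      qed (auto simp: unit_cube_def c_def, linarith)
      then show ?thesis by (auto simp: indicator_def)
    qed
    then have "(\<integral>\<^sup>+k. indicator unit_cube (x - k) \<partial>Zs) = (\<integral>\<^sup>+k. (indicator {c} k :: ennreal) \<partial>Zs)"
      by (intro nn_integral_cong) auto
    also have "\<dots> = 1" using c by simp
    finally show ?thesis .
  qed
  have "(\<integral>\<^sup>+x. f x \<partial>lborel) = (\<integral>\<^sup>+x. (\<integral>\<^sup>+k. f x * indicator unit_cube (x - k) \<partial>Zs) \<partial>lborel)"
    by (simp add: nn_integral_cmult one)
  also have "\<dots> = (\<integral>\<^sup>+k. (\<integral>\<^sup>+x. f x * indicator unit_cube (x - k) \<partial>lborel) \<partial>Zs)"
    by (rule nn_integral_count_space_swap[OF countable_integer_vectors]) measurable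
  also have "\<dots> = (\<integral>\<^sup>+k. \<integral>\<^sup>+q. f (k + q) * indicator unit_cube q \<partial>lborel \<partial>Zs)"
  proof (rule nn_integral_cong)
    fix k :: "real^'n"
    show "(\<integral>\<^sup>+x. f x * indicator unit_cube (x - k) \<partial>lborel) = (\<integral>\<^sup>+q. f (k + q) * indicator unit_cube q \<partial>lborel)"
      using nn_integral_translate[of "\<lambda>x. f x * indicator unit_cube (x - k)" k] by (simp add: add.commute)
  qed
  finally show ?thesis .
qed

lemma emeasure_unit_cube: "emeasure lborel (unit_cube :: (real^'n::finite) set) = 1"
proof -
  have b: "box 0 1 \<subseteq> (unit_cube :: (real^'n) set)" "unit_cube \<subseteq> cbox 0 (1 :: real^'n)"
    by (auto simp: unit_cube_def mem_box_cart less_imp_le)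
  have "emeasure lborel (box 0 1 :: (real^'n) set) = 1" "emeasure lborel (cbox 0 1 :: (real^'n) set) = 1"
    by (auto simp: emeasure_lborel_box_eq emeasure_lborel_cbox_eq Basis_vec_def inner_axis prod.neutral)
  then show ?thesis
    using emeasure_mono[OF b(1), of lborel] emeasure_mono[OF b(2), of lborel] by auto
qed

lemma measurable_matrix_vector_mult [measurable (raw)]:
  fixes f :: "'a \<Rightarrow> real^'n::finite^'m::finite"
  assumes "f \<in> borel_measurable M" "h \<in> borel_measurable M"
  shows "(\<lambda>x. f x *v h x) \<in> borel_measurable M"
proof -
  have "continuous_on UNIV (\<lambda>x :: (real^'n^'m) \<times> (real^'n). fst x *v snd x)"
    unfolding matrix_vector_mult_def by (intro continuous_intros)
  from borel_measurable_continuous_Pair[OF assms this] show ?thesis by simp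
qed

lemma ennreal_square_eq_1:
  assumes "(c::ennreal) * c = 1"
  shows "c = 1"
proof -
  have "c \<noteq> \<top>" using assms by (auto simp: ennreal_mult_top)
  then obtain r where r: "c = ennreal r" "r \<ge> 0" by (cases c) auto
  then have "r * r = 1" using assms by (simp add: ennreal_mult[symmetric] flip: ennreal_1)
  then have "r = 1" using r by (metis abs_of_nonneg power2_eq_square real_sqrt_abs real_sqrt_one)
  then show ?thesis using r by simp
qed

text \<open>
  Uniqueness of translation-invariant measures, up to a factor: integrate \<open>f (g x + y)\<close> over \<open>x\<close> and
  over \<open>y\<close> in a unit cube, and translate in either variable.
\<close>

lemma nn_integral_linear_change_ex:
  fixes g h :: "real^'n::finite^'n"
  assumes gh: "g ** h = mat 1"
  shows "\<exists>c. \<forall>f\<in>borel_measurable borel. (\<integral>\<^sup>+x. f (g *v x) \<partial>lborel) = c * (\<integral>\<^sup>+x. f x \<partial>lborel)"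
proof (intro exI ballI)
  fix f :: "real^'n \<Rightarrow> ennreal"
  assume [measurable]: "f \<in> borel_measurable borel"
  let ?C = "indicator unit_cube :: real^'n \<Rightarrow> ennreal"
  have ghx: "g *v (h *v y) = y" for y by (simp add: matrix_vector_mul_assoc gh)
  have "(\<integral>\<^sup>+x. f (g *v x) \<partial>lborel) = (\<integral>\<^sup>+y. (\<integral>\<^sup>+x. f (g *v x) \<partial>lborel) * ?C y \<partial>lborel)"
    by (simp add: nn_integral_cmult_indicator emeasure_unit_cube)
  also have "\<dots> = (\<integral>\<^sup>+y. \<integral>\<^sup>+x. f (g *v x + y) * ?C y \<partial>lborel \<partial>lborel)"
  proof (rule nn_integral_cong)
    fix y :: "real^'n"
    have "(\<integral>\<^sup>+x. f (g *v x + y) \<partial>lborel) = (\<integral>\<^sup>+x. f (g *v (x + h *v y)) \<partial>lborel)"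
      by (simp add: matrix_vector_right_distrib ghx)
    also have "\<dots> = (\<integral>\<^sup>+x. f (g *v x) \<partial>lborel)"
      by (rule nn_integral_translate) measurable
    finally show "(\<integral>\<^sup>+x. f (g *v x) \<partial>lborel) * ?C y = (\<integral>\<^sup>+x. f (g *v x + y) * ?C y \<partial>lborel)"
      by (simp add: nn_integral_multc)
  qed
  also have "\<dots> = (\<integral>\<^sup>+x. \<integral>\<^sup>+y. f (g *v x + y) * ?C y \<partial>lborel \<partial>lborel)"
    by (rule lborel_pair.Fubini') measurable
  also have "\<dots> = (\<integral>\<^sup>+x. \<integral>\<^sup>+y. f y * ?C (y - g *v x) \<partial>lborel \<partial>lborel)"
  proof (rule nn_integral_cong)
    fix x :: "real^'n"
    have "(\<integral>\<^sup>+y. f ((y + g *v x)) * ?C ((y + g *v x) - g *v x) \<partial>lborel) = (\<integral>\<^sup>+y. f y * ?C (y - g *v x) \<partial>lborel)"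
      by (rule nn_integral_translate[where f = "\<lambda>y. f y * ?C (y - g *v x)"]) measurable
    then show "(\<integral>\<^sup>+y. f (g *v x + y) * ?C y \<partial>lborel) = (\<integral>\<^sup>+y. f y * ?C (y - g *v x) \<partial>lborel)"
      by (simp add: add.commute)
  qed
  also have "\<dots> = (\<integral>\<^sup>+y. \<integral>\<^sup>+x. f y * ?C (y - g *v x) \<partial>lborel \<partial>lborel)"
    by (rule lborel_pair.Fubini') measurable
  \<comment> \<open>Replacing \<open>x\<close> by \<open>x + h *v y\<close> turns
    \<open>y - g *v x\<close> into \<open>- (g *v x)\<close>. The inner integral no longer depends
    on \<open>y\<close> and becomes the scaling factor.\<close>
  also have "\<dots> = (\<integral>\<^sup>+y. f y * (\<integral>\<^sup>+x. ?C (- (g *v x)) \<partial>lborel) \<partial>lborel)"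
  proof (rule nn_integral_cong)
    fix y :: "real^'n"
    have "(\<integral>\<^sup>+x. ?C (y - g *v (x + h *v y)) \<partial>lborel) = (\<integral>\<^sup>+x. ?C (y - g *v x) \<partial>lborel)"
      by (rule nn_integral_translate) measurable
    then show "(\<integral>\<^sup>+x. f y * ?C (y - g *v x) \<partial>lborel) = f y * (\<integral>\<^sup>+x. ?C (- (g *v x)) \<partial>lborel)"
      by (simp add: nn_integral_cmult matrix_vector_right_distrib ghx)
  qed
  also have "\<dots> = (\<integral>\<^sup>+x. ?C (- (g *v x)) \<partial>lborel) * (\<integral>\<^sup>+x. f x \<partial>lborel)"
    by (simp add: nn_integral_multc mult.commute)
  finally show "(\<integral>\<^sup>+x. f (g *v x) \<partial>lborel) = (\<integral>\<^sup>+x. ?C (- (g *v x)) \<partial>lborel) * (\<integral>\<^sup>+x. f x \<partial>lborel)" .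
qed

text \<open>Scaling factors multiply, so the factor of \<open>d\<close> has square 1, and then so
  has the factor of \<open>g\<close>; a nonnegative number with square 1 is 1. The indicator of the
  unit cube, whose integral is 1, converts identities between maps into identities between
  factors.\<close>

lemma nn_integral_conj_involution:
  fixes g d :: "real^'n::finite^'n" and f :: "real^'n \<Rightarrow> ennreal"
  assumes d: "d ** d = mat 1" and g: "d ** g ** d ** g = mat 1" "g ** (d ** g ** d) = mat 1"
    and [measurable]: "f \<in> borel_measurable borel"
  shows "(\<integral>\<^sup>+x. f (g *v x) \<partial>lborel) = (\<integral>\<^sup>+x. f x \<partial>lborel)"
proof -
  obtain c where c: "\<And>f. f\<in>borel_measurable borel \<Longrightarrow> (\<integral>\<^sup>+x. f (g *v x) \<partial>lborel) = c * (\<integral>\<^sup>+x. f x \<partial>lborel)"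
    using nn_integral_linear_change_ex[OF g(2)] by blast
  obtain e where e: "\<And>f. f\<in>borel_measurable borel \<Longrightarrow> (\<integral>\<^sup>+x. f (d *v x) \<partial>lborel) = e * (\<integral>\<^sup>+x. f x \<partial>lborel)"
    using nn_integral_linear_change_ex[OF d] by blast
  let ?C = "indicator unit_cube :: real^'n \<Rightarrow> ennreal"
  have C: "(\<integral>\<^sup>+x. ?C x \<partial>lborel) = 1" by (simp add: emeasure_unit_cube)
  have "(\<integral>\<^sup>+x. ?C (d *v (d *v x)) \<partial>lborel) = e * (e * (\<integral>\<^sup>+x. ?C x \<partial>lborel))"
    by (subst e[of "\<lambda>x. ?C (d *v x)"], measurable, subst e) auto
  then have "e * e = 1" by (simp add: matrix_vector_mul_assoc d C del: nn_integral_indicator)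
  then have e1: "e = 1" by (rule ennreal_square_eq_1)
  have "(\<integral>\<^sup>+x. ?C (d *v (g *v (d *v (g *v x)))) \<partial>lborel) = c * (e * (c * (e * (\<integral>\<^sup>+x. ?C x \<partial>lborel))))"
    by (subst c[of "\<lambda>x. ?C (d *v (g *v (d *v x)))"], measurable, subst e[of "\<lambda>x. ?C (d *v (g *v x))"],
        measurable, subst c[of "\<lambda>x. ?C (d *v x)"], measurable, subst e) auto
  moreover have "d *v (g *v (d *v (g *v x))) = x" for x
    using g(1) by (simp add: matrix_vector_mul_assoc matrix_mul_assoc)
  ultimately have "c * c = 1" by (simp add: C e1 del: nn_integral_indicator)
  then have "c = 1" by (rule ennreal_square_eq_1)
  then show ?thesis using c[of f] by simp
qed

text \<open>
  \<open>measure_linear_image\<close> would need a well-ordered index type.  The scaling factor is multiplicative,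
  so shears and swaps have factor \<open>1\<close>: they are conjugate to their inverses by an involution.
\<close>

lemma nn_integral_det:
  fixes g :: "real^'n::finite^'n"
  assumes "det g \<noteq> 0" "f \<in> borel_measurable borel"
  shows "ennreal \<bar>det g\<bar> * (\<integral>\<^sup>+x. f (g *v x) \<partial>lborel) = (\<integral>\<^sup>+x. f x \<partial>lborel)"
proof -
  let ?P = "\<lambda>A :: real^'n^'n. det A \<noteq> 0 \<longrightarrow> (\<forall>f\<in>borel_measurable borel.
              ennreal \<bar>det A\<bar> * (\<integral>\<^sup>+x. f (A *v x) \<partial>lborel) = (\<integral>\<^sup>+x. f x \<partial>lborel))"
  have "?P g"
  proof (rule induct_matrix_elementary_alt)
    fix A B :: "real^'n^'n" assume A: "?P A" and B: "?P B"
    show "?P (A ** B)"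
    proof (intro impI ballI)
      fix f :: "real^'n \<Rightarrow> ennreal"
      assume nz: "det (A ** B) \<noteq> 0" and [measurable]: "f \<in> borel_measurable borel"
      have "ennreal \<bar>det B\<bar> * (\<integral>\<^sup>+x. f (A *v (B *v x)) \<partial>lborel) = (\<integral>\<^sup>+x. f (A *v x) \<partial>lborel)"
        using B nz by (auto simp: det_mul)
      moreover have "ennreal \<bar>det A\<bar> * (\<integral>\<^sup>+x. f (A *v x) \<partial>lborel) = (\<integral>\<^sup>+x. f x \<partial>lborel)"
        using A nz by (auto simp: det_mul)
      ultimately show "ennreal \<bar>det (A ** B)\<bar> * (\<integral>\<^sup>+x. f (A ** B *v x) \<partial>lborel) = (\<integral>\<^sup>+x. f x \<partial>lborel)"
        by (simp add: det_mul abs_mult ennreal_mult matrix_vector_mul_assoc[symmetric] mult.assoc)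
    qed
  next
    fix A :: "real^'n^'n" and i assume "row i A = 0"
    then show "?P A" using det_zero_row by blast
  next
    fix A :: "real^'n^'n" assume A: "\<And>i j. i \<noteq> j \<Longrightarrow> A $ i $ j = 0"
    show "?P A"
    proof (intro impI ballI)
      fix f :: "real^'n \<Rightarrow> ennreal"
      assume nz: "det A \<noteq> 0" and [measurable]: "f \<in> borel_measurable borel"
      have dA: "det A = (\<Prod>i\<in>UNIV. A $ i $ i)" by (rule det_diagonal) (use A in auto)
      \<comment> \<open>\<open>lborel_affine_euclidean\<close> takes its factors indexed by basis
        vectors, so the diagonal entry has to be recovered from \<open>axis i 1\<close>.\<close>
      define c :: "real^'n \<Rightarrow> real" where "c b = (THE r. \<exists>i. b = axis i 1 \<and> r = A $ i $ i)" for b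
      have c: "c (axis i 1) = A $ i $ i" for i
        unfolding c_def by (rule the_equality) (auto simp: axis_eq_axis)
      have cn: "c j \<noteq> 0" if "j \<in> Basis" for j
        using that nz dA by (auto simp: Basis_vec_def c)
      have B: "(\<Prod>j\<in>Basis. F j) = (\<Prod>i\<in>UNIV. F (axis i (1::real)))" for F :: "real^'n \<Rightarrow> real"
        by (subst prod.reindex_bij_betw[symmetric, where T = "Basis :: (real^'n) set" and S = UNIV and h = "\<lambda>i. axis i 1"])
           (auto simp: bij_betw_def inj_on_def axis_eq_axis Basis_vec_def)
      have BS: "(\<Sum>j\<in>Basis. F j) = (\<Sum>i\<in>UNIV. F (axis i (1::real)))" for F :: "real^'n \<Rightarrow> real^'n"
        by (subst sum.reindex_bij_betw[symmetric, where T = "Basis :: (real^'n) set" and S = UNIV and h = "\<lambda>i. axis i 1"])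
           (auto simp: bij_betw_def inj_on_def axis_eq_axis Basis_vec_def)
      have axn: "axis j (1::real) $ i = (if i = j then 1 else 0)" for i j :: 'n
        by (simp add: axis_def)
      have T: "0 + (\<Sum>j\<in>Basis. (c j * (x \<bullet> j)) *\<^sub>R j) = A *v x" for x
      proof -
        have "(\<Sum>j\<in>UNIV. A $ i $ j * x $ j) = A $ i $ i * x $ i" for i
          by (subst sum.remove[of _ i]) (auto simp: A intro!: sum.neutral)
        moreover have "(\<Sum>j\<in>Basis. (c j * (x \<bullet> j)) *\<^sub>R j) $ i = A $ i $ i * x $ i" for i
          by (subst BS, subst sum_component, subst sum.remove[of _ i])
             (auto simp: c inner_axis axn intro!: sum.neutral)
        ultimately show ?thesis by (simp add: vec_eq_iff matrix_vector_mult_def)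
      qed
      have "(\<integral>\<^sup>+x. f x \<partial>lborel) = (\<integral>\<^sup>+x. f x \<partial>density (distr lborel borel (\<lambda>x. A *v x)) (\<lambda>_. (\<Prod>j\<in>Basis. \<bar>c j\<bar>)))"
        using lborel_affine_euclidean[of c 0, OF cn] by (simp only: T)
      also have "\<dots> = ennreal \<bar>det A\<bar> * (\<integral>\<^sup>+x. f (A *v x) \<partial>lborel)"
        by (simp add: nn_integral_density nn_integral_distr nn_integral_cmult B c dA abs_prod)
      finally show "ennreal \<bar>det A\<bar> * (\<integral>\<^sup>+x. f (A *v x) \<partial>lborel) = (\<integral>\<^sup>+x. f x \<partial>lborel)" ..
    qed
  next
    fix m n :: 'n assume mn: "m \<noteq> n"
    let ?A = "(\<chi> i j. mat 1 $ i $ Transposition.transpose m n j) :: real^'n^'n"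
    have AA: "?A ** ?A = mat 1"
    proof -
      have tr: "i = Transposition.transpose m n j \<longleftrightarrow> j = Transposition.transpose m n i" for i j
        by (metis transpose_involutory)
      have "?A *v x = (\<chi> i. x $ Transposition.transpose m n i)" for x
        unfolding matrix_vector_mult_def mat_def vec_eq_iff vec_lambda_beta
      proof
        fix i
        show "(\<Sum>j\<in>UNIV. (if i = Transposition.transpose m n j then 1 else 0) * x $ j) = x $ Transposition.transpose m n i"
          by (subst sum.remove[of _ "Transposition.transpose m n i"]) (auto simp: tr[of i] intro!: sum.neutral)
      qed
      then show ?thesis
        by (auto simp: matrix_eq matrix_vector_mul_assoc[symmetric] vec_eq_iff)
    qed
    \<comment> \<open>A swap is its own inverse, so its determinant has modulus 1 and the identity
      serves as the involution.\<close>
    then have "det ?A * det ?A = 1" by (metis det_I det_mul)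
    then have "\<bar>det ?A\<bar> = 1"
      using square_eq_1_iff[of "det ?A"] by auto
    then show "?P ?A"
      using nn_integral_conj_involution[of "mat 1" ?A] AA by (simp add: matrix_mul_assoc)
  next
    fix m n :: 'n assume mn: "m \<noteq> n"
    let ?A = "(\<chi> i j. of_bool (i = m \<and> j = n \<or> i = j)) :: real^'n^'n"
    \<comment> \<open>Conjugation by the sign flip of coordinate \<open>m\<close> turns
      \<open>x $ m + x $ n\<close> into \<open>x $ m - x $ n\<close>, which inverts the
      shear.\<close>
    let ?D = "(\<chi> i j. if i = j then (if i = m then -1 else 1) else 0) :: real^'n^'n"
    have 1: "?A = (\<chi> k. if k = m then row m (mat 1) + 1 *s row n (mat 1) else row k (mat 1))"
      using mn by (auto simp: vec_eq_iff row_def mat_def)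
    have detA: "det ?A = 1"
      unfolding 1 by (subst det_row_operation[OF mn]) simp
    have Av: "?A *v x = (\<chi> i. if i = m then x $ m + x $ n else x $ i)" for x
    proof -
      have "(\<Sum>j\<in>UNIV. of_bool (i = m \<and> j = n \<or> i = j) * x $ j) = (if i = m then x $ m + x $ n else x $ i)" for i
      proof (cases "i = m")
        case True
        then show ?thesis using mn
          by (subst sum.remove[of _ m], simp, simp, subst sum.remove[of _ n]) (auto intro!: sum.neutral)
      next
        case False
        then show ?thesis
          by (subst sum.remove[of _ i]) (auto intro!: sum.neutral)
      qed
      then show ?thesis by (simp add: matrix_vector_mult_def)
    qed
    have Dv: "?D *v x = (\<chi> i. if i = m then - x $ m else x $ i)" for x
    proof -
      have "(\<Sum>j\<in>UNIV. (if i = j then (if i = m then -1 else 1) else 0) * x $ j) = (if i = m then - x $ m else x $ i)" for i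
        by (subst sum.remove[of _ i]) (auto intro!: sum.neutral)
      then show ?thesis by (simp add: matrix_vector_mult_def)
    qed
    have d: "?D ** ?D = mat 1" "?D ** ?A ** ?D ** ?A = mat 1" "?A ** (?D ** ?A ** ?D) = mat 1"
      unfolding matrix_eq matrix_vector_mul_assoc[symmetric] Av Dv using mn
      by (auto simp: vec_eq_iff)
    show "?P ?A"
      using nn_integral_conj_involution[OF d] detA by simp
  qed
  then show ?thesis using assms by blast
qed

lemma nn_integral_det_1:
  fixes g :: "real^'n::finite^'n" and f :: "real^'n \<Rightarrow> ennreal"
  assumes "det g = 1" and [measurable]: "f \<in> borel_measurable borel"
  shows "(\<integral>\<^sup>+x. f (g *v x) \<partial>lborel) = (\<integral>\<^sup>+x. f x \<partial>lborel)"
  using nn_integral_det[of g f] assms by simp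

text \<open>
  A lattice sum is compared with an integral by smearing each point over a fundamental cell.
\<close>

lemma lattice_sum_le_integral:
  fixes g :: "real^'n::finite^'n" and J J' :: "real^'n \<Rightarrow> ennreal"
  assumes g: "det g = 1" and [measurable]: "J' \<in> borel_measurable borel"
    and le: "\<And>k q. k \<in> integer_vectors \<Longrightarrow> q \<in> unit_cube \<Longrightarrow> J (g *v k) \<le> J' (g *v k + g *v q)"
  shows "(\<integral>\<^sup>+k. J (g *v k) \<partial>Zs) \<le> (\<integral>\<^sup>+x. J' x \<partial>lborel)"
proof -
  have "(\<integral>\<^sup>+k. J (g *v k) \<partial>Zs) = (\<integral>\<^sup>+k. \<integral>\<^sup>+q. J (g *v k) * indicator unit_cube (q :: real^'n) \<partial>lborel \<partial>Zs)"
    by (simp add: nn_integral_cmult_indicator emeasure_unit_cube)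
  also have "\<dots> \<le> (\<integral>\<^sup>+k. \<integral>\<^sup>+q. J' (g *v (k + q)) * indicator unit_cube q \<partial>lborel \<partial>Zs)"
    by (intro nn_integral_mono) (auto simp: matrix_vector_right_distrib le split: split_indicator)
  also have "\<dots> = (\<integral>\<^sup>+x. J' (g *v x) \<partial>lborel)"
    by (rule nn_integral_unit_cube[symmetric]) measurable
  also have "\<dots> = (\<integral>\<^sup>+x. J' x \<partial>lborel)"
    using nn_integral_det_1[OF g, of J'] by simp
  finally show ?thesis .
qed

lemma integral_le_lattice_sum:
  fixes g :: "real^'n::finite^'n" and J J' :: "real^'n \<Rightarrow> ennreal"
  assumes g: "det g = 1" and [measurable]: "J' \<in> borel_measurable borel"
    and le: "\<And>k q. k \<in> integer_vectors \<Longrightarrow> q \<in> unit_cube \<Longrightarrow> J' (g *v k + g *v q) \<le> J (g *v k)"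
  shows "(\<integral>\<^sup>+x. J' x \<partial>lborel) \<le> (\<integral>\<^sup>+k. J (g *v k) \<partial>Zs)"
proof -
  have "(\<integral>\<^sup>+x. J' x \<partial>lborel) = (\<integral>\<^sup>+x. J' (g *v x) \<partial>lborel)"
    using nn_integral_det_1[OF g, of J'] by simp
  also have "\<dots> = (\<integral>\<^sup>+k. \<integral>\<^sup>+q. J' (g *v (k + q)) * indicator unit_cube q \<partial>lborel \<partial>Zs)"
    by (rule nn_integral_unit_cube) measurable
  also have "\<dots> \<le> (\<integral>\<^sup>+k. \<integral>\<^sup>+q. J (g *v k) * indicator unit_cube (q :: real^'n) \<partial>lborel \<partial>Zs)"
    by (intro nn_integral_mono) (auto simp: matrix_vector_right_distrib le split: split_indicator)
  also have "\<dots> = (\<integral>\<^sup>+k. J (g *v k) \<partial>Zs)"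
    by (simp add: nn_integral_cmult_indicator emeasure_unit_cube)
  finally show ?thesis .
qed

text \<open>\<open>D\<close> bounds how far smearing over the cell \<open>g *v unit_cube\<close>
  moves a point. It depends on the lattice, which does no harm because the limits are taken for each
  lattice separately.\<close>

lemma unit_cube_image_bounded:
  fixes g :: "real^'n::finite^'n"
  obtains D where "D > 0" "\<And>q i. q \<in> unit_cube \<Longrightarrow> \<bar>(g *v q) $ i\<bar> \<le> D"
proof -
  have "bounded ((\<lambda>q. g *v q) ` cbox 0 1)"
    by (intro compact_imp_bounded compact_continuous_image continuous_intros compact_cbox)
  then obtain D where D: "D > 0" "\<And>x. x \<in> (\<lambda>q. g *v q) ` cbox 0 1 \<Longrightarrow> norm x \<le> D"
    unfolding bounded_pos by auto
  have "unit_cube \<subseteq> cbox 0 (1 :: real^'n)"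
    by (auto simp: unit_cube_def mem_box_cart less_imp_le)
  then show ?thesis
    using that[of D] D component_le_norm_cart order_trans by (metis image_eqI subset_iff)
qed

section \<open>Lifting the measure to the group\<close>

lemma aff_mult_assoc: "aff_mult (aff_mult a b) c = aff_mult a (aff_mult b c)"
  by (simp add: aff_mult_def matrix_mul_assoc matrix_vector_mul_assoc matrix_vector_right_distrib)

lemma aff_mult_one [simp]: "aff_mult (mat 1, 0) b = b" "aff_mult b (mat 1, 0) = b"
  by (simp_all add: aff_mult_def)

lemma aff_mult_ASL: "a \<in> ASL \<Longrightarrow> b \<in> ASL \<Longrightarrow> aff_mult a b \<in> ASL"
  by (simp add: ASL_def aff_mult_def det_mul)

lemma ASL_inverse:
  assumes "a \<in> ASL"
  obtains h where "h \<in> ASL" "aff_mult h a = (mat 1, 0)" "aff_mult a h = (mat 1, 0)"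
proof -
  have "invertible (fst a)"
    using assms by (simp add: ASL_def invertible_det_nz)
  then obtain h where h: "fst a ** h = mat 1" "h ** fst a = mat 1"
    by (auto simp: invertible_def)
  have "det (fst a ** h) = 1" by (simp add: h)
  then have "det h = 1"
    using assms by (simp add: det_mul ASL_def)
  then show ?thesis
    using h by (intro that[of "(h, - (h *v snd a))"])
      (simp_all add: ASL_def aff_mult_def matrix_vector_mul_assoc vec.neg)
qed

lemma continuous_aff_mult:
  "continuous_on UNIV (\<lambda>x :: 'n::finite aff \<times> 'n aff. aff_mult (fst x) (snd x))"
  unfolding aff_mult_def matrix_matrix_mult_def matrix_vector_mult_def
  by (intro continuous_intros)

lemma measurable_aff_mult [measurable (raw)]:
  fixes f h :: "'a \<Rightarrow> 'n::finite aff"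
  assumes "f \<in> borel_measurable M" "h \<in> borel_measurable M"
  shows "(\<lambda>x. aff_mult (f x) (h x)) \<in> borel_measurable M"
  using borel_measurable_continuous_Pair[OF assms continuous_aff_mult] by simp

lemma closed_ASL: "closed (ASL :: 'n::finite aff set)"
proof -
  have "continuous_on UNIV (\<lambda>a :: 'n aff. det (fst a))"
    unfolding det_def by (intro continuous_intros)
  from continuous_closed_preimage_constant[OF this, of 1] show ?thesis
    by (simp add: ASL_def)
qed

lemma ASL_borel [measurable]: "ASL \<in> sets borel"
  using closed_ASL by (rule borel_closed)

lemma countable_ASL_int: "countable (ASL_int :: 'n::finite aff set)"
proof -
  have "ASL_int \<subseteq> range (\<lambda>f::'n \<Rightarrow> 'n \<Rightarrow> int. \<chi> i j. real_of_int (f i j)) \<times> integer_vectors"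
  proof
    fix c :: "'n aff" assume c: "c \<in> ASL_int"
    then have "fst c = (\<chi> i j. real_of_int \<lfloor>fst c $ i $ j\<rfloor>)"
      by (auto simp: ASL_int_def vec_eq_iff elim!: Ints_cases)
    then have "fst c \<in> range (\<lambda>f::'n \<Rightarrow> 'n \<Rightarrow> int. \<chi> i j. real_of_int (f i j))"
      by (intro image_eqI[of _ _ "\<lambda>i j. \<lfloor>fst c $ i $ j\<rfloor>"]) auto
    then show "c \<in> range (\<lambda>f::'n \<Rightarrow> 'n \<Rightarrow> int. \<chi> i j. real_of_int (f i j)) \<times> integer_vectors"
      using c by (cases c) (auto simp: ASL_int_def)
  qed
  then show ?thesis
    by (rule countable_subset) (intro countable_SIGMA countable_integer_vectors, simp)
qed

lemma ASL_int_ASL: "c \<in> ASL_int \<Longrightarrow> c \<in> ASL"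
  by (simp add: ASL_int_def)

section \<open>Fibre sums and Weil's formula\<close>

definition fibre_sum :: "('n::finite aff \<Rightarrow> ennreal) \<Rightarrow> (real^'n) set \<Rightarrow> ennreal" where
  "fibre_sum f \<Lambda> = (\<integral>\<^sup>+b. f b \<partial>count_space {b \<in> ASL. affine_lattice b = \<Lambda>})"

lemma fibre_sum_eq:
  fixes a :: "'n::finite aff"
  assumes a: "a \<in> ASL"
  shows "fibre_sum f (affine_lattice a) = (\<integral>\<^sup>+c. f (aff_mult a c) \<partial>count_space ASL_int)"
proof -
  obtain h where h: "aff_mult h a = (mat 1, 0)" using ASL_inverse[OF a] by metis
  have "inj_on (aff_mult a) ASL_int"
    by (rule inj_on_inverseI[of _ "aff_mult h"]) (simp add: aff_mult_assoc[symmetric] h)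
  moreover have "aff_mult a ` ASL_int = {b \<in> ASL. affine_lattice b = affine_lattice a}"
  proof (rule set_eqI)
    fix b
    show "b \<in> aff_mult a ` ASL_int \<longleftrightarrow> b \<in> {b \<in> ASL. affine_lattice b = affine_lattice a}"
      using affine_lattice_eq_iff[OF a, of b] aff_mult_ASL[OF a] ASL_int_ASL by blast
  qed
  ultimately have "bij_betw (aff_mult a) ASL_int {b \<in> ASL. affine_lattice b = affine_lattice a}"
    by (simp add: bij_betw_def)
  from nn_integral_bij_count_space[OF this] show ?thesis
    by (simp add: fibre_sum_def)
qed

locale affine_lattice_haar =
  fixes \<mu> :: "(real^'n::finite) set measure" and m :: "'n aff measure"
  assumes prob: "prob_space \<mu>"
    and space_mu: "space \<mu> = affine_lattices"
    and sets_mu: "sets \<mu> = affine_lattice_sets"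
    and haar: "ASL_haar_measure m"
    and weil: "\<And>E. E \<in> sets m \<Longrightarrow> emeasure m E =
         (\<integral>\<^sup>+ \<Lambda>. emeasure (count_space ASL) {a \<in> E. affine_lattice a = \<Lambda>} \<partial>\<mu>)"
begin

lemma sets_m: "sets m = sets (restrict_space borel ASL)"
  using haar by (simp add: ASL_haar_measure_def)

lemma sets_m_iff: "E \<in> sets m \<longleftrightarrow> E \<in> sets borel \<and> E \<subseteq> ASL"
  unfolding sets_m by (subst sets_restrict_space_iff) auto

lemma space_m: "space m = ASL"
  using sets_eq_imp_space_eq[OF sets_m] by (simp add: space_restrict_space)

lemma measurable_m: "f \<in> borel \<rightarrow>\<^sub>M N \<Longrightarrow> f \<in> m \<rightarrow>\<^sub>M N"
  unfolding measurable_cong_sets[OF sets_m refl] by (rule measurable_restrict_space1)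

lemma measurable_m_D:
  assumes "f \<in> m \<rightarrow>\<^sub>M N" "A \<in> sets N"
  shows "{a \<in> ASL. f a \<in> A} \<in> sets borel"
proof -
  have "f -` A \<inter> space m = {a \<in> ASL. f a \<in> A}" by (auto simp: space_m)
  then show ?thesis using measurable_sets[OF assms] by (simp add: sets_m_iff)
qed

lemma measurable_mult_m:
  assumes "h \<in> ASL"
  shows "aff_mult h \<in> m \<rightarrow>\<^sub>M m" "(\<lambda>a. aff_mult a h) \<in> m \<rightarrow>\<^sub>M m"
proof -
  have sp: "space (restrict_space borel ASL :: 'n aff measure) = ASL" by (simp add: space_restrict_space)
  have *: "f \<in> m \<rightarrow>\<^sub>M m" if "f \<in> borel \<rightarrow>\<^sub>M borel" "\<And>a. a \<in> ASL \<Longrightarrow> f a \<in> ASL" for f :: "'n aff \<Rightarrow> 'n aff"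
    unfolding measurable_cong_sets[OF sets_m sets_m]
    by (rule measurable_restrict_space2) (use that sp in \<open>auto intro: measurable_restrict_space1\<close>)
  show "aff_mult h \<in> m \<rightarrow>\<^sub>M m" by (rule *) (use aff_mult_ASL[OF assms] in auto)
  show "(\<lambda>a. aff_mult a h) \<in> m \<rightarrow>\<^sub>M m" by (rule *) (use aff_mult_ASL[OF _ assms] in auto)
qed

text \<open>\<open>affine_lattice_sets\<close> is the final sigma-algebra of
  \<open>affine_lattice\<close> on \<open>ASL\<close>, so measurability on the quotient is tested on
  the group.\<close>

lemma measurable_muI:
  fixes F :: "(real^'n) set \<Rightarrow> ennreal"
  assumes "(\<lambda>a. F (affine_lattice a)) \<in> borel_measurable m"
  shows "F \<in> borel_measurable \<mu>"
proof (rule measurableI)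
  fix A :: "ennreal set" assume A: "A \<in> sets borel"
  have "{a \<in> ASL. affine_lattice a \<in> F -` A \<inter> affine_lattices} = {a \<in> ASL. F (affine_lattice a) \<in> A}"
    by (auto simp: affine_lattices_def)
  then show "F -` A \<inter> space \<mu> \<in> sets \<mu>"
    using measurable_m_D[OF assms A] by (simp add: space_mu sets_mu affine_lattice_sets_def)
qed simp

lemma measurable_fibre_sum:
  assumes f: "f \<in> borel_measurable m"
  shows "fibre_sum f \<in> borel_measurable \<mu>" "(\<lambda>a. fibre_sum f (affine_lattice a)) \<in> borel_measurable m"
proof -
  have "(\<lambda>a. \<integral>\<^sup>+c. f (aff_mult a c) \<partial>count_space ASL_int) \<in> borel_measurable m"
    by (rule measurable_count_space_sum[OF countable_ASL_int])
       (use measurable_compose[OF measurable_mult_m(2) f] ASL_int_ASL in auto)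
  then show "(\<lambda>a. fibre_sum f (affine_lattice a)) \<in> borel_measurable m"
    by (subst measurable_cong[of m _ "\<lambda>a. \<integral>\<^sup>+c. f (aff_mult a c) \<partial>count_space ASL_int"])
       (auto simp: space_m fibre_sum_eq)
  then show "fibre_sum f \<in> borel_measurable \<mu>" by (rule measurable_muI)
qed

text \<open>Indicators are the assumption \<open>weil\<close>; both sides are additive, homogeneous
  and continuous along increasing sequences.\<close>

lemma weil_formula:
  assumes "f \<in> borel_measurable m"
  shows "(\<integral>\<^sup>+a. f a \<partial>m) = (\<integral>\<^sup>+\<Lambda>. fibre_sum f \<Lambda> \<partial>\<mu>)"
  using assms
proof (induction f rule: borel_measurable_induct)
  case (cong f g)
  then have "fibre_sum f \<Lambda> = fibre_sum g \<Lambda>" for \<Lambda>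
    unfolding fibre_sum_def by (intro nn_integral_cong) (auto simp: space_m)
  moreover have "(\<integral>\<^sup>+a. f a \<partial>m) = (\<integral>\<^sup>+a. g a \<partial>m)"
    using cong by (intro nn_integral_cong) auto
  ultimately show ?case using cong.IH cong by (metis nn_integral_cong)
next
  case (set A)
  have "fibre_sum (indicator A) \<Lambda> = emeasure (count_space ASL) {a \<in> A. affine_lattice a = \<Lambda>}" for \<Lambda>
  proof -
    have sub: "A \<subseteq> ASL" using set by (simp add: sets_m_iff)
    have "fibre_sum (indicator A) \<Lambda> = (\<integral>\<^sup>+b. indicator {a \<in> A. affine_lattice a = \<Lambda>} b \<partial>count_space {b \<in> ASL. affine_lattice b = \<Lambda>})"
      unfolding fibre_sum_def by (intro nn_integral_cong) (auto simp: indicator_def)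
    also have "\<dots> = emeasure (count_space {b \<in> ASL. affine_lattice b = \<Lambda>}) {a \<in> A. affine_lattice a = \<Lambda>}"
      using sub by (intro nn_integral_indicator) auto
    also have "\<dots> = emeasure (count_space ASL) {a \<in> A. affine_lattice a = \<Lambda>}"
    proof -
      have "{a \<in> A. affine_lattice a = \<Lambda>} \<subseteq> {b \<in> ASL. affine_lattice b = \<Lambda>}" "{a \<in> A. affine_lattice a = \<Lambda>} \<subseteq> ASL"
        using sub by auto
      then show ?thesis by (simp only: emeasure_count_space)
    qed
    finally show ?thesis .
  qed
  then show ?case using weil[OF set] set by simp
next
  case (mult u c)
  then show ?case
    by (simp add: nn_integral_cmult fibre_sum_def measurable_fibre_sum[unfolded fibre_sum_def[abs_def]])
next
  case (add u v)
  have "fibre_sum (\<lambda>x. v x + u x) \<Lambda> = fibre_sum v \<Lambda> + fibre_sum u \<Lambda>" for \<Lambda>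
    unfolding fibre_sum_def by (rule nn_integral_add) auto
  then show ?case using add
    by (simp add: nn_integral_add measurable_fibre_sum)
next
  case (seq U)
  have mono: "incseq (\<lambda>i. fibre_sum (U i))"
    using seq unfolding fibre_sum_def incseq_def le_fun_def by (auto intro!: nn_integral_mono)
  have "fibre_sum (SUP i. U i) \<Lambda> = (SUP i. fibre_sum (U i) \<Lambda>)" for \<Lambda>
    unfolding fibre_sum_def SUP_apply
    by (rule nn_integral_monotone_convergence_SUP) (use seq in auto)
  then have "(\<integral>\<^sup>+\<Lambda>. fibre_sum (SUP i. U i) \<Lambda> \<partial>\<mu>) = (SUP i. \<integral>\<^sup>+\<Lambda>. fibre_sum (U i) \<Lambda> \<partial>\<mu>)"
    using mono by (simp add: nn_integral_monotone_convergence_SUP measurable_fibre_sum seq)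
  moreover have "(\<integral>\<^sup>+a. (SUP i. U i) a \<partial>m) = (SUP i. \<integral>\<^sup>+a. U i a \<partial>m)"
    unfolding SUP_apply by (rule nn_integral_monotone_convergence_SUP) (use seq in auto)
  ultimately show ?case by (simp only: seq)
qed

lemma nn_integral_left_mult:
  assumes f: "f \<in> borel_measurable m" and h: "h \<in> ASL"
  shows "(\<integral>\<^sup>+a. f (aff_mult h a) \<partial>m) = (\<integral>\<^sup>+a. f a \<partial>m)"
proof -
  obtain h' where h': "h' \<in> ASL" "aff_mult h' h = (mat 1, 0)" "aff_mult h h' = (mat 1, 0)"
    using ASL_inverse[OF h] by metis
  have "distr m m (aff_mult h) = m"
  proof (rule measure_eqI)
    fix E assume "E \<in> sets (distr m m (aff_mult h))"
    then have E: "E \<in> sets m" "E \<subseteq> ASL" by (auto simp: sets_m_iff)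
    have "aff_mult h -` E \<inter> space m = aff_mult h' ` E"
    proof (intro equalityI subsetI)
      fix a assume "a \<in> aff_mult h -` E \<inter> space m"
      then show "a \<in> aff_mult h' ` E"
        by (intro image_eqI[of _ _ "aff_mult h a"]) (simp_all add: aff_mult_assoc[symmetric] h')
    next
      fix b assume "b \<in> aff_mult h' ` E"
      then obtain a where a: "a \<in> E" "b = aff_mult h' a" by blast
      then have "aff_mult h b = a" by (simp add: aff_mult_assoc[symmetric] h')
      moreover have "b \<in> ASL" using a E h'(1) aff_mult_ASL by blast
      ultimately show "b \<in> aff_mult h -` E \<inter> space m" using a by (simp add: space_m)
    qed
    then show "emeasure (distr m m (aff_mult h)) E = emeasure m E"
      using haar h' E by (simp add: emeasure_distr measurable_mult_m[OF h] ASL_haar_measure_def)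
  qed simp
  then have "(\<integral>\<^sup>+a. f a \<partial>m) = (\<integral>\<^sup>+a. f a \<partial>distr m m (aff_mult h))" by simp
  also have "\<dots> = (\<integral>\<^sup>+a. f (aff_mult h a) \<partial>m)"
    using f by (intro nn_integral_distr measurable_mult_m[OF h]) simp
  finally show ?thesis ..
qed

text \<open>This provides the strictly positive integrable function from which the lift is built.
  The exhausting sets are compact because \<open>ASL\<close> is closed.\<close>

lemma sigma_finite_m: "sigma_finite_measure m"
proof
  show "\<exists>A. countable A \<and> A \<subseteq> sets m \<and> \<Union>A = space m \<and> (\<forall>a\<in>A. emeasure m a \<noteq> \<infinity>)"
  proof (intro exI conjI ballI)
    let ?A = "range (\<lambda>n::nat. ASL \<inter> cball 0 (real n) :: 'n aff set)"
    show "countable ?A" by simp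
    show "?A \<subseteq> sets m"
      using closed_ASL by (auto simp: sets_m_iff)
    show "\<Union>?A = space m"
      by (auto simp: space_m real_arch_simple)
    fix a assume "a \<in> ?A"
    then have "compact a" "a \<subseteq> ASL" using closed_ASL by (auto intro: closed_Int_compact)
    then show "emeasure m a \<noteq> \<infinity>"
      using haar by (auto simp: ASL_haar_measure_def less_top)
  qed
qed

end

section \<open>Functions of the lattice and measures that average them\<close>

text \<open>By \<open>affine_lattice_eq_iff\<close> these are the Borel functions whose restriction
  to \<open>ASL\<close> depends on the lattice alone.\<close>

definition right_invariant :: "('n::finite aff \<Rightarrow> ennreal) \<Rightarrow> bool" where
  "right_invariant \<Phi> \<longleftrightarrow> \<Phi> \<in> borel_measurable borel \<and> (\<forall>a\<in>ASL. \<forall>c\<in>ASL_int. \<Phi> (aff_mult a c) = \<Phi> a)"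

text \<open>\<open>ASL\<close> is not compact, so no probability measure on it is left invariant.
  Invariance is therefore required only for integrals of functions of the lattice.\<close>

locale ASL_average =
  fixes P :: "'n::finite aff measure"
  assumes prob_space_P: "prob_space P"
    and sets_P [measurable_cong]: "sets P = sets borel"
    and AE_ASL: "AE a in P. a \<in> ASL"
    and left_invariant: "\<And>\<Phi> h. right_invariant \<Phi> \<Longrightarrow> h \<in> ASL \<Longrightarrow>
       (\<integral>\<^sup>+a. \<Phi> (aff_mult h a) \<partial>P) = (\<integral>\<^sup>+a. \<Phi> a \<partial>P)"

context affine_lattice_haar begin

text \<open>
  The lift has density \<open>w / \<tau>\<close> with respect to \<open>m\<close>, where \<open>w > 0\<close> is integrable and \<open>\<tau>\<close> is its fibre sum.
\<close>

lemma lift_ex: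
  "\<exists>P :: 'n aff measure. ASL_average P \<and>
     (\<forall>S\<in>sets \<mu>. emeasure P {a \<in> ASL. affine_lattice a \<in> S} = emeasure \<mu> S)"
proof -
  obtain w where w [measurable]: "w \<in> borel_measurable m" and wfin: "(\<integral>\<^sup>+a. w a \<partial>m) \<noteq> \<infinity>"
    and wpos: "\<And>a. a \<in> space m \<Longrightarrow> 0 < w a \<and> w a < \<infinity>"
    using sigma_finite_measure.Ex_finite_integrable_function[OF sigma_finite_m] by blast
  define \<tau> where "\<tau> = fibre_sum w"
  note [measurable] = measurable_fibre_sum[OF w, folded \<tau>_def]
  have tau_fin: "AE \<Lambda> in \<mu>. \<tau> \<Lambda> \<noteq> \<infinity>"
    by (rule nn_integral_PInf_AE) (use wfin weil_formula[OF w] in \<open>auto simp: \<tau>_def[symmetric]\<close>)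
  have tau_pos: "\<tau> (affine_lattice a) \<noteq> 0" if "a \<in> ASL" for a
  proof
    assume "\<tau> (affine_lattice a) = 0"
    then have "\<forall>b\<in>{b \<in> ASL. affine_lattice b = affine_lattice a}. w b = 0"
      unfolding \<tau>_def fibre_sum_def by (subst (asm) nn_integral_0_iff_AE) (auto simp: AE_count_space)
    then have "w a = 0" using that by blast
    then show False using wpos[of a] that by (simp add: space_m)
  qed
  define \<phi> where "\<phi> a = w a / \<tau> (affine_lattice a)" for a
  have [measurable]: "\<phi> \<in> borel_measurable m"
    unfolding \<phi>_def[abs_def] by measurable
  have fibre_phi: "fibre_sum \<phi> \<Lambda> = 1" if "\<Lambda> \<in> affine_lattices" "\<tau> \<Lambda> \<noteq> \<infinity>" for \<Lambda>
  proof -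
    have "fibre_sum \<phi> \<Lambda> = (\<integral>\<^sup>+b. w b / \<tau> \<Lambda> \<partial>count_space {b \<in> ASL. affine_lattice b = \<Lambda>})"
      unfolding fibre_sum_def \<phi>_def by (intro nn_integral_cong) auto
    also have "\<dots> = \<tau> \<Lambda> / \<tau> \<Lambda>"
      unfolding \<tau>_def by (subst nn_integral_divide) (auto simp: fibre_sum_def)
    also have "\<dots> = 1"
      using that tau_pos by (auto simp: affine_lattices_def ennreal_divide_self less_top)
    finally show ?thesis .
  qed
  define P where "P = distr (density m \<phi>) borel (\<lambda>a. a)"
  have idm: "(\<lambda>a. a) \<in> m \<rightarrow>\<^sub>M borel" by (rule measurable_m) simp
  have intP: "(\<integral>\<^sup>+a. f a \<partial>P) = (\<integral>\<^sup>+a. \<phi> a * f a \<partial>m)" if "f \<in> borel_measurable borel" for f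
    unfolding P_def using that idm measurable_m[OF that]
    by (simp add: nn_integral_distr nn_integral_density)
  \<comment> \<open>For \<open>h\<close> the identity this says that \<open>P\<close> projects to
    \<open>\<mu>\<close>. For general \<open>h\<close> it says that the translated density still has
    fibre sum 1 almost everywhere, which is the source of the invariance of
    \<open>P\<close>.\<close>
  have down: "(\<integral>\<^sup>+a. \<phi> (aff_mult h a) * F (affine_lattice a) \<partial>m) = (\<integral>\<^sup>+\<Lambda>. F \<Lambda> \<partial>\<mu>)"
    if h: "h \<in> ASL" and F [measurable]: "(\<lambda>a. F (affine_lattice a)) \<in> borel_measurable m" for F h
  proof -
    obtain h' where h': "h' \<in> ASL" "aff_mult h' h = (mat 1, 0)" "aff_mult h h' = (mat 1, 0)"
      using ASL_inverse[OF h] by metis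
    have [measurable]: "(\<lambda>a. \<phi> (aff_mult h a)) \<in> borel_measurable m"
      by (rule measurable_compose[OF measurable_mult_m(1)[OF h]]) simp
    \<comment> \<open>The lattices with infinite \<open>\<tau>\<close> are null for
      \<open>\<mu>\<close>, but their translates by \<open>h\<close> have to be null as well, and no
      invariance of \<open>\<mu>\<close> is available yet. Weil's formula moves the question to
      \<open>m\<close>, where left invariance holds, and back again.\<close>
    define D where "D = {a \<in> ASL. \<tau> (affine_lattice a) = \<infinity>}"
    have Dm [measurable]: "D \<in> sets m"
    proof -
      have "D = {a \<in> space m. \<tau> (affine_lattice a) = \<infinity>}" by (simp add: D_def space_m)
      then show ?thesis by simp
    qed
    have "(\<integral>\<^sup>+\<Lambda>. fibre_sum (indicator D) \<Lambda> \<partial>\<mu>) = (\<integral>\<^sup>+\<Lambda>. 0 \<partial>\<mu>)"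
    proof (rule nn_integral_cong_AE, use tau_fin in eventually_elim)
      fix \<Lambda> assume "\<tau> \<Lambda> \<noteq> \<infinity>"
      then have "fibre_sum (indicator D) \<Lambda> = (\<integral>\<^sup>+b. 0 \<partial>count_space {b \<in> ASL. affine_lattice b = \<Lambda>})"
        unfolding fibre_sum_def by (intro nn_integral_cong) (auto simp: D_def)
      then show "fibre_sum (indicator D) \<Lambda> = 0" by simp
    qed
    then have "(\<integral>\<^sup>+a. indicator D a \<partial>m) = 0"
      using weil_formula[of "indicator D"] by simp
    then have "(\<integral>\<^sup>+a. indicator D (aff_mult h a) \<partial>m) = 0"
      using nn_integral_left_mult[OF _ h, of "indicator D"] by simp
    moreover have mD: "(\<lambda>a. indicator D (aff_mult h a) :: ennreal) \<in> borel_measurable m"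
      by (rule measurable_compose[OF measurable_mult_m(1)[OF h]]) simp
    ultimately have "(\<integral>\<^sup>+\<Lambda>. fibre_sum (\<lambda>a. indicator D (aff_mult h a)) \<Lambda> \<partial>\<mu>) = 0"
      using weil_formula[OF mD] by simp
    then have AE: "AE \<Lambda> in \<mu>. fibre_sum (\<lambda>a. indicator D (aff_mult h a)) \<Lambda> = 0"
      using measurable_fibre_sum(1)[OF mD] by (subst (asm) nn_integral_0_iff_AE) auto
    have "(\<integral>\<^sup>+a. \<phi> (aff_mult h a) * F (affine_lattice a) \<partial>m) =
       (\<integral>\<^sup>+\<Lambda>. fibre_sum (\<lambda>a. \<phi> (aff_mult h a) * F (affine_lattice a)) \<Lambda> \<partial>\<mu>)"
      by (rule weil_formula) measurable
    also have "\<dots> = (\<integral>\<^sup>+\<Lambda>. F \<Lambda> \<partial>\<mu>)"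
    proof (rule nn_integral_cong_AE, use AE AE_space in eventually_elim)
      fix \<Lambda> assume 0: "fibre_sum (\<lambda>a. indicator D (aff_mult h a)) \<Lambda> = 0" and "\<Lambda> \<in> space \<mu>"
      then obtain a where a: "a \<in> ASL" "\<Lambda> = affine_lattice a"
        by (auto simp: space_mu affine_lattices_def)
      have ha: "aff_mult h a \<in> ASL" using a h by (simp add: aff_mult_ASL)
      have "indicator D (aff_mult h b) = (0::ennreal)" if "b \<in> ASL" "affine_lattice b = \<Lambda>" for b
      proof -
        have "\<forall>b\<in>{b \<in> ASL. affine_lattice b = \<Lambda>}. indicator D (aff_mult h b) = (0::ennreal)"
          using 0 unfolding fibre_sum_def by (subst (asm) nn_integral_0_iff_AE) (auto simp: AE_count_space)
        then show ?thesis using that by blast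
      qed
      then have "aff_mult h a \<notin> D" using a by (auto simp: indicator_def split: if_splits)
      then have tf: "\<tau> (affine_lattice (aff_mult h a)) \<noteq> \<infinity>" using ha by (simp add: D_def)
      have "fibre_sum (\<lambda>a. \<phi> (aff_mult h a) * F (affine_lattice a)) \<Lambda> =
          (\<integral>\<^sup>+b. \<phi> (aff_mult h b) * F \<Lambda> \<partial>count_space {b \<in> ASL. affine_lattice b = \<Lambda>})"
        unfolding fibre_sum_def by (intro nn_integral_cong) auto
      also have "\<dots> = fibre_sum (\<lambda>b. \<phi> (aff_mult h b)) \<Lambda> * F \<Lambda>"
        unfolding fibre_sum_def by (rule nn_integral_multc) simp
      also have "fibre_sum (\<lambda>b. \<phi> (aff_mult h b)) \<Lambda> = fibre_sum \<phi> (affine_lattice (aff_mult h a))"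
        unfolding a fibre_sum_eq[OF a(1)] fibre_sum_eq[OF ha] by (simp add: aff_mult_assoc)
      also have "\<dots> = 1" using ha tf by (intro fibre_phi) (auto simp: affine_lattices_def)
      finally show "fibre_sum (\<lambda>a. \<phi> (aff_mult h a) * F (affine_lattice a)) \<Lambda> = F \<Lambda>" by simp
    qed
    finally show ?thesis .
  qed
  have one_ASL: "(mat 1, 0) \<in> (ASL :: 'n aff set)" by (simp add: ASL_def)
  have S: "emeasure P {a \<in> ASL. affine_lattice a \<in> S} = emeasure \<mu> S" if S: "S \<in> sets \<mu>" for S
  proof -
    have B [measurable]: "{a \<in> ASL. affine_lattice a \<in> S} \<in> sets borel"
      using S by (simp add: sets_mu affine_lattice_sets_def)
    have sm: "(\<lambda>a. indicator S (affine_lattice a) :: ennreal) \<in> borel_measurable m"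
      by (subst measurable_cong[of m _ "indicator {a \<in> ASL. affine_lattice a \<in> S}"])
         (auto simp: space_m indicator_def intro!: measurable_m)
    have "emeasure P {a \<in> ASL. affine_lattice a \<in> S} = (\<integral>\<^sup>+a. indicator {a \<in> ASL. affine_lattice a \<in> S} a \<partial>P)"
      by (subst nn_integral_indicator) (auto simp: P_def)
    also have "\<dots> = (\<integral>\<^sup>+a. \<phi> a * indicator {a \<in> ASL. affine_lattice a \<in> S} a \<partial>m)"
      by (rule intP) measurable
    also have "\<dots> = (\<integral>\<^sup>+a. \<phi> (aff_mult (mat 1, 0) a) * indicator S (affine_lattice a) \<partial>m)"
      by (intro nn_integral_cong) (auto simp: space_m indicator_def)
    also have "\<dots> = (\<integral>\<^sup>+\<Lambda>. indicator S \<Lambda> \<partial>\<mu>)" by (rule down[OF one_ASL sm])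
    finally show ?thesis using S by simp
  qed
  have PA: "emeasure P ASL = 1"
  proof -
    have "{a \<in> ASL. affine_lattice a \<in> space \<mu>} = ASL" by (auto simp: space_mu affine_lattices_def)
    then show ?thesis using S[of "space \<mu>"] prob by (simp add: prob_space.emeasure_space_1)
  qed
  have sP: "sets P = sets borel" "space P = UNIV" by (auto simp: P_def)
  have AEP: "AE a in P. a \<in> ASL"
  proof -
    have "AE a in density m \<phi>. a \<in> ASL"
      using AE_space[of "density m \<phi>"] by (simp add: space_m)
    then show ?thesis
      unfolding P_def using idm ASL_borel by (subst AE_distr_iff) auto
  qed
  have PP: "prob_space P"
  proof
    have "emeasure P (space P) = emeasure P ASL"
      by (rule emeasure_eq_AE) (use AEP in \<open>auto simp: sP\<close>)
    then show "emeasure P (space P) = 1" using PA by simp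
  qed
  have inv: "(\<integral>\<^sup>+a. \<Phi> (aff_mult h a) \<partial>P) = (\<integral>\<^sup>+a. \<Phi> a \<partial>P)" if \<Phi>: "right_invariant \<Phi>" and h: "h \<in> ASL" for \<Phi> h
  proof -
    have [measurable]: "\<Phi> \<in> borel_measurable borel" using \<Phi> by (simp add: right_invariant_def)
    note Pm = measurable_m[OF this]
    obtain h' where h': "h' \<in> ASL" "aff_mult h' h = (mat 1, 0)" "aff_mult h h' = (mat 1, 0)"
      using ASL_inverse[OF h] by metis
    \<comment> \<open>\<open>\<Phi>\<close> as a function on the quotient; right invariance makes
      the choice of the representative immaterial.\<close>
    define F where "F \<Lambda> = \<Phi> (SOME a. a \<in> ASL \<and> affine_lattice a = \<Lambda>)" for \<Lambda>
    have F: "F (affine_lattice a) = \<Phi> a" if a: "a \<in> ASL" for a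
    proof -
      let ?b = "SOME b. b \<in> ASL \<and> affine_lattice b = affine_lattice a"
      have "?b \<in> ASL \<and> affine_lattice ?b = affine_lattice a" by (rule someI[of _ a]) (simp add: a)
      then obtain c where "c \<in> ASL_int" "?b = aff_mult a c" using affine_lattice_eq_iff[OF a, of ?b] by blast
      then show ?thesis using \<Phi> a by (simp add: F_def right_invariant_def)
    qed
    have Fm: "(\<lambda>a. F (affine_lattice a)) \<in> borel_measurable m"
      by (subst measurable_cong[of m _ \<Phi>]) (auto simp: space_m F Pm)
    have "(\<integral>\<^sup>+a. \<Phi> (aff_mult h a) \<partial>P) = (\<integral>\<^sup>+a. \<phi> a * \<Phi> (aff_mult h a) \<partial>m)"
      by (rule intP) measurable
    \<comment> \<open>With the inverse inserted, the integrand is a function of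
      \<open>aff_mult h a\<close>, so left invariance of \<open>m\<close> shifts the translation
      from \<open>\<Phi>\<close> to the density.\<close>
    also have "\<dots> = (\<integral>\<^sup>+a. \<phi> (aff_mult h' (aff_mult h a)) * \<Phi> (aff_mult h a) \<partial>m)"
      by (simp add: aff_mult_assoc[symmetric] h')
    also have "\<dots> = (\<integral>\<^sup>+a. \<phi> (aff_mult h' a) * \<Phi> a \<partial>m)"
      using measurable_compose[OF measurable_mult_m(1)[OF h'(1)], of \<phi>] Pm
      by (intro nn_integral_left_mult[OF _ h, of "\<lambda>a. \<phi> (aff_mult h' a) * \<Phi> a"]) auto
    also have "\<dots> = (\<integral>\<^sup>+a. \<phi> (aff_mult h' a) * F (affine_lattice a) \<partial>m)"
      by (intro nn_integral_cong) (auto simp: space_m F)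
    also have "\<dots> = (\<integral>\<^sup>+\<Lambda>. F \<Lambda> \<partial>\<mu>)" by (rule down[OF h'(1) Fm])
    also have "\<dots> = (\<integral>\<^sup>+a. \<phi> (aff_mult (mat 1, 0) a) * F (affine_lattice a) \<partial>m)"
      by (rule down[OF one_ASL Fm, symmetric])
    also have "\<dots> = (\<integral>\<^sup>+a. \<phi> a * \<Phi> a \<partial>m)"
      by (intro nn_integral_cong) (auto simp: space_m F)
    also have "\<dots> = (\<integral>\<^sup>+a. \<Phi> a \<partial>P)" by (rule intP[symmetric]) measurable
    finally show ?thesis .
  qed
  show ?thesis
    using PP sP AEP S inv by (intro exI[of _ P]) (auto simp: ASL_average_def)
qed

end

section \<open>Averaging\<close>

lemma nn_integral_SUP_min:
  fixes f :: "'a \<Rightarrow> ennreal"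
  assumes [measurable]: "f \<in> borel_measurable M"
  shows "(\<integral>\<^sup>+x. f x \<partial>M) = (SUP k::nat. \<integral>\<^sup>+x. min (of_nat k) (f x) \<partial>M)"
proof -
  have "(SUP k::nat. min (of_nat k) y) = y" for y :: ennreal
  proof (rule antisym)
    show "(SUP k::nat. min (of_nat k) y) \<le> y" by (rule SUP_least) simp
    show "y \<le> (SUP k::nat. min (of_nat k) y)"
    proof (cases "y = \<top>")
      case True
      then show ?thesis by (simp add: ennreal_SUP_of_nat_eq_top)
    next
      case False
      then obtain k :: nat where "y \<le> of_nat k" by (metis ennreal_Ex_less_of_nat less_imp_le less_top)
      then have "y = min (of_nat k) y" by (simp add: min_absorb2)
      then show ?thesis by (metis SUP_upper UNIV_I)
    qed
  qed
  then have "(\<integral>\<^sup>+x. f x \<partial>M) = (\<integral>\<^sup>+x. (SUP k::nat. min (of_nat k) (f x)) \<partial>M)" by simp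
  also have "\<dots> = (SUP k::nat. \<integral>\<^sup>+x. min (of_nat k) (f x) \<partial>M)"
    by (rule nn_integral_monotone_convergence_SUP)
       (auto simp: incseq_def le_fun_def intro: min.coboundedI1)
  finally show ?thesis .
qed

context ASL_average
begin

sublocale prob_space P by (rule prob_space_P)

text \<open>
  The limit exchanges with \<open>P\<close> although \<open>\<Phi>\<close> is not known to be integrable: one direction is Fatou,
  and the other is bounded convergence for the truncations \<open>min k \<Phi>\<close>, which are invariant as well.
  This replaces the reduction theory otherwise needed for the integrability of Siegel transforms.
\<close>

lemma nn_integral_average:
  fixes \<Theta> :: "nat \<Rightarrow> 't measure" and h :: "'t \<Rightarrow> 'n aff"
  assumes inv: "right_invariant \<Phi>" and prob: "\<And>n. prob_space (\<Theta> n)"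
    and h: "\<And>n. h \<in> borel_measurable (\<Theta> n)" "\<And>t. h t \<in> ASL"
    and lim: "\<And>a. a \<in> ASL \<Longrightarrow> (\<lambda>n. \<integral>\<^sup>+t. \<Phi> (aff_mult (h t) a) \<partial>\<Theta> n) \<longlonglongrightarrow> \<Psi> a"
    and \<Psi> [measurable]: "\<Psi> \<in> borel_measurable borel"
  shows "(\<integral>\<^sup>+a. \<Phi> a \<partial>P) = (\<integral>\<^sup>+a. \<Psi> a \<partial>P)"
proof -
  have m [measurable]: "\<Phi> \<in> borel_measurable borel" using inv by (simp add: right_invariant_def)
  note [measurable] = h(1)
  define G where "G n a = (\<integral>\<^sup>+t. \<Phi> (aff_mult (h t) a) \<partial>\<Theta> n)" for n a
  have sf: "sigma_finite_measure (\<Theta> n)" for n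
    using prob by (simp add: prob_space_imp_sigma_finite)
  have Gm [measurable]: "G n \<in> borel_measurable borel" for n
    unfolding G_def[abs_def] by (rule sigma_finite_measure.borel_measurable_nn_integral[OF sf]) measurable
  have avg: "(\<integral>\<^sup>+a. (\<integral>\<^sup>+t. X (aff_mult (h t) a) \<partial>\<Theta> n) \<partial>P) = (\<integral>\<^sup>+a. X a \<partial>P)"
    if X: "right_invariant X" for X n
  proof -
    interpret T: prob_space "\<Theta> n" by (rule prob)
    interpret pair_sigma_finite "\<Theta> n" P ..
    have [measurable]: "X \<in> borel_measurable borel" using X by (simp add: right_invariant_def)
    have "(\<integral>\<^sup>+a. (\<integral>\<^sup>+t. X (aff_mult (h t) a) \<partial>\<Theta> n) \<partial>P) = (\<integral>\<^sup>+t. (\<integral>\<^sup>+a. X (aff_mult (h t) a) \<partial>P) \<partial>\<Theta> n)"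
      by (rule Fubini') measurable
    also have "\<dots> = (\<integral>\<^sup>+t. (\<integral>\<^sup>+a. X a \<partial>P) \<partial>\<Theta> n)"
      by (intro nn_integral_cong left_invariant[OF X] h)
    also have "\<dots> = (\<integral>\<^sup>+a. X a \<partial>P)" by (simp add: T.emeasure_space_1)
    finally show ?thesis .
  qed
  have "(\<integral>\<^sup>+a. \<Psi> a \<partial>P) = (\<integral>\<^sup>+a. liminf (\<lambda>n. G n a) \<partial>P)"
    by (rule nn_integral_cong_AE, use AE_ASL in eventually_elim)
       (use lim in \<open>auto simp: G_def intro!: lim_imp_Liminf[symmetric]\<close>)
  also have "\<dots> \<le> liminf (\<lambda>n. \<integral>\<^sup>+a. G n a \<partial>P)"
    by (rule nn_integral_liminf) measurable
  also have "\<dots> = (\<integral>\<^sup>+a. \<Phi> a \<partial>P)"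
    unfolding G_def by (simp add: avg[OF inv] Liminf_const)
  finally have 1: "(\<integral>\<^sup>+a. \<Psi> a \<partial>P) \<le> (\<integral>\<^sup>+a. \<Phi> a \<partial>P)" .
  have "(\<integral>\<^sup>+a. min (of_nat k) (\<Phi> a) \<partial>P) \<le> (\<integral>\<^sup>+a. \<Psi> a \<partial>P)" for k :: nat
  proof -
    have "(\<lambda>n. \<integral>\<^sup>+a. min (of_nat k) (G n a) \<partial>P) \<longlonglongrightarrow> (\<integral>\<^sup>+a. min (of_nat k) (\<Psi> a) \<partial>P)"
    proof (rule nn_integral_dominated_convergence[where w = "\<lambda>_. of_nat k"])
      show "AE a in P. (\<lambda>n. min (of_nat k) (G n a)) \<longlonglongrightarrow> min (of_nat k) (\<Psi> a)"
        using AE_ASL by eventually_elim (use lim in \<open>auto simp: G_def intro!: tendsto_min\<close>)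
    qed (auto simp: emeasure_space_1 of_nat_less_top)
    \<comment> \<open>Truncation is concave: the average of the truncations is at most the
      truncation of the average.\<close>
    moreover have "(\<integral>\<^sup>+a. min (of_nat k) (\<Phi> a) \<partial>P) \<le> (\<integral>\<^sup>+a. min (of_nat k) (G n a) \<partial>P)" for n
    proof -
      have X: "right_invariant (\<lambda>a. min (of_nat k) (\<Phi> a))"
        using inv by (simp add: right_invariant_def)
      interpret T: prob_space "\<Theta> n" by (rule prob)
      have "(\<integral>\<^sup>+a. min (of_nat k) (\<Phi> a) \<partial>P) =
          (\<integral>\<^sup>+a. (\<integral>\<^sup>+t. min (of_nat k) (\<Phi> (aff_mult (h t) a)) \<partial>\<Theta> n) \<partial>P)"
        by (rule avg[OF X, symmetric])
      also have "\<dots> \<le> (\<integral>\<^sup>+a. min (of_nat k) (G n a) \<partial>P)"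
      proof (intro nn_integral_mono min.boundedI)
        fix a
        have "(\<integral>\<^sup>+t. min (of_nat k) (\<Phi> (aff_mult (h t) a)) \<partial>\<Theta> n) \<le> (\<integral>\<^sup>+t. of_nat k \<partial>\<Theta> n)"
          by (intro nn_integral_mono) simp
        then show "(\<integral>\<^sup>+t. min (of_nat k) (\<Phi> (aff_mult (h t) a)) \<partial>\<Theta> n) \<le> of_nat k"
          by (simp add: T.emeasure_space_1)
        show "(\<integral>\<^sup>+t. min (of_nat k) (\<Phi> (aff_mult (h t) a)) \<partial>\<Theta> n) \<le> G n a"
          unfolding G_def by (intro nn_integral_mono) simp
      qed
      finally show ?thesis .
    qed
    ultimately have "(\<integral>\<^sup>+a. min (of_nat k) (\<Phi> a) \<partial>P) \<le> (\<integral>\<^sup>+a. min (of_nat k) (\<Psi> a) \<partial>P)"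
      by (intro LIMSEQ_le_const) auto
    also have "\<dots> \<le> (\<integral>\<^sup>+a. \<Psi> a \<partial>P)" by (intro nn_integral_mono) simp
    finally show ?thesis .
  qed
  then have "(\<integral>\<^sup>+a. \<Phi> a \<partial>P) \<le> (\<integral>\<^sup>+a. \<Psi> a \<partial>P)"
    by (subst nn_integral_SUP_min) (auto intro!: SUP_least)
  with 1 show ?thesis by simp
qed

end

lemma borel_measurable_fst_snd [measurable (raw)]:
  fixes f :: "'a \<Rightarrow> 'b::second_countable_topology \<times> 'c::second_countable_topology"
  assumes "f \<in> borel_measurable M"
  shows "(\<lambda>x. fst (f x)) \<in> borel_measurable M" "(\<lambda>x. snd (f x)) \<in> borel_measurable M"
proof -
  show "(\<lambda>x. fst (f x)) \<in> borel_measurable M"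
    by (rule borel_measurable_continuous_on[OF continuous_on_fst[OF continuous_on_id] assms])
  show "(\<lambda>x. snd (f x)) \<in> borel_measurable M"
    by (rule borel_measurable_continuous_on[OF continuous_on_snd[OF continuous_on_id] assms])
qed

section \<open>Pair sums and averages over translations\<close>

text \<open>An ordered pair of lattice points is encoded by its first point and the difference
  vector, so that translations act on the first entry only.\<close>

definition pair_sum :: "((real^'n) \<times> (real^'n) \<Rightarrow> ennreal) \<Rightarrow> 'n::finite aff \<Rightarrow> ennreal" where
  "pair_sum f a = (\<integral>\<^sup>+l. \<integral>\<^sup>+k. f (aff_act a k, fst a *v l) \<partial>Zs \<partial>Zs)"

lemma bij_aff_act_integer_vectors:
  fixes c :: "'n::finite aff"
  assumes "c \<in> ASL_int"
  shows "bij_betw (aff_act c) integer_vectors integer_vectors"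
proof -
  obtain h where h: "aff_mult h c = (mat 1, 0)" using ASL_inverse[OF ASL_int_ASL[OF assms]] by metis
  have "aff_act h (aff_act c v) = v" for v
    by (simp add: aff_act_mult[symmetric] h) (simp add: aff_act_def)
  then have "inj_on (aff_act c) integer_vectors" by (rule inj_on_inverseI)
  then show ?thesis
    using affine_lattice_ASL_int[OF assms] by (simp add: bij_betw_def affine_lattice_def)
qed

lemma bij_linear_integer_vectors:
  fixes c :: "'n::finite aff"
  assumes "c \<in> ASL_int"
  shows "bij_betw (\<lambda>l. fst c *v l) integer_vectors integer_vectors"
proof -
  have "(fst c, 0) \<in> ASL_int" using assms by (simp add: ASL_int_def ASL_def integer_vectors_def)
  from bij_aff_act_integer_vectors[OF this] show ?thesis by (simp add: aff_act_def[abs_def])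
qed

lemma pair_sum_measurable [measurable]:
  assumes [measurable]: "f \<in> borel_measurable borel"
  shows "pair_sum f \<in> borel_measurable borel"
  unfolding pair_sum_def[abs_def] aff_act_def
  by (intro measurable_count_space_sum countable_integer_vectors) measurable

lemma right_invariant_pair_sum:
  assumes "f \<in> borel_measurable borel"
  shows "right_invariant (pair_sum f)"
  unfolding right_invariant_def
proof (intro conjI ballI)
  fix a c :: "'a aff" assume c: "c \<in> ASL_int"
  have "pair_sum f (aff_mult a c) = (\<integral>\<^sup>+l. \<integral>\<^sup>+k. f (aff_act a (aff_act c k), fst a *v (fst c *v l)) \<partial>Zs \<partial>Zs)"
    unfolding pair_sum_def aff_act_mult by (simp add: aff_mult_def matrix_vector_mul_assoc)
  also have "\<dots> = (\<integral>\<^sup>+l. \<integral>\<^sup>+k. f (aff_act a k, fst a *v (fst c *v l)) \<partial>Zs \<partial>Zs)"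
    by (intro nn_integral_cong nn_integral_bij_count_space[OF bij_aff_act_integer_vectors[OF c]])
  also have "\<dots> = pair_sum f a"
    unfolding pair_sum_def
    by (rule nn_integral_bij_count_space[OF bij_linear_integer_vectors[OF c],
          of "\<lambda>l. \<integral>\<^sup>+k. f (aff_act a k, fst a *v l) \<partial>Zs"])
  finally show "pair_sum f (aff_mult a c) = pair_sum f a" .
qed (use assms in measurable)

text \<open>The bounds are multiplicative rather than additive, so that the limit may be
  infinite.\<close>

lemma tendsto_ennreal_squeeze:
  fixes X :: "nat \<Rightarrow> ennreal"
  assumes "eventually (\<lambda>n. ennreal (l n) * \<Psi> \<le> X n) sequentially" "l \<longlonglongrightarrow> 1"
    and "eventually (\<lambda>n. X n \<le> ennreal (u n) * \<Psi>) sequentially" "u \<longlonglongrightarrow> 1"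
  shows "X \<longlonglongrightarrow> \<Psi>"
proof -
  have *: "(\<lambda>n. ennreal (v n) * \<Psi>) \<longlonglongrightarrow> \<Psi>" if "v \<longlonglongrightarrow> 1" for v
    using tendsto_mult_ennreal[OF tendsto_ennrealI[OF that] tendsto_const, of \<Psi>] by simp
  show ?thesis
    by (rule tendsto_sandwich[OF assms(1,3) *[OF assms(2)] *[OF assms(4)]])
qed

definition coord_cube :: "real \<Rightarrow> real \<Rightarrow> (real^'n::finite) set" where
  "coord_cube s t = {b. \<forall>i. s \<le> b $ i \<and> b $ i \<le> t}"

lemma coord_cube_borel [measurable]: "coord_cube s t \<in> sets borel"
  unfolding coord_cube_def by measurable

lemma emeasure_coord_cube:
  assumes "s \<le> t"
  shows "emeasure lborel (coord_cube s t :: (real^'n::finite) set) = ennreal ((t - s) ^ CARD('n))"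
proof -
  have e: "coord_cube s t = cbox (\<chi> i. s) ((\<chi> i. t) :: real^'n)" by (auto simp: coord_cube_def mem_box_cart)
  have B: "(\<Prod>j\<in>Basis. F j) = (\<Prod>i\<in>UNIV. F (axis i (1::real)))" for F :: "real^'n \<Rightarrow> real"
    by (subst prod.reindex_bij_betw[symmetric, where T = "Basis :: (real^'n) set" and S = UNIV and h = "\<lambda>i. axis i 1"])
       (auto simp: bij_betw_def inj_on_def axis_eq_axis Basis_vec_def)
  have "(\<chi> i. s) \<bullet> j \<le> (\<chi> i. t) \<bullet> j" if "j \<in> Basis" for j :: "real^'n"
    using that assms by (auto simp: Basis_vec_def inner_axis)
  then show ?thesis
    unfolding e by (subst emeasure_lborel_cbox) (auto simp: B inner_axis)
qed

text \<open>Let \<open>J T v\<close> be the integral of \<open>\<phi>\<close> over the cube of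
  half-side \<open>T\<close> around \<open>v + x\<close>. Moving \<open>v\<close> by at most
  \<open>D\<close> in each coordinate is absorbed by a cube larger by \<open>D\<close>, so the sum
  of \<open>J T\<close> over the lattice lies between the integrals of \<open>J (T - D)\<close> and
  \<open>J (T + D)\<close>. By Fubini these are cube volumes times the integral of
  \<open>\<phi>\<close>.\<close>

lemma translation_average:
  fixes \<phi> :: "real^'n::finite \<Rightarrow> ennreal" and g :: "real^'n^'n" and x :: "real^'n"
  assumes g: "det g = 1" and [measurable]: "\<phi> \<in> borel_measurable borel"
    and D: "\<And>q i. q \<in> unit_cube \<Longrightarrow> \<bar>(g *v q) $ i\<bar> \<le> D"
  defines "I T \<equiv> (\<integral>\<^sup>+k. \<integral>\<^sup>+b. \<phi> (g *v k + x + b) * indicator (coord_cube (-T) T) b \<partial>lborel \<partial>Zs)"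
  shows "I T \<le> emeasure lborel (coord_cube (-(T + D)) (T + D) :: (real^'n) set) * (\<integral>\<^sup>+u. \<phi> u \<partial>lborel)"
    and "emeasure lborel (coord_cube (-(T - D)) (T - D) :: (real^'n) set) * (\<integral>\<^sup>+u. \<phi> u \<partial>lborel) \<le> I T"
proof -
  define J where "J T v = (\<integral>\<^sup>+b. \<phi> (v + x + b) * indicator (coord_cube (-T) T) b \<partial>lborel)" for T v
  have [measurable]: "J T \<in> borel_measurable borel" for T
    unfolding J_def[abs_def] by measurable
  have shift: "J T v \<le> J T' (v + w)" if w: "\<And>i. \<bar>w $ i\<bar> \<le> D" and T: "T + D \<le> T'" for T T' v w
  proof -
    have "J T v = (\<integral>\<^sup>+b. \<phi> (v + x + (b + w)) * indicator (coord_cube (-T) T) (b + w) \<partial>lborel)"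
      unfolding J_def by (rule nn_integral_translate[symmetric]) measurable
    also have "\<dots> \<le> J T' (v + w)"
      unfolding J_def
    proof (intro nn_integral_mono mult_mono)
      fix b
      have "b \<in> coord_cube (-T') T'" if "b + w \<in> coord_cube (-T) T"
        unfolding coord_cube_def mem_Collect_eq
      proof
        fix i show "- T' \<le> b $ i \<and> b $ i \<le> T'"
          using that w[of i] T by (auto simp: coord_cube_def dest!: spec[of _ i])
      qed
      then show "indicator (coord_cube (-T) T) (b + w) \<le> (indicator (coord_cube (-T') T') b :: ennreal)"
        by (auto simp: indicator_def)
    qed (auto simp: algebra_simps)
    finally show ?thesis .
  qed
  have intJ: "(\<integral>\<^sup>+v. J T v \<partial>lborel) = emeasure lborel (coord_cube (-T) T :: (real^'n) set) * (\<integral>\<^sup>+u. \<phi> u \<partial>lborel)" for T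
  proof -
    have "(\<integral>\<^sup>+v. J T v \<partial>lborel) = (\<integral>\<^sup>+b. \<integral>\<^sup>+v. \<phi> (v + (x + b)) * indicator (coord_cube (-T) T) b \<partial>lborel \<partial>lborel)"
      unfolding J_def add.assoc by (rule lborel_pair.Fubini') measurable
    also have "\<dots> = (\<integral>\<^sup>+b. (\<integral>\<^sup>+u. \<phi> u \<partial>lborel) * indicator (coord_cube (-T) T) (b :: real^'n) \<partial>lborel)"
      by (intro nn_integral_cong) (simp add: nn_integral_multc nn_integral_translate)
    finally show ?thesis by (simp add: nn_integral_cmult_indicator mult.commute)
  qed
  have I: "I T = (\<integral>\<^sup>+k. J T (g *v k) \<partial>Zs)" by (simp add: I_def J_def)
  show "I T \<le> emeasure lborel (coord_cube (-(T + D)) (T + D) :: (real^'n) set) * (\<integral>\<^sup>+u. \<phi> u \<partial>lborel)"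
    unfolding I intJ[symmetric] by (rule lattice_sum_le_integral[OF g]) (auto intro!: shift D)
  show "emeasure lborel (coord_cube (-(T - D)) (T - D) :: (real^'n) set) * (\<integral>\<^sup>+u. \<phi> u \<partial>lborel) \<le> I T"
    unfolding I intJ[symmetric]
  proof (rule integral_le_lattice_sum[OF g])
    fix k q :: "real^'n" assume "q \<in> unit_cube"
    then show "J (T - D) (g *v k + g *v q) \<le> J T (g *v k)"
      using shift[of "- (g *v q)" "T - D" T "g *v k + g *v q"] D by simp
  qed measurable
qed

context ASL_average
begin

lemma nn_integral_pair_sum_fst:
  fixes f :: "(real^'n) \<times> (real^'n) \<Rightarrow> ennreal"
  assumes f [measurable]: "f \<in> borel_measurable borel"
  shows "(\<integral>\<^sup>+a. pair_sum f a \<partial>P) = (\<integral>\<^sup>+a. (\<integral>\<^sup>+l. \<integral>\<^sup>+u. f (u, fst a *v l) \<partial>lborel \<partial>Zs) \<partial>P)"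
proof (rule nn_integral_average)
  \<comment> \<open>The summand 1 keeps the volume positive at \<open>n = 0\<close>, so that every
    \<open>\<Theta> n\<close> is a probability measure.\<close>
  let ?Q = "\<lambda>n::nat. coord_cube (-(real n + 1)) (real n + 1) :: (real^'n) set"
  let ?c = "\<lambda>T. emeasure lborel (coord_cube (-T) T :: (real^'n) set)"
  define \<Theta> where "\<Theta> n = uniform_measure lborel (?Q n)" for n
  have Qe: "?c T = ennreal ((2 * T) ^ CARD('n))" if "T \<ge> 0" for T
    using emeasure_coord_cube[of "-T" T, where ?'n = 'n] that by simp
  show "right_invariant (pair_sum f)" by (rule right_invariant_pair_sum) fact
  show "prob_space (\<Theta> n)" for n
    unfolding \<Theta>_def by (rule prob_space_uniform_measure) (use Qe[of "real n + 1"] in auto)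
  show "(\<lambda>b. (mat 1, b) :: 'n aff) \<in> borel_measurable (\<Theta> n)" for n
    unfolding \<Theta>_def by measurable
  show "(mat 1, b) \<in> (ASL :: 'n aff set)" for b by (simp add: ASL_def)
  show "(\<lambda>a. \<integral>\<^sup>+l. \<integral>\<^sup>+u. f (u, fst a *v l) \<partial>lborel \<partial>Zs) \<in> borel_measurable (borel :: 'n aff measure)"
    by (intro measurable_count_space_sum countable_integer_vectors) measurable
  fix a :: "'n aff" assume a: "a \<in> ASL"
  then have g: "det (fst a) = 1" by (simp add: ASL_def)
  obtain D where D: "D > 0" "\<And>q i. q \<in> unit_cube \<Longrightarrow> \<bar>(fst a *v q) $ i\<bar> \<le> D"
    using unit_cube_image_bounded by metis
  let ?\<Psi> = "\<integral>\<^sup>+l. \<integral>\<^sup>+u. f (u, fst a *v l) \<partial>lborel \<partial>Zs"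
  let ?I = "\<lambda>l T. \<integral>\<^sup>+k. \<integral>\<^sup>+b. f (fst a *v k + snd a + b, fst a *v l) * indicator (coord_cube (-T) T) b \<partial>lborel \<partial>Zs"
  have X: "(\<integral>\<^sup>+b. pair_sum f (aff_mult (mat 1, b) a) \<partial>\<Theta> n) = (\<integral>\<^sup>+l. ?I l (real n + 1) \<partial>Zs) / ?c (real n + 1)" for n
  proof -
    have "(\<integral>\<^sup>+b. pair_sum f (aff_mult (mat 1, b) a) \<partial>\<Theta> n) =
       (\<integral>\<^sup>+b. pair_sum f (aff_mult (mat 1, b) a) * indicator (?Q n) b \<partial>lborel) / ?c (real n + 1)"
      unfolding \<Theta>_def by (rule nn_integral_uniform_measure) measurable
    also have "(\<integral>\<^sup>+b. pair_sum f (aff_mult (mat 1, b) a) * indicator (?Q n) b \<partial>lborel) =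
       (\<integral>\<^sup>+b. (\<integral>\<^sup>+l. \<integral>\<^sup>+k. f (fst a *v k + snd a + b, fst a *v l) * indicator (?Q n) b \<partial>Zs \<partial>Zs) \<partial>lborel)"
      by (simp add: pair_sum_def aff_act_def aff_mult_def nn_integral_multc add.assoc)
    also have "\<dots> = (\<integral>\<^sup>+l. (\<integral>\<^sup>+b. \<integral>\<^sup>+k. f (fst a *v k + snd a + b, fst a *v l) * indicator (?Q n) b \<partial>Zs \<partial>lborel) \<partial>Zs)"
      by (intro nn_integral_count_space_swap measurable_count_space_sum countable_integer_vectors) measurable
    also have "\<dots> = (\<integral>\<^sup>+l. ?I l (real n + 1) \<partial>Zs)"
      by (intro nn_integral_cong nn_integral_count_space_swap countable_integer_vectors) measurable
    finally show ?thesis .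
  qed
  have div: "(ennreal p * \<Psi>) / ennreal q = ennreal (p / q) * \<Psi>" if "p \<ge> 0" "q > 0" for p q \<Psi>
    using that by (simp add: divide_ennreal[symmetric] ennreal_times_divide mult.commute)
  show "(\<lambda>n. \<integral>\<^sup>+b. pair_sum f (aff_mult (mat 1, b) a) \<partial>\<Theta> n) \<longlonglongrightarrow> ?\<Psi>"
    unfolding X
  proof (rule tendsto_ennreal_squeeze[where
        l = "\<lambda>n. (2 * (real n + 1 + (- D))) ^ CARD('n) / (2 * (real n + 1)) ^ CARD('n)" and
        u = "\<lambda>n. (2 * (real n + 1 + D)) ^ CARD('n) / (2 * (real n + 1)) ^ CARD('n)"])
    have lim: "(\<lambda>n. (2 * (real n + 1 + c)) ^ CARD('n) / (2 * (real n + 1)) ^ CARD('n)) \<longlonglongrightarrow> 1" for c :: real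
    proof -
      have "(\<lambda>n. (2 * (real n + 1 + c)) / (2 * (real n + 1))) \<longlonglongrightarrow> 1" by real_asymp
      from tendsto_power[OF this, of "CARD('n)"] show ?thesis by (simp add: power_divide)
    qed
    show "(\<lambda>n. (2 * (real n + 1 + D)) ^ CARD('n) / (2 * (real n + 1)) ^ CARD('n)) \<longlonglongrightarrow> 1" by (rule lim)
    show "(\<lambda>n. (2 * (real n + 1 + (- D))) ^ CARD('n) / (2 * (real n + 1)) ^ CARD('n)) \<longlonglongrightarrow> 1" by (rule lim)
    have "(\<integral>\<^sup>+l. ?I l T \<partial>Zs) \<le> (\<integral>\<^sup>+l. ?c (T + D) * (\<integral>\<^sup>+u. f (u, fst a *v l) \<partial>lborel) \<partial>Zs)" for T
      by (intro nn_integral_mono translation_average(1)[OF g _ D(2)]) measurable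
    then have up: "(\<integral>\<^sup>+l. ?I l T \<partial>Zs) \<le> ?c (T + D) * ?\<Psi>" for T by (simp add: nn_integral_cmult)
    have "(\<integral>\<^sup>+l. ?c (T - D) * (\<integral>\<^sup>+u. f (u, fst a *v l) \<partial>lborel) \<partial>Zs) \<le> (\<integral>\<^sup>+l. ?I l T \<partial>Zs)" for T
      by (intro nn_integral_mono translation_average(2)[OF g _ D(2)]) measurable
    then have lo: "?c (T - D) * ?\<Psi> \<le> (\<integral>\<^sup>+l. ?I l T \<partial>Zs)" for T by (simp add: nn_integral_cmult)
    show "\<forall>\<^sub>F n in sequentially. (\<integral>\<^sup>+l. ?I l (real n + 1) \<partial>Zs) / ?c (real n + 1) \<le>
        ennreal ((2 * (real n + 1 + D)) ^ CARD('n) / (2 * (real n + 1)) ^ CARD('n)) * ?\<Psi>"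
    proof (rule always_eventually, rule allI)
      fix n
      have "(\<integral>\<^sup>+l. ?I l (real n + 1) \<partial>Zs) / ?c (real n + 1) \<le> (?c (real n + 1 + D) * ?\<Psi>) / ?c (real n + 1)"
        by (intro divide_right_mono_ennreal up)
      moreover have "(?c (real n + 1 + D) * ?\<Psi>) / ?c (real n + 1) = ennreal ((2 * (real n + 1 + D)) ^ CARD('n) / (2 * (real n + 1)) ^ CARD('n)) * ?\<Psi>"
        using D(1) by (subst Qe, simp, subst Qe, simp, subst div) auto
      ultimately show "(\<integral>\<^sup>+l. ?I l (real n + 1) \<partial>Zs) / ?c (real n + 1) \<le>
        ennreal ((2 * (real n + 1 + D)) ^ CARD('n) / (2 * (real n + 1)) ^ CARD('n)) * ?\<Psi>"
        by simp
    qed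
    \<comment> \<open>This keeps the half-side of the smaller cube nonnegative, as the volume
      formula \<open>Qe\<close> requires.\<close>
    have "\<forall>\<^sub>F n in sequentially. D \<le> real n" by real_asymp
    then show "\<forall>\<^sub>F n in sequentially. ennreal ((2 * (real n + 1 + (- D))) ^ CARD('n) / (2 * (real n + 1)) ^ CARD('n)) * ?\<Psi> \<le>
       (\<integral>\<^sup>+l. ?I l (real n + 1) \<partial>Zs) / ?c (real n + 1)"
    proof eventually_elim
      fix n assume n: "D \<le> real n"
      have "(?c (real n + 1 - D) * ?\<Psi>) / ?c (real n + 1) \<le> (\<integral>\<^sup>+l. ?I l (real n + 1) \<partial>Zs) / ?c (real n + 1)"
        by (intro divide_right_mono_ennreal lo)
      moreover have "(?c (real n + 1 - D) * ?\<Psi>) / ?c (real n + 1) = ennreal ((2 * (real n + 1 + (- D))) ^ CARD('n) / (2 * (real n + 1)) ^ CARD('n)) * ?\<Psi>"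
        using n by (subst Qe, simp, subst Qe, simp, subst div) auto
      ultimately show "ennreal ((2 * (real n + 1 + (- D))) ^ CARD('n) / (2 * (real n + 1)) ^ CARD('n)) * ?\<Psi> \<le>
       (\<integral>\<^sup>+l. ?I l (real n + 1) \<partial>Zs) / ?c (real n + 1)" by simp
    qed
  qed
qed

end

section \<open>Siegel's formula\<close>

definition shear1 :: "'n \<Rightarrow> 'n \<Rightarrow> real \<Rightarrow> real^'n::finite \<Rightarrow> real^'n" where
  "shear1 i j s z = z + (s * z $ j) *\<^sub>R axis i 1"

text \<open>Subtracting \<open>r $ i\<close> lets the parameter range over a cube of full dimension.
  The extra coordinate multiplies integrals by one side length, which the normalisation by the
  volume of the cube cancels.\<close>

definition shear2 :: "'n \<Rightarrow> real^'n \<Rightarrow> real^'n::finite \<Rightarrow> real^'n" where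
  "shear2 i r y = y + y $ i *\<^sub>R (r - r $ i *\<^sub>R axis i 1)"

definition shear1_mat :: "'n \<Rightarrow> 'n \<Rightarrow> real \<Rightarrow> real^'n^'n::finite" where
  "shear1_mat i j s = mat 1 + (\<chi> k l. if k = i \<and> l = j then s else 0)"

definition shear2_mat :: "'n \<Rightarrow> real^'n \<Rightarrow> real^'n^'n::finite" where
  "shear2_mat i r = mat 1 + (\<chi> k l. if l = i \<and> k \<noteq> i then r $ k else 0)"

lemma axis_nth_if: "axis i (1::real) $ k = (if k = i then 1 else 0)"
  by (simp add: axis_def)

lemma shear1_nth: "shear1 i j s z $ k = (if k = i then z $ i + s * z $ j else z $ k)"
  by (simp add: shear1_def axis_nth_if)

lemma shear2_nth: "shear2 i r y $ k = (if k = i then y $ i else y $ k + y $ i * r $ k)"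
  by (simp add: shear2_def axis_nth_if)

lemma shear1_mat_vec: "shear1_mat i j s *v z = shear1 i j s z"
proof -
  have "(\<Sum>l\<in>UNIV. (if k = i \<and> l = j then s else 0) * z $ l) = (if k = i then s * z $ j else 0)" for k
    by (cases "k = i") (simp_all add: if_distrib[of "\<lambda>c. c * y" for y] cong: if_cong)
  then show ?thesis
    unfolding vec_eq_iff shear1_nth shear1_mat_def
    by (simp add: matrix_vector_mult_add_rdistrib) (simp add: matrix_vector_mult_def)
qed

lemma shear2_mat_vec: "shear2_mat i r *v y = shear2 i r y"
proof -
  have "(\<Sum>l\<in>UNIV. (if l = i \<and> k \<noteq> i then r $ k else 0) * y $ l) = (if k = i then 0 else y $ i * r $ k)" for k
    by (cases "k = i") (simp_all add: if_distrib[of "\<lambda>c. c * y" for y] mult.commute[of "y $ i"] cong: if_cong)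
  then show ?thesis
    unfolding vec_eq_iff shear2_nth shear2_mat_def
    by (simp add: matrix_vector_mult_add_rdistrib) (simp add: matrix_vector_mult_def)
qed

lemma det_shear1_mat:
  assumes "i \<noteq> j"
  shows "det (shear1_mat i j s) = 1"
proof -
  have "shear1_mat i j s = (\<chi> k. if k = i then row i (mat 1) + s *s row j (mat 1) else row k (mat 1))"
    using assms by (auto simp: shear1_mat_def vec_eq_iff row_def mat_def)
  then show ?thesis by (simp add: det_row_operation[OF assms])
qed

text \<open>The transpose arises from the identity by one row operation: row \<open>i\<close> gains
  a combination of the other rows.\<close>

lemma det_shear2_mat: "det (shear2_mat i r) = 1"
proof -
  let ?x = "r - r $ i *\<^sub>R axis i 1"
  have "transpose (shear2_mat i r) = (\<chi> k. if k = i then row i (mat 1) + ?x else row k (mat 1))"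
    by (auto simp: shear2_mat_def vec_eq_iff row_def mat_def transpose_def axis_nth_if)
  moreover have "?x \<in> vec.span {row j (mat 1 :: real^'a^'a) |j. j \<noteq> i}"
  proof -
    have "?x = (\<Sum>j\<in>UNIV - {i}. r $ j *s row j (mat 1))"
      unfolding vec_eq_iff
    proof
      fix k
      have "(\<Sum>j\<in>UNIV - {i}. r $ j *s row j (mat 1)) $ k = (\<Sum>j\<in>UNIV - {i}. r $ j * (if j = k then 1 else 0))"
        unfolding sum_component by (intro sum.cong) (auto simp: row_def mat_def)
      also have "\<dots> = (\<Sum>j\<in>UNIV - {i}. if j = k then r $ j else 0)"
        by (intro sum.cong) auto
      also have "\<dots> = ?x $ k" by (subst sum.delta) (auto simp: axis_nth_if)
      finally show "?x $ k = (\<Sum>j\<in>UNIV - {i}. r $ j *s row j (mat 1)) $ k" ..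
    qed
    also have "\<dots> \<in> vec.span {row j (mat 1 :: real^'a^'a) |j. j \<noteq> i}"
      by (intro vec.span_sum vec.span_scale vec.span_base) auto
    finally show ?thesis .
  qed
  ultimately have "det (transpose (shear2_mat i r)) = det (mat 1 :: real^'a^'a)"
    by (simp only: det_row_span)
  then show ?thesis by (simp add: det_transpose)
qed

lemma borel_measurable_vec_nth [measurable (raw)]:
  fixes f :: "'a \<Rightarrow> real^'n::finite"
  assumes "f \<in> borel_measurable M"
  shows "(\<lambda>x. f x $ i) \<in> borel_measurable M"
  by (rule borel_measurable_continuous_on[OF _ assms]) (intro continuous_intros)

lemma measurable_shear [measurable (raw)]:
  fixes f h :: "'a \<Rightarrow> real^'n::finite" and s :: "'a \<Rightarrow> real"
  assumes [measurable]: "f \<in> borel_measurable M" "h \<in> borel_measurable M" "s \<in> borel_measurable M"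
  shows "(\<lambda>x. shear1 i j (s x) (f x)) \<in> borel_measurable M" "(\<lambda>x. shear2 i (h x) (f x)) \<in> borel_measurable M"
  unfolding shear1_def shear2_def by measurable

lemma measurable_shear_mat:
  "(\<lambda>(s, r). shear2_mat i r ** shear1_mat i j s) \<in> borel_measurable (borel :: (real \<times> (real^'n::finite)) measure)"
proof -
  have 1: "continuous_on UNIV (\<lambda>x :: real \<times> (real^'n). shear1_mat i j (fst x))"
  proof -
    have "continuous_on UNIV (\<lambda>x :: real \<times> (real^'n). if k = i \<and> l = j then fst x else 0)" for k l
      by (cases "k = i \<and> l = j") (auto intro!: continuous_intros)
    then show ?thesis
      unfolding shear1_mat_def by (intro continuous_intros continuous_on_vec_lambda)
  qed
  have "continuous_on UNIV (\<lambda>x :: real \<times> (real^'n). if l = i \<and> k \<noteq> i then snd x $ k else 0)" for k l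
    by (cases "l = i \<and> k \<noteq> i") (auto intro!: continuous_intros)
  then have 2: "continuous_on UNIV (\<lambda>x :: real \<times> (real^'n). shear2_mat i (snd x))"
    unfolding shear2_mat_def
    by (intro continuous_intros continuous_on_vec_lambda)
  show ?thesis
    unfolding split_beta' matrix_matrix_mult_def
    by (intro borel_measurable_continuous_onI continuous_on_vec_lambda continuous_intros 1 2)
qed

section \<open>Integrals over the shear parameters\<close>

definition shear2_int :: "'n \<Rightarrow> (real^'n \<Rightarrow> ennreal) \<Rightarrow> real \<Rightarrow> real \<Rightarrow> real^'n::finite \<Rightarrow> ennreal" where
  "shear2_int i f lo hi y = (\<integral>\<^sup>+r. f (shear2 i r y) * indicator (coord_cube lo hi) r \<partial>lborel)"

text \<open>The ranges are left free because moving a lattice point is paid for by slightly larger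
  ranges; a negative \<open>e\<close> gives a shorter interval, needed for lower bounds.\<close>

definition shear_int :: "'n \<Rightarrow> 'n \<Rightarrow> (real^'n \<Rightarrow> ennreal) \<Rightarrow> real \<Rightarrow> real \<Rightarrow> real \<Rightarrow> real^'n::finite \<Rightarrow> ennreal" where
  "shear_int i j f e lo hi z =
     (\<integral>\<^sup>+s. shear2_int i f lo hi (shear1 i j s z) * indicator {-e..1 + e} s \<partial>lborel)"

lemma shear2_int_measurable [measurable (raw)]:
  assumes [measurable]: "f \<in> borel_measurable borel" "h \<in> borel_measurable M"
  shows "(\<lambda>x. shear2_int i f lo hi (h x)) \<in> borel_measurable M"
  unfolding shear2_int_def[abs_def] by measurable

lemma shear_int_measurable [measurable]:
  assumes [measurable]: "f \<in> borel_measurable borel"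
  shows "shear_int i j f e lo hi \<in> borel_measurable borel"
  unfolding shear_int_def[abs_def] by measurable

text \<open>Replacing \<open>r\<close> by \<open>r + p\<close> with \<open>p = q / y $ i\<close>
  moves the sheared point by exactly \<open>q\<close>, since \<open>q $ i = 0\<close>. Where
  \<open>f\<close> does not vanish, \<open>\<bar>y $ i\<bar>\<close> is at least
  \<open>\<eta>\<close>, so \<open>p\<close> is bounded by \<open>D / \<eta>\<close>.\<close>

lemma shear2_int_shift:
  fixes f :: "real^'n::finite \<Rightarrow> ennreal"
  assumes [measurable]: "f \<in> borel_measurable borel"
    and \<eta>: "\<eta> > 0" and supp: "\<And>w. f w \<noteq> 0 \<Longrightarrow> \<eta> \<le> \<bar>w $ i\<bar>"
    and q: "q $ i = 0" "\<And>k. \<bar>q $ k\<bar> \<le> D"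
  shows "shear2_int i f lo hi y \<le> shear2_int i f (lo - D / \<eta>) (hi + D / \<eta>) (y + q)"
proof (cases "\<eta> \<le> \<bar>y $ i\<bar>")
  case False
  then have "f (shear2 i r y) = 0" for r
    using supp[of "shear2 i r y"] by (auto simp: shear2_nth)
  then show ?thesis by (simp add: shear2_int_def)
next
  case True
  define p where "p = (1 / y $ i) *\<^sub>R q"
  have p: "\<bar>p $ k\<bar> \<le> D / \<eta>" for k
  proof -
    have "\<bar>q $ k\<bar> / \<bar>y $ i\<bar> \<le> D / \<eta>" using True q(2)[of k] \<eta> by (intro frac_le) auto
    then show ?thesis by (simp add: p_def)
  qed
  have "shear2_int i f lo hi y = (\<integral>\<^sup>+r. f (shear2 i (r + p) y) * indicator (coord_cube lo hi) (r + p) \<partial>lborel)"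
    unfolding shear2_int_def by (rule nn_integral_translate[symmetric]) measurable
  also have "\<dots> \<le> shear2_int i f (lo - D / \<eta>) (hi + D / \<eta>) (y + q)"
    unfolding shear2_int_def
  proof (intro nn_integral_mono mult_mono)
    fix r
    have "shear2 i (r + p) y = shear2 i r (y + q)"
      using True q(1) \<eta> by (auto simp: vec_eq_iff shear2_nth p_def field_simps)
    then show "f (shear2 i (r + p) y) \<le> f (shear2 i r (y + q))" by simp
    have "r \<in> coord_cube (lo - D / \<eta>) (hi + D / \<eta>)" if "r + p \<in> coord_cube lo hi"
      unfolding coord_cube_def mem_Collect_eq
    proof
      fix k
      show "lo - D / \<eta> \<le> r $ k \<and> r $ k \<le> hi + D / \<eta>"
        using that p[of k] unfolding coord_cube_def mem_Collect_eq by (auto dest!: spec[of _ k])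
    qed
    then show "indicator (coord_cube lo hi) (r + p) \<le> (indicator (coord_cube (lo - D / \<eta>) (hi + D / \<eta>)) r :: ennreal)"
      by (auto simp: indicator_def)
  qed simp_all
  finally show ?thesis .
qed

text \<open>
  Moving \<open>z\<close> to \<open>z + q\<close> is absorbed by the shear parameters: choose the new \<open>s\<close> so that the \<open>i\<close>-th
  coordinate \<open>z\<^sub>i + s z\<^sub>j\<close> is unchanged, then shift \<open>r\<close>.  If \<open>f\<close> does not vanish at the sheared point, then
  \<open>\<bar>z\<^sub>j\<bar>\<close> is at least about \<open>lo * \<eta>\<close>, so the parameters move little.
\<close>

lemma shear_int_shift:
  fixes f :: "real^'n::finite \<Rightarrow> ennreal"
  assumes [measurable]: "f \<in> borel_measurable borel"
    and ij: "i \<noteq> j" and \<eta>: "\<eta> > 0"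
    and supp: "\<And>w. f w \<noteq> 0 \<Longrightarrow> \<eta> \<le> \<bar>w $ i\<bar> \<and> \<bar>w $ j\<bar> \<le> R"
    and q: "\<And>k. \<bar>q $ k\<bar> \<le> D"
    and lo: "0 \<le> lo" and Z: "Z \<le> lo * \<eta> - R" "D < Z"
    and e: "e \<le> 1" "3 * D / (Z - D) \<le> e'"
  shows "shear_int i j f e lo hi z \<le> ennreal (1 + D / Z) * shear_int i j f (e + e') (lo - D / \<eta>) (hi + D / \<eta>) (z + q)"
proof -
  have D: "0 \<le> D" using q[of i] by simp
  let ?K = "shear2_int i f lo hi" and ?K' = "shear2_int i f (lo - D / \<eta>) (hi + D / \<eta>)"
  show ?thesis
  proof (cases "Z \<le> \<bar>z $ j\<bar>")
    case False
    \<comment> \<open>The \<open>j\<close>-th coordinate of the sheared point is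
      \<open>z $ j + y * r $ j\<close>, where the product has modulus at least
      \<open>lo * \<eta>\<close>. It can be bounded by \<open>R\<close> only if \<open>z $ j\<close>
      is large enough to compensate.\<close>
    have "f (shear2 i r (shear1 i j s z)) * indicator (coord_cube lo hi) r = 0" for r s
    proof (rule ccontr)
      assume "f (shear2 i r (shear1 i j s z)) * indicator (coord_cube lo hi) r \<noteq> 0"
      then have nz: "f (shear2 i r (shear1 i j s z)) \<noteq> 0" and r: "lo \<le> r $ j"
        by (auto simp: coord_cube_def split: split_indicator_asm)
      define y where "y = shear1 i j s z $ i"
      have 1: "\<eta> \<le> \<bar>y\<bar>" and 2: "\<bar>z $ j + y * r $ j\<bar> \<le> R"
        using supp[OF nz] ij by (auto simp: shear2_nth y_def shear1_nth)
      have "lo * \<eta> \<le> \<bar>r $ j\<bar> * \<bar>y\<bar>" using r lo 1 \<eta> by (intro mult_mono) auto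
      then have "lo * \<eta> \<le> \<bar>y * r $ j\<bar>" by (simp add: abs_mult mult.commute)
      then show False using 2 False Z by linarith
    qed
    then have "shear_int i j f e lo hi z = 0"
      unfolding shear_int_def shear2_int_def by (simp only: nn_integral_const mult_zero_left)
    then show ?thesis by simp
  next
    case True
    define w where "w = z $ j + q $ j"
    have w: "Z - D \<le> \<bar>w\<bar>" "w \<noteq> 0" and zj: "z $ j \<noteq> 0"
      using True q[of j] Z D by (auto simp: w_def)
    \<comment> \<open>\<open>\<beta> + \<alpha> * s\<close> is the parameter for
      \<open>z + q\<close> that reproduces the \<open>i\<close>-th coordinate
      \<open>z $ i + s * z $ j\<close>. The remaining displacement \<open>q'\<close> has
      \<open>i\<close>-th coordinate 0, as \<open>shear2_int_shift\<close> demands.\<close>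
    define \<alpha> \<beta> where "\<alpha> = z $ j / w" and "\<beta> = - (q $ i) / w"
    have \<alpha>: "\<alpha> \<noteq> 0" using w zj by (simp add: \<alpha>_def)
    define q' where "q' = (\<chi> k. if k = i then 0 else q $ k)"
    have "?K (shear1 i j s z) \<le> ?K' (shear1 i j (\<beta> + \<alpha> * s) (z + q))" for s
    proof -
      have "(\<beta> + \<alpha> * s) * w = - (q $ i) + s * z $ j"
        using w(2) by (simp add: \<alpha>_def \<beta>_def left_diff_distrib)
      then have "shear1 i j s z + q' = shear1 i j (\<beta> + \<alpha> * s) (z + q)"
        by (auto simp: vec_eq_iff shear1_nth q'_def w_def)
      then show ?thesis
        using shear2_int_shift[OF assms(1) \<eta>, of i q' D lo hi "shear1 i j s z"] supp q D by (auto simp: q'_def)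
    qed
    moreover have "indicator {-e..1 + e} s \<le> (indicator {-(e + e')..1 + (e + e')} (\<beta> + \<alpha> * s) :: ennreal)" for s
    proof -
      have "-(e + e') \<le> \<beta> + \<alpha> * s \<and> \<beta> + \<alpha> * s \<le> 1 + (e + e')" if s: "-e \<le> s" "s \<le> 1 + e"
      proof -
        \<comment> \<open>The change of the parameter. Since \<open>e \<le> 1\<close> gives
          \<open>\<bar>s\<bar> \<le> 2\<close>, the numerator is at most \<open>D + 2 * D\<close>,
          and \<open>w\<close> is at least \<open>Z - D\<close> in modulus.\<close>
        have "\<beta> + \<alpha> * s - s = (- (q $ i) - s * q $ j) / w"
        proof -
          have "(\<beta> + \<alpha> * s) * w = - (q $ i) + s * z $ j"
            using w(2) by (simp add: \<alpha>_def \<beta>_def left_diff_distrib)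
          then have "(\<beta> + \<alpha> * s - s) * w = - (q $ i) - s * q $ j"
            by (simp add: left_diff_distrib) (simp add: w_def distrib_left)
          then show ?thesis using w(2) by (simp add: nonzero_eq_divide_eq)
        qed
        moreover have "\<bar>(- (q $ i) - s * q $ j) / w\<bar> \<le> 3 * D / (Z - D)"
        proof -
          have "\<bar>s\<bar> \<le> 2" using s e by auto
          then have "\<bar>s * q $ j\<bar> \<le> 2 * D" unfolding abs_mult using q[of j] by (intro mult_mono) auto
          then have "\<bar>- (q $ i) - s * q $ j\<bar> \<le> 3 * D" using q[of i] by linarith
          then show ?thesis
            unfolding abs_divide using w Z by (intro frac_le) auto
        qed
        ultimately have "\<bar>\<beta> + \<alpha> * s - s\<bar> \<le> e'" using e by simp
        then show ?thesis using s by linarith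
      qed
      then show ?thesis by (auto simp: indicator_def)
    qed
    ultimately have "shear_int i j f e lo hi z \<le>
       (\<integral>\<^sup>+s. ?K' (shear1 i j (\<beta> + \<alpha> * s) (z + q)) * indicator {-(e + e')..1 + (e + e')} (\<beta> + \<alpha> * s) \<partial>lborel)" (is "_ \<le> ?I")
      unfolding shear_int_def by (intro nn_integral_mono mult_mono) auto
    \<comment> \<open>The Jacobian of the change of parameter is
      \<open>\<bar>w\<bar> / \<bar>z $ j\<bar>\<close>, hence the factor
      \<open>1 + D / Z\<close>.\<close>
    also have "?I = ennreal (1 / \<bar>\<alpha>\<bar>) * shear_int i j f (e + e') (lo - D / \<eta>) (hi + D / \<eta>) (z + q)"
    proof -
      have "shear_int i j f (e + e') (lo - D / \<eta>) (hi + D / \<eta>) (z + q) = ennreal \<bar>\<alpha>\<bar> * ?I"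
        unfolding shear_int_def by (rule nn_integral_real_affine[OF _ \<alpha>]) measurable
      then have "ennreal (1 / \<bar>\<alpha>\<bar>) * shear_int i j f (e + e') (lo - D / \<eta>) (hi + D / \<eta>) (z + q) =
         ennreal (1 / \<bar>\<alpha>\<bar>) * ennreal \<bar>\<alpha>\<bar> * ?I" by (simp add: mult.assoc)
      also have "ennreal (1 / \<bar>\<alpha>\<bar>) * ennreal \<bar>\<alpha>\<bar> = 1"
        using \<alpha> by (subst ennreal_mult[symmetric]) auto
      finally show ?thesis by simp
    qed
    also have "\<dots> \<le> ennreal (1 + D / Z) * shear_int i j f (e + e') (lo - D / \<eta>) (hi + D / \<eta>) (z + q)"
    proof (intro mult_right_mono ennreal_leI)
      have "\<bar>w\<bar> \<le> \<bar>z $ j\<bar> + D" using q[of j] by (simp add: w_def)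
      then have "1 / \<bar>\<alpha>\<bar> \<le> (\<bar>z $ j\<bar> + D) / \<bar>z $ j\<bar>"
        using zj by (simp add: \<alpha>_def divide_right_mono)
      also have "\<dots> = 1 + D / \<bar>z $ j\<bar>" using zj by (simp add: field_simps)
      also have "\<dots> \<le> 1 + D / Z" using True Z D by (intro add_left_mono frac_le) auto
      finally show "1 / \<bar>\<alpha>\<bar> \<le> 1 + D / Z" .
    qed simp
    finally show ?thesis .
  qed
qed

text \<open>Every shear preserves Lebesgue measure, so only the volume of the parameter range
  remains; \<open>- 1 / 2 \<le> e\<close> makes the interval length \<open>1 + 2 * e\<close>
  nonnegative.\<close>

lemma nn_integral_shear_int:
  fixes f :: "real^'n::finite \<Rightarrow> ennreal"
  assumes [measurable]: "f \<in> borel_measurable borel" and ij: "i \<noteq> j"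
    and "- 1 / 2 \<le> e" "lo \<le> hi"
  shows "(\<integral>\<^sup>+z. shear_int i j f e lo hi z \<partial>lborel) =
    ennreal ((1 + 2 * e) * (hi - lo) ^ CARD('n)) * (\<integral>\<^sup>+w. f w \<partial>lborel)"
proof -
  have one: "(\<integral>\<^sup>+z. f (shear2 i r (shear1 i j s z)) \<partial>lborel) = (\<integral>\<^sup>+w. f w \<partial>lborel)" for r s
  proof -
    have "det (shear2_mat i r ** shear1_mat i j s) = 1"
      by (simp add: det_mul det_shear1_mat[OF ij] det_shear2_mat)
    from nn_integral_det_1[OF this assms(1)] show ?thesis
      by (simp add: matrix_vector_mul_assoc[symmetric] shear1_mat_vec shear2_mat_vec)
  qed
  have two: "(\<integral>\<^sup>+z. shear2_int i f lo hi (shear1 i j s z) \<partial>lborel) =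
      ennreal ((hi - lo) ^ CARD('n)) * (\<integral>\<^sup>+w. f w \<partial>lborel)" for s
  proof -
    have "(\<integral>\<^sup>+z. shear2_int i f lo hi (shear1 i j s z) \<partial>lborel) =
       (\<integral>\<^sup>+r. \<integral>\<^sup>+z. f (shear2 i r (shear1 i j s z)) * indicator (coord_cube lo hi) r \<partial>lborel \<partial>lborel)"
      unfolding shear2_int_def by (rule lborel_pair.Fubini') measurable
    also have "\<dots> = (\<integral>\<^sup>+r. (\<integral>\<^sup>+w. f w \<partial>lborel) * indicator (coord_cube lo hi) (r :: real^'n) \<partial>lborel)"
      by (intro nn_integral_cong) (simp add: nn_integral_multc one)
    finally show ?thesis
      using emeasure_coord_cube[OF assms(4), where ?'n = 'n] by (simp add: nn_integral_cmult_indicator mult.commute)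
  qed
  have "(\<integral>\<^sup>+z. shear_int i j f e lo hi z \<partial>lborel) =
      (\<integral>\<^sup>+s. \<integral>\<^sup>+z. shear2_int i f lo hi (shear1 i j s z) * indicator {-e..1 + e} s \<partial>lborel \<partial>lborel)"
    unfolding shear_int_def by (rule lborel_pair.Fubini') measurable
  also have "\<dots> = (\<integral>\<^sup>+s. (ennreal ((hi - lo) ^ CARD('n)) * (\<integral>\<^sup>+w. f w \<partial>lborel)) * indicator {-e..1 + e} s \<partial>lborel)"
    by (intro nn_integral_cong) (simp add: nn_integral_multc two)
  also have "\<dots> = (ennreal ((hi - lo) ^ CARD('n)) * (\<integral>\<^sup>+w. f w \<partial>lborel)) * ennreal (1 + 2 * e)"
    using assms(3) by (subst nn_integral_cmult_indicator) (auto simp: algebra_simps)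
  also have "\<dots> = ennreal ((1 + 2 * e) * (hi - lo) ^ CARD('n)) * (\<integral>\<^sup>+w. f w \<partial>lborel)"
    using assms(3,4) by (subst ennreal_mult) (auto simp: mult_ac)
  finally show ?thesis .
qed

section \<open>Siegel transforms and their mean value\<close>

text \<open>The Siegel transform with the zero vector included; Siegel's formula will therefore
  require \<open>f 0 = 0\<close>.\<close>

definition linear_sum :: "(real^'n \<Rightarrow> ennreal) \<Rightarrow> 'n::finite aff \<Rightarrow> ennreal" where
  "linear_sum f a = (\<integral>\<^sup>+l. f (fst a *v l) \<partial>Zs)"

lemma linear_sum_measurable [measurable]:
  assumes [measurable]: "f \<in> borel_measurable borel"
  shows "linear_sum f \<in> borel_measurable borel"
  unfolding linear_sum_def[abs_def]
  by (intro measurable_count_space_sum countable_integer_vectors) measurable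

lemma linear_sum_mono:
  "(\<And>w. f w \<le> f' w) \<Longrightarrow> linear_sum f a \<le> linear_sum f' a"
  unfolding linear_sum_def by (intro nn_integral_mono) simp

lemma right_invariant_linear_sum:
  assumes "f \<in> borel_measurable borel"
  shows "right_invariant (linear_sum f)"
  unfolding right_invariant_def
proof (intro conjI ballI)
  fix a c :: "'a aff" assume c: "c \<in> ASL_int"
  have "linear_sum f (aff_mult a c) = (\<integral>\<^sup>+l. f (fst a *v (fst c *v l)) \<partial>Zs)"
    by (simp add: linear_sum_def aff_mult_def matrix_vector_mul_assoc)
  also have "\<dots> = linear_sum f a"
    unfolding linear_sum_def
    by (rule nn_integral_bij_count_space[OF bij_linear_integer_vectors[OF c], of "\<lambda>l. f (fst a *v l)"])
  finally show "linear_sum f (aff_mult a c) = linear_sum f a" .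
qed (use assms in measurable)

text \<open>\<open>shear_int_shift\<close> supplies the cell-wise comparison in both directions. For
  the upper bound the ranges start at \<open>[0, 1]\<close> and \<open>[S, 2 S]\<close> and grow;
  for the lower bound they start shrunken and grow back to these. The conditions
  \<open>e \<le> 1 / 2\<close> and \<open>2 * (D / \<eta>) \<le> S\<close> keep the shrunken ranges
  from being empty.\<close>

lemma shear_sum_bounds:
  fixes f :: "real^'n::finite \<Rightarrow> ennreal" and g :: "real^'n^'n"
  assumes g: "det g = 1" and f [measurable]: "f \<in> borel_measurable borel"
    and ij: "i \<noteq> j" and \<eta>: "\<eta> > 0"
    and supp: "\<And>w. f w \<noteq> 0 \<Longrightarrow> \<eta> \<le> \<bar>w $ i\<bar> \<and> \<bar>w $ j\<bar> \<le> R"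
    and D: "\<And>q k. q \<in> unit_cube \<Longrightarrow> \<bar>(g *v q) $ k\<bar> \<le> D" "0 \<le> D"
    and S: "0 \<le> S" "Z = S * \<eta> - R" "D < Z" "e = 3 * D / (Z - D)" "e \<le> 1 / 2" "2 * (D / \<eta>) \<le> S"
  defines "X \<equiv> (\<integral>\<^sup>+l. shear_int i j f 0 S (2 * S) (g *v l) \<partial>Zs)"
  shows "X \<le> ennreal ((1 + D / Z) * ((1 + 2 * e) * (S + 2 * (D / \<eta>)) ^ CARD('n))) * (\<integral>\<^sup>+w. f w \<partial>lborel)"
    and "ennreal ((1 - 2 * e) * (S - 2 * (D / \<eta>)) ^ CARD('n)) * (\<integral>\<^sup>+w. f w \<partial>lborel) \<le> ennreal (1 + D / Z) * X"
proof -
  have e0: "0 \<le> e" using D S by simp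
  have d0: "0 \<le> D / \<eta>" using D \<eta> by simp
  have "X \<le> (\<integral>\<^sup>+z. ennreal (1 + D / Z) * shear_int i j f e (S - D / \<eta>) (2 * S + D / \<eta>) z \<partial>lborel)"
    unfolding X_def
  proof (rule lattice_sum_le_integral[OF g])
    fix k q :: "real^'n" assume q: "q \<in> unit_cube"
    show "shear_int i j f 0 S (2 * S) (g *v k) \<le>
        ennreal (1 + D / Z) * shear_int i j f e (S - D / \<eta>) (2 * S + D / \<eta>) (g *v k + g *v q)"
      using shear_int_shift[OF f ij \<eta> supp, of "g *v q" D S Z 0 e "2 * S" "g *v k"] D(1)[OF q] S by simp
  qed measurable
  also have "\<dots> = ennreal (1 + D / Z) * (ennreal ((1 + 2 * e) * (S + 2 * (D / \<eta>)) ^ CARD('n)) * (\<integral>\<^sup>+w. f w \<partial>lborel))"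
  proof -
    have "2 * S + D / \<eta> - (S - D / \<eta>) = S + 2 * (D / \<eta>)" by simp
    then show ?thesis
      using nn_integral_shear_int[OF f ij, of e "S - D / \<eta>" "2 * S + D / \<eta>"] e0 S(1) d0
      by (simp add: nn_integral_cmult)
  qed
  also have "\<dots> = ennreal ((1 + D / Z) * ((1 + 2 * e) * (S + 2 * (D / \<eta>)) ^ CARD('n))) * (\<integral>\<^sup>+w. f w \<partial>lborel)"
    using S D e0 d0 by (subst ennreal_mult[of "1 + D / Z"]) (auto simp: mult.assoc)
  finally show "X \<le> ennreal ((1 + D / Z) * ((1 + 2 * e) * (S + 2 * (D / \<eta>)) ^ CARD('n))) * (\<integral>\<^sup>+w. f w \<partial>lborel)" .
  have "ennreal ((1 - 2 * e) * (S - 2 * (D / \<eta>)) ^ CARD('n)) * (\<integral>\<^sup>+w. f w \<partial>lborel) =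
      (\<integral>\<^sup>+z. shear_int i j f (- e) (S + D / \<eta>) (2 * S - D / \<eta>) z \<partial>lborel)"
  proof -
    have "2 * S - D / \<eta> - (S + D / \<eta>) = S - 2 * (D / \<eta>)" by simp
    then show ?thesis
      using nn_integral_shear_int[OF f ij, of "- e" "S + D / \<eta>" "2 * S - D / \<eta>"] S(5,6)
      by simp
  qed
  also have "\<dots> \<le> (\<integral>\<^sup>+l. ennreal (1 + D / Z) * shear_int i j f 0 S (2 * S) (g *v l) \<partial>Zs)"
  proof (rule integral_le_lattice_sum[OF g, where J = "\<lambda>z. ennreal (1 + D / Z) * shear_int i j f 0 S (2 * S) z"])
    fix k q :: "real^'n" assume q: "q \<in> unit_cube"
    have lo: "Z \<le> (S + D / \<eta>) * \<eta> - R" using S(2) D(2) \<eta> by (simp add: distrib_right)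
    show "shear_int i j f (- e) (S + D / \<eta>) (2 * S - D / \<eta>) (g *v k + g *v q) \<le>
        ennreal (1 + D / Z) * shear_int i j f 0 S (2 * S) (g *v k)"
      using shear_int_shift[OF f ij \<eta> supp, of "- (g *v q)" D "S + D / \<eta>" Z "- e" e "2 * S - D / \<eta>" "g *v k + g *v q"]
        D(1)[OF q] S lo d0 e0 by simp
  qed measurable
  also have "\<dots> = ennreal (1 + D / Z) * X"
    unfolding X_def by (simp add: nn_integral_cmult)
  finally show "ennreal ((1 - 2 * e) * (S - 2 * (D / \<eta>)) ^ CARD('n)) * (\<integral>\<^sup>+w. f w \<partial>lborel) \<le> ennreal (1 + D / Z) * X" .
qed

context ASL_average
begin

text \<open>For every lattice the normalised averages tend to the same number, the integral of
  \<open>f\<close>, so the limit function in \<open>nn_integral_average\<close> is constant and its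
  expectation immediate.\<close>

lemma siegel_formula_region:
  fixes f :: "real^'n \<Rightarrow> ennreal"
  assumes f [measurable]: "f \<in> borel_measurable borel"
    and ij: "i \<noteq> j" and \<eta>: "\<eta> > 0"
    and supp: "\<And>w. f w \<noteq> 0 \<Longrightarrow> \<eta> \<le> \<bar>w $ i\<bar> \<and> \<bar>w $ j\<bar> \<le> R"
  shows "(\<integral>\<^sup>+a. linear_sum f a \<partial>P) = (\<integral>\<^sup>+w. f w \<partial>lborel)"
proof -
  let ?S = "\<lambda>n::nat. real n + 1"
  let ?Q = "\<lambda>n::nat. {0..1} \<times> coord_cube (?S n) (2 * ?S n) :: (real \<times> (real^'n)) set"
  define h :: "real \<times> (real^'n) \<Rightarrow> 'n aff" where "h = (\<lambda>(s, r). (shear2_mat i r ** shear1_mat i j s, 0))"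
  define \<Theta> where "\<Theta> n = uniform_measure lborel (?Q n)" for n
  have [measurable]: "h \<in> borel_measurable borel"
  proof -
    have "h = (\<lambda>t. ((\<lambda>(s, r). shear2_mat i r ** shear1_mat i j s) t, 0))"
      by (auto simp: h_def)
    then show ?thesis using measurable_shear_mat[of i j] by (simp add: borel_measurable_Pair)
  qed
  have Qm [measurable]: "?Q n \<in> sets borel" for n
    unfolding borel_prod[symmetric] by measurable
  have Qe: "emeasure lborel (?Q n) = ennreal (?S n ^ CARD('n))" for n
    using emeasure_coord_cube[of "?S n" "2 * ?S n", where ?'n = 'n]
    by (subst lborel_prod[symmetric], subst lborel.emeasure_pair_measure_Times) auto
  have X: "(\<integral>\<^sup>+t. linear_sum f (aff_mult (h t) a) \<partial>\<Theta> n) =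
     (\<integral>\<^sup>+l. shear_int i j f 0 (?S n) (2 * ?S n) (fst a *v l) \<partial>Zs) / ennreal (?S n ^ CARD('n))" for n a
  proof -
    have "(\<integral>\<^sup>+t. linear_sum f (aff_mult (h t) a) \<partial>\<Theta> n) =
       (\<integral>\<^sup>+t. linear_sum f (aff_mult (h t) a) * indicator (?Q n) t \<partial>lborel) / ennreal (?S n ^ CARD('n))"
      unfolding \<Theta>_def Qe[symmetric] by (rule nn_integral_uniform_measure) measurable
    also have "(\<integral>\<^sup>+t. linear_sum f (aff_mult (h t) a) * indicator (?Q n) t \<partial>lborel) =
       (\<integral>\<^sup>+t. \<integral>\<^sup>+l. f (shear2 i (snd t) (shear1 i j (fst t) (fst a *v l))) * indicator (?Q n) t \<partial>Zs \<partial>lborel)"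
      by (intro nn_integral_cong)
         (auto simp: linear_sum_def h_def aff_mult_def nn_integral_multc split_beta'
            matrix_vector_mul_assoc[symmetric] shear1_mat_vec shear2_mat_vec)
    also have "\<dots> = (\<integral>\<^sup>+l. \<integral>\<^sup>+t. f (shear2 i (snd t) (shear1 i j (fst t) (fst a *v l))) * indicator (?Q n) t \<partial>lborel \<partial>Zs)"
      by (rule nn_integral_count_space_swap[OF countable_integer_vectors]) measurable
    also have "\<dots> = (\<integral>\<^sup>+l. shear_int i j f 0 (?S n) (2 * ?S n) (fst a *v l) \<partial>Zs)"
    proof (rule nn_integral_cong)
      fix l :: "real^'n"
      let ?F = "\<lambda>t. f (shear2 i (snd t) (shear1 i j (fst t) (fst a *v l))) * indicator (?Q n) t"
      have "(\<integral>\<^sup>+t. ?F t \<partial>lborel) = (\<integral>\<^sup>+s. \<integral>\<^sup>+r. ?F (s, r) \<partial>lborel \<partial>lborel)"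
      proof -
        have "?F \<in> borel_measurable (lborel \<Otimes>\<^sub>M lborel)"
          unfolding lborel_prod by measurable
        from lborel.nn_integral_fst[OF this] show ?thesis by (simp only: lborel_prod)
      qed
      also have "\<dots> = shear_int i j f 0 (?S n) (2 * ?S n) (fst a *v l)"
        unfolding shear_int_def shear2_int_def
      proof (rule nn_integral_cong)
        fix s :: real
        show "(\<integral>\<^sup>+r. ?F (s, r) \<partial>lborel) = (\<integral>\<^sup>+r. f (shear2 i r (shear1 i j s (fst a *v l))) *
            indicator (coord_cube (?S n) (2 * ?S n)) r \<partial>lborel) * indicator {- 0..1 + 0} s"
          by (cases "s \<in> {0..1}") (auto simp: indicator_times intro!: nn_integral_cong)
      qed
      finally show "(\<integral>\<^sup>+t. ?F t \<partial>lborel) = shear_int i j f 0 (?S n) (2 * ?S n) (fst a *v l)" .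
    qed
    finally show ?thesis .
  qed
  have "(\<integral>\<^sup>+a. linear_sum f a \<partial>P) = (\<integral>\<^sup>+a. (\<integral>\<^sup>+w. f w \<partial>lborel) \<partial>P)"
  proof (rule nn_integral_average)
    show "right_invariant (linear_sum f)" by (rule right_invariant_linear_sum) fact
    show "prob_space (\<Theta> n)" for n
      unfolding \<Theta>_def by (rule prob_space_uniform_measure) (use Qe[of n] in simp_all)
    show "h \<in> borel_measurable (\<Theta> n)" for n unfolding \<Theta>_def by measurable
    show "h t \<in> ASL" for t
      by (auto simp: h_def ASL_def det_mul det_shear1_mat[OF ij] det_shear2_mat split: prod.split)
    fix a :: "'n aff" assume a: "a \<in> ASL"
    then have g: "det (fst a) = 1" by (simp add: ASL_def)
    obtain D where D: "D > 0" "\<And>q i. q \<in> unit_cube \<Longrightarrow> \<bar>(fst a *v q) $ i\<bar> \<le> D"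
      using unit_cube_image_bounded by metis
    define Z where "Z n = ?S n * \<eta> - R" for n
    define e where "e n = 3 * D / (Z n - D)" for n
    define \<delta> where "\<delta> = D / \<eta>"
    \<comment> \<open>The hypotheses of \<open>shear_sum_bounds\<close>. They hold eventually
      because \<open>Z n\<close> grows linearly while \<open>D\<close> and \<open>\<delta>\<close>
      stay fixed; for the same reason all error factors tend to 1.\<close>
    have ev: "\<forall>\<^sub>F n in sequentially. D < Z n \<and> e n \<le> 1 / 2 \<and> 2 * \<delta> \<le> ?S n"
    proof (intro eventually_conj)
      show "\<forall>\<^sub>F n in sequentially. D < Z n" unfolding Z_def using \<eta> by real_asymp
      have "e \<longlonglongrightarrow> 0" unfolding e_def Z_def using \<eta> by real_asymp
      then have "\<forall>\<^sub>F n in sequentially. e n < 1 / 2" by (rule order_tendstoD) simp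
      then show "\<forall>\<^sub>F n in sequentially. e n \<le> 1 / 2" by eventually_elim simp
      show "\<forall>\<^sub>F n in sequentially. 2 * \<delta> \<le> ?S n" by real_asymp
    qed
    have lim1: "(\<lambda>n. 1 + D / Z n) \<longlonglongrightarrow> 1" unfolding Z_def using \<eta> by real_asymp
    have lime: "e \<longlonglongrightarrow> 0" unfolding e_def Z_def using \<eta> by real_asymp
    have limS: "(\<lambda>n. (?S n + c) ^ CARD('n) / ?S n ^ CARD('n)) \<longlonglongrightarrow> 1" for c :: real
    proof -
      have "(\<lambda>n. (?S n + c) / ?S n) \<longlonglongrightarrow> 1" by real_asymp
      from tendsto_power[OF this, of "CARD('n)"] show ?thesis by (simp add: power_divide)
    qed
    let ?\<Psi> = "\<integral>\<^sup>+w. f w \<partial>lborel"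
    let ?X = "\<lambda>n. \<integral>\<^sup>+l. shear_int i j f 0 (?S n) (2 * ?S n) (fst a *v l) \<partial>Zs"
    show "(\<lambda>n. \<integral>\<^sup>+t. linear_sum f (aff_mult (h t) a) \<partial>\<Theta> n) \<longlonglongrightarrow> ?\<Psi>"
      unfolding X
    proof (rule tendsto_ennreal_squeeze[where
          l = "\<lambda>n. (1 - 2 * e n) * ((?S n + (- (2 * \<delta>))) ^ CARD('n) / ?S n ^ CARD('n)) / (1 + D / Z n)" and
          u = "\<lambda>n. (1 + D / Z n) * (1 + 2 * e n) * ((?S n + 2 * \<delta>) ^ CARD('n) / ?S n ^ CARD('n))"])
      have "(\<lambda>n. (1 - 2 * e n) * ((?S n + (- (2 * \<delta>))) ^ CARD('n) / ?S n ^ CARD('n)) / (1 + D / Z n))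
          \<longlonglongrightarrow> (1 - 2 * 0) * 1 / 1"
        by (intro tendsto_intros lim1 lime limS) simp
      then show "(\<lambda>n. (1 - 2 * e n) * ((?S n + (- (2 * \<delta>))) ^ CARD('n) / ?S n ^ CARD('n)) / (1 + D / Z n)) \<longlonglongrightarrow> 1"
        by simp
      have "(\<lambda>n. (1 + D / Z n) * (1 + 2 * e n) * ((?S n + 2 * \<delta>) ^ CARD('n) / ?S n ^ CARD('n)))
          \<longlonglongrightarrow> 1 * (1 + 2 * 0) * 1"
        by (intro tendsto_intros lim1 lime limS)
      then show "(\<lambda>n. (1 + D / Z n) * (1 + 2 * e n) * ((?S n + 2 * \<delta>) ^ CARD('n) / ?S n ^ CARD('n))) \<longlonglongrightarrow> 1"
        by simp
      show "\<forall>\<^sub>F n in sequentially. ?X n / ennreal (?S n ^ CARD('n)) \<le>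
         ennreal ((1 + D / Z n) * (1 + 2 * e n) * ((?S n + 2 * \<delta>) ^ CARD('n) / ?S n ^ CARD('n))) * ?\<Psi>"
        using ev
      proof eventually_elim
        case (elim n)
        let ?A = "(1 + D / Z n) * ((1 + 2 * e n) * (?S n + 2 * \<delta>) ^ CARD('n))"
        have A: "0 \<le> ?A" using elim D(1) \<eta> by (auto simp: \<delta>_def e_def intro!: mult_nonneg_nonneg)
        have "?X n \<le> ennreal ?A * ?\<Psi>"
          unfolding \<delta>_def
          by (rule shear_sum_bounds(1)[OF g f ij \<eta> supp D(2), where Z = "Z n"])
             (use elim D(1) in \<open>auto simp: Z_def e_def \<delta>_def\<close>)
        then have "?X n / ennreal (?S n ^ CARD('n)) \<le> (ennreal ?A * ?\<Psi>) / ennreal (?S n ^ CARD('n))"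
          by (rule divide_right_mono_ennreal)
        also have "\<dots> = ennreal (?A / ?S n ^ CARD('n)) * ?\<Psi>"
          using A by (simp add: divide_ennreal[symmetric] ennreal_times_divide mult.commute[of _ ?\<Psi>] del: ennreal_mult' ennreal_mult'')
        finally show ?case by (simp add: mult.assoc)
      qed
      show "\<forall>\<^sub>F n in sequentially.
         ennreal ((1 - 2 * e n) * ((?S n + (- (2 * \<delta>))) ^ CARD('n) / ?S n ^ CARD('n)) / (1 + D / Z n)) * ?\<Psi> \<le>
         ?X n / ennreal (?S n ^ CARD('n))"
        using ev
      proof eventually_elim
        case (elim n)
        let ?A = "(1 - 2 * e n) * (?S n - 2 * \<delta>) ^ CARD('n)"
        define p where "p = ?S n ^ CARD('n)"
        have p: "p > 0" by (simp add: p_def)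
        define q where "q = 1 + D / Z n"
        have q: "q > 0" using elim D(1) unfolding q_def by (intro add_pos_nonneg) auto
        have A: "0 \<le> ?A" using elim D(1) \<eta> by (intro mult_nonneg_nonneg) auto
        have "ennreal ?A * ?\<Psi> \<le> ennreal q * ?X n"
          unfolding \<delta>_def q_def
          by (rule shear_sum_bounds(2)[OF g f ij \<eta> supp D(2)])
             (use elim D(1) in \<open>auto simp: Z_def e_def \<delta>_def\<close>)
        then have "ennreal (1 / (p * q)) * (ennreal ?A * ?\<Psi>) \<le> ennreal (1 / (p * q)) * (ennreal q * ?X n)"
          by (intro mult_left_mono) auto
        also have "\<dots> = ennreal (1 / p) * ?X n"
          using p q by (simp add: mult.assoc[symmetric] ennreal_mult[symmetric])
        also have "\<dots> = ?X n / ennreal p"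
        proof -
          have "ennreal (1 / p) = 1 / ennreal p"
            using p divide_ennreal[of 1 p] by simp
          then have "ennreal (1 / p) * ?X n = ?X n * (1 / ennreal p)"
            by (simp only: mult.commute)
          also have "\<dots> = ?X n / ennreal p"
            by (simp only: ennreal_times_divide mult_1_right)
          finally show ?thesis .
        qed
        also have "ennreal (1 / (p * q)) * (ennreal ?A * ?\<Psi>) = ennreal (?A / p / q) * ?\<Psi>"
          using p q A by (subst mult.assoc[symmetric], subst ennreal_mult[symmetric]) auto
        finally show ?case by (simp add: p_def q_def)
      qed
    qed
  qed simp
  then show ?thesis by (simp add: emeasure_space_1)
qed

text \<open>The regions of the preceding lemma exhaust the set where \<open>w $ i\<close> is
  nonzero, and monotone convergence applies to both sides.\<close>

lemma siegel_formula_coordinate: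
  fixes f :: "real^'n \<Rightarrow> ennreal"
  assumes f [measurable]: "f \<in> borel_measurable borel" and ij: "i \<noteq> j"
    and supp: "\<And>w. f w \<noteq> 0 \<Longrightarrow> w $ i \<noteq> 0"
  shows "(\<integral>\<^sup>+a. linear_sum f a \<partial>P) = (\<integral>\<^sup>+w. f w \<partial>lborel)"
proof -
  define A where "A n = {w :: real^'n. 1 / (real n + 1) \<le> \<bar>w $ i\<bar> \<and> \<bar>w $ j\<bar> \<le> real n}" for n :: nat
  have [measurable]: "A n \<in> sets borel" for n unfolding A_def by measurable
  define F where "F n w = f w * indicator (A n) w" for n w
  have [measurable]: "F n \<in> borel_measurable borel" for n unfolding F_def[abs_def] by measurable
  have Amono: "A m \<subseteq> A n" if "m \<le> n" for m n
  proof -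
    have "1 / (real n + 1) \<le> 1 / (real m + 1)" using that by (intro frac_le) auto
    then show ?thesis using that by (auto simp: A_def)
  qed
  have mono: "F m w \<le> F n w" if "m \<le> n" for m n w
    unfolding F_def using Amono[OF that] by (intro mult_left_mono) (auto simp: indicator_def)
  have sup: "(SUP n. F n w) = f w" for w
  proof (cases "f w = 0")
    case True then show ?thesis by (simp add: F_def)
  next
    case False
    obtain n1 :: nat where n1: "\<bar>w $ j\<bar> \<le> real n1" using real_arch_simple by blast
    obtain n2 :: nat where n2: "1 / \<bar>w $ i\<bar> \<le> real n2" using real_arch_simple by blast
    have wi: "\<bar>w $ i\<bar> > 0" using supp[OF False] by simp
    have "1 / (real (max n1 n2) + 1) \<le> \<bar>w $ i\<bar>"
    proof -
      have "1 / \<bar>w $ i\<bar> \<le> real (max n1 n2) + 1" using n2 by linarith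
      then show ?thesis using wi by (simp add: divide_le_eq mult.commute)
    qed
    then have "w \<in> A (max n1 n2)" using n1 by (auto simp: A_def)
    then have "F (max n1 n2) w = f w" by (simp add: F_def)
    moreover have "F n w \<le> f w" for n by (auto simp: F_def indicator_def)
    ultimately show ?thesis by (intro antisym SUP_least) (auto intro: SUP_upper2[of "max n1 n2"])
  qed
  have 1: "(\<integral>\<^sup>+a. linear_sum (F n) a \<partial>P) = (\<integral>\<^sup>+w. F n w \<partial>lborel)" for n
    by (rule siegel_formula_region[OF _ ij, of _ "1 / (real n + 1)" "real n"])
       (auto simp: F_def A_def split: split_indicator_asm)
  have ls: "linear_sum f a = (SUP n. linear_sum (F n) a)" for a
  proof -
    have "linear_sum f a = (\<integral>\<^sup>+l. (SUP n. F n (fst a *v l)) \<partial>Zs)" by (simp add: linear_sum_def sup)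
    also have "\<dots> = (SUP n. linear_sum (F n) a)"
      unfolding linear_sum_def
      by (rule nn_integral_monotone_convergence_SUP) (auto simp: incseq_def le_fun_def mono)
    finally show ?thesis .
  qed
  have "(\<integral>\<^sup>+a. linear_sum f a \<partial>P) = (SUP n. \<integral>\<^sup>+a. linear_sum (F n) a \<partial>P)"
    unfolding ls
    by (rule nn_integral_monotone_convergence_SUP)
       (auto simp: incseq_def le_fun_def intro!: linear_sum_mono mono)
  also have "\<dots> = (\<integral>\<^sup>+w. (SUP n. F n w) \<partial>lborel)"
    unfolding 1
    by (rule nn_integral_monotone_convergence_SUP[symmetric]) (auto simp: incseq_def le_fun_def mono)
  finally show ?thesis by (simp add: sup)
qed

text \<open>What remains are the vectors with \<open>w $ i0 = 0\<close> for a fixed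
  \<open>i0\<close>. Such a vector, unless 0, has a nonzero coordinate \<open>i\<close>, and the
  formula for \<open>i\<close>, applied to the part of \<open>f\<close> on this hyperplane, gives
  expected sum 0 because the hyperplane is null. So \<open>f\<close> may be replaced by
  \<open>f1\<close>.\<close>

lemma siegel_formula:
  fixes f :: "real^'n \<Rightarrow> ennreal"
  assumes dim: "CARD('n) \<ge> 2" and f [measurable]: "f \<in> borel_measurable borel" and f0: "f 0 = 0"
  shows "(\<integral>\<^sup>+a. linear_sum f a \<partial>P) = (\<integral>\<^sup>+w. f w \<partial>lborel)"
proof -
  have other: "\<exists>j. i \<noteq> j" for i :: 'n
  proof (rule ccontr)
    assume "\<nexists>j. i \<noteq> j"
    then have "(UNIV :: 'n set) = {i}" by auto
    then have "CARD('n) = card {i}" by (rule arg_cong)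
    then show False using dim by simp
  qed
  have coord: "(\<integral>\<^sup>+a. linear_sum h a \<partial>P) = (\<integral>\<^sup>+w. h w \<partial>lborel)"
    if "h \<in> borel_measurable borel" "\<And>w. h w \<noteq> 0 \<Longrightarrow> w $ i \<noteq> 0" for h i
    using siegel_formula_coordinate[OF that(1) _ that(2)] other[of i] by blast
  fix i0 :: 'n
  have "{w :: real^'n. w $ i0 = 0} \<in> null_sets lebesgue"
    using negligible_standard_hyperplane_cart[of i0] by (simp add: negligible_iff_null_sets)
  then have null: "{w :: real^'n. w $ i0 = 0} \<in> null_sets lborel"
    by (subst (asm) null_sets_completion_iff) auto
  define f1 where "f1 w = (if w $ i0 = 0 then 0 else f w)" for w
  define f2 where "f2 i w = (if w $ i0 = 0 \<and> w $ i \<noteq> 0 then f w else 0)" for i w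
  have [measurable]: "f1 \<in> borel_measurable borel" "f2 i \<in> borel_measurable borel" for i
    unfolding f1_def[abs_def] f2_def[abs_def] by measurable
  have z: "(\<integral>\<^sup>+a. linear_sum (f2 i) a \<partial>P) = 0" for i
  proof -
    have "(\<integral>\<^sup>+a. linear_sum (f2 i) a \<partial>P) = (\<integral>\<^sup>+w. f2 i w \<partial>lborel)"
      by (rule coord[of _ i]) (auto simp: f2_def split: if_splits)
    also have "\<dots> = (\<integral>\<^sup>+w. 0 \<partial>(lborel :: (real^'n) measure))"
      by (rule nn_integral_cong_AE, use AE_not_in[OF null] in eventually_elim) (auto simp: f2_def)
    finally show ?thesis by simp
  qed
  have le: "f w \<le> f1 w + (\<Sum>i\<in>UNIV. f2 i w)" for w
  proof (cases "f w = 0 \<or> w $ i0 \<noteq> 0")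
    case True then show ?thesis by (auto simp: f1_def)
  next
    case False
    then have "w \<noteq> 0" using f0 by auto
    then obtain i where "w $ i \<noteq> 0" by (auto simp: vec_eq_iff)
    then have "f w = f2 i w" using False by (simp add: f2_def)
    also have "\<dots> \<le> (\<Sum>i\<in>UNIV. f2 i w)" by (rule member_le_sum) auto
    finally show ?thesis by (simp add: add_increasing)
  qed
  have "(\<integral>\<^sup>+a. linear_sum f a \<partial>P) \<le> (\<integral>\<^sup>+a. linear_sum f1 a + (\<Sum>i\<in>UNIV. linear_sum (f2 i) a) \<partial>P)"
  proof (rule nn_integral_mono)
    fix a
    have "linear_sum f a \<le> (\<integral>\<^sup>+l. f1 (fst a *v l) + (\<Sum>i\<in>UNIV. f2 i (fst a *v l)) \<partial>Zs)"
      unfolding linear_sum_def by (intro nn_integral_mono le)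
    also have "\<dots> = linear_sum f1 a + (\<Sum>i\<in>UNIV. linear_sum (f2 i) a)"
      unfolding linear_sum_def by (simp add: nn_integral_add nn_integral_sum)
    finally show "linear_sum f a \<le> linear_sum f1 a + (\<Sum>i\<in>UNIV. linear_sum (f2 i) a)" .
  qed
  also have "\<dots> = (\<integral>\<^sup>+a. linear_sum f1 a \<partial>P)"
    by (simp add: nn_integral_add nn_integral_sum z)
  finally have 1: "(\<integral>\<^sup>+a. linear_sum f a \<partial>P) \<le> (\<integral>\<^sup>+a. linear_sum f1 a \<partial>P)" .
  have "(\<integral>\<^sup>+a. linear_sum f1 a \<partial>P) \<le> (\<integral>\<^sup>+a. linear_sum f a \<partial>P)"
    unfolding linear_sum_def by (intro nn_integral_mono) (auto simp: f1_def)
  with 1 have "(\<integral>\<^sup>+a. linear_sum f a \<partial>P) = (\<integral>\<^sup>+a. linear_sum f1 a \<partial>P)" by simp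
  also have "\<dots> = (\<integral>\<^sup>+w. f1 w \<partial>lborel)" by (rule coord[of _ i0]) (auto simp: f1_def split: if_splits)
  also have "\<dots> = (\<integral>\<^sup>+w. f w \<partial>lborel)"
    by (rule nn_integral_cong_AE, use AE_not_in[OF null] in eventually_elim) (auto simp: f1_def)
  finally show ?thesis .
qed

end

section \<open>Moments\<close>

lemma compact_subset_positive:
  fixes A :: "(real^'n::finite) set"
  assumes A [measurable]: "A \<in> sets borel" and pos: "0 < emeasure lborel A"
  obtains K where "compact K" "K \<subseteq> A" "0 < emeasure lborel K"
proof -
  \<comment> \<open>The measure of \<open>A\<close> may be infinite; a closed subset missing less
    than a finite \<open>c\<close> still has positive measure.\<close>
  have "\<exists>c>0. ennreal c \<le> emeasure lborel A"
  proof (cases "emeasure lborel A")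
    case (real r)
    then show ?thesis using pos by (intro exI[of _ r]) auto
  qed (auto intro: exI[of _ 1])
  then obtain c where c: "c > 0" "ennreal c \<le> emeasure lborel A" by blast
  have "A \<in> sets lebesgue" by simp
  then obtain T where T: "closed T" "T \<subseteq> A" "A - T \<in> lmeasurable" "emeasure lebesgue (A - T) < ennreal c"
    using c(1) by (rule sets_lebesgue_inner_closed)
  have [measurable]: "T \<in> sets borel" using T by auto
  have Tpos: "emeasure lborel T \<noteq> 0"
  proof
    assume "emeasure lborel T = 0"
    then have "emeasure lborel A \<le> emeasure lborel (A - T)"
      using emeasure_subadditive[of T lborel "A - T"] T(2) by (simp add: Un_absorb1)
    then show False using T(4) c(2) by simp
  qed
  have "\<exists>n::nat. emeasure lborel (T \<inter> cball 0 (real n)) \<noteq> 0"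
  proof (rule ccontr)
    assume "\<nexists>n::nat. emeasure lborel (T \<inter> cball 0 (real n)) \<noteq> 0"
    then have "T \<inter> cball 0 (real n) \<in> null_sets lborel" for n :: nat by (intro null_setsI) auto
    then have "(\<Union>n::nat. T \<inter> cball 0 (real n)) \<in> null_sets lborel" by (intro null_sets_UN)
    moreover have "(\<Union>n::nat. T \<inter> cball 0 (real n)) = T" by (auto simp: real_arch_simple)
    ultimately show False using Tpos by auto
  qed
  then obtain n :: nat where "emeasure lborel (T \<inter> cball 0 (real n)) \<noteq> 0" ..
  then show ?thesis
    using T by (intro that[of "T \<inter> cball 0 (real n)"]) (auto intro: closed_Int_compact simp: zero_less_iff_neq_zero)
qed

text \<open>Take a compact \<open>K\<close> inside \<open>A\<close> and an open \<open>U\<close>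
  around it that exceeds it by less than \<open>1 / m\<close> of its measure. For small
  \<open>w\<close>, all terms of a progression of length \<open>m\<close> starting in
  \<open>K\<close> stay in \<open>U\<close>, so most starting points keep the whole progression
  inside \<open>K\<close>. The admissible \<open>w\<close> fill a punctured ball, which is not
  null.\<close>

lemma progressions_positive:
  fixes A :: "(real^'n::finite) set" and m :: nat
  assumes A [measurable]: "A \<in> sets borel" and pos: "0 < emeasure lborel A" and m: "0 < m"
  shows "0 < (\<integral>\<^sup>+w. (\<integral>\<^sup>+u. (if w \<noteq> 0 then \<Prod>j<m. indicator A (u + real j *\<^sub>R w) else 0) \<partial>lborel) \<partial>lborel)"
    (is "0 < (\<integral>\<^sup>+w. ?G w \<partial>lborel)")
proof -
  obtain K where K: "compact K" "K \<subseteq> A" "0 < emeasure lborel K"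
    using compact_subset_positive[OF A pos] by metis
  have [measurable]: "K \<in> sets borel" using K by (simp add: compact_imp_closed)
  obtain k where k: "emeasure lborel K = ennreal k" "k > 0"
    using emeasure_compact_finite[OF K(1)] K(3) by (cases "emeasure lborel K") auto
  have "K \<in> sets lebesgue" "k / real m > 0" using k m by simp_all
  then obtain U where U: "open U" "K \<subseteq> U" "U - K \<in> lmeasurable" "emeasure lebesgue (U - K) < ennreal (k / real m)"
    by (rule sets_lebesgue_outer_open)
  have [measurable]: "U \<in> sets borel" using U by auto
  have UK: "emeasure lborel (U - K) < ennreal (k / real m)" using U(4) by simp
  obtain d where d: "d > 0" "(\<Union>x\<in>K. ball x d) \<subseteq> U"
    using compact_subset_open_imp_ball_epsilon_subset[OF K(1) U(1,2)] by metis
  have Gpos: "?G w \<noteq> 0" if w: "w \<in> ball 0 (d / real m)" "w \<noteq> 0" for w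
  proof
    assume G0: "?G w = 0"
    let ?E = "{u. \<forall>j<m. u + real j *\<^sub>R w \<in> K}"
    let ?F = "\<lambda>j. {u. u + real j *\<^sub>R w \<in> U - K}"
    have Em [measurable]: "?E \<in> sets borel" by measurable
    have Fm [measurable]: "?F j \<in> sets borel" for j by measurable
    have "emeasure lborel ?E = (\<integral>\<^sup>+u. indicator ?E u \<partial>lborel)" by simp
    also have "\<dots> \<le> ?G w"
    proof (rule nn_integral_mono)
      fix u
      show "indicator ?E u \<le> (if w \<noteq> 0 then \<Prod>j<m. indicator A (u + real j *\<^sub>R w) else 0 :: ennreal)"
      proof (cases "u \<in> ?E")
        case True
        then have "(\<Prod>j<m. indicator A (u + real j *\<^sub>R w)) = (1 :: ennreal)"
          using K(2) by (intro prod.neutral) (auto simp: indicator_def)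
        then show ?thesis using w by (simp add: indicator_def)
      qed simp
    qed
    finally have E0: "emeasure lborel ?E = 0" using G0 by simp
    \<comment> \<open>A point of \<open>K\<close> either starts a progression inside
      \<open>K\<close> or has one of its \<open>m\<close> terms in \<open>U - K\<close>. Each
      exceptional set has measure less than \<open>k / m\<close>, so together they cannot cover
      \<open>K\<close>.\<close>
    have "K \<subseteq> ?E \<union> (\<Union>j<m. ?F j)"
    proof
      fix u assume u: "u \<in> K"
      have "u + real j *\<^sub>R w \<in> U" if "j < m" for j
      proof -
        have "norm (real j *\<^sub>R w) \<le> real m * norm w" using that by (simp add: mult_right_mono)
        also have "\<dots> < d" using w(1) m by (simp add: field_simps)
        finally have "u + real j *\<^sub>R w \<in> ball u d" by (simp add: dist_norm)
        then show ?thesis using d(2) u by blast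
      qed
      then show "u \<in> ?E \<union> (\<Union>j<m. ?F j)" by auto
    qed
    then have "emeasure lborel K \<le> emeasure lborel (?E \<union> (\<Union>j<m. ?F j))"
      by (intro emeasure_mono) auto
    also have "\<dots> \<le> emeasure lborel ?E + emeasure lborel (\<Union>j<m. ?F j)"
      by (rule emeasure_subadditive) auto
    also have "\<dots> \<le> (\<Sum>j<m. emeasure lborel (?F j))"
      unfolding E0 by (simp, rule emeasure_subadditive_finite) auto
    also have "\<dots> = (\<Sum>j<m. emeasure lborel (U - K))"
    proof (rule sum.cong)
      fix j
      have "emeasure lborel (?F j) = (\<integral>\<^sup>+u. indicator (?F j) u \<partial>lborel)"
        by (rule nn_integral_indicator[symmetric]) simp
      also have "\<dots> = (\<integral>\<^sup>+u. indicator (U - K) (u + real j *\<^sub>R w) \<partial>lborel)"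
        by (intro nn_integral_cong) (simp add: indicator_def)
      also have "\<dots> = emeasure lborel (U - K)"
        by (subst nn_integral_translate) auto
      finally show "emeasure lborel (?F j) = emeasure lborel (U - K)" .
    qed simp
    also have "\<dots> = of_nat m * emeasure lborel (U - K)" by simp
    also have "\<dots> < of_nat m * ennreal (k / real m)"
      using UK m by (intro ennreal_mult_strict_left_mono) (auto simp: of_nat_less_top)
    also have "\<dots> = ennreal k"
      using m k by (simp add: ennreal_of_nat_eq_real_of_nat ennreal_mult[symmetric])
    finally show False using k by simp
  qed
  have Gm [measurable]: "?G \<in> borel_measurable borel"
    by measurable
  have "(\<integral>\<^sup>+w. ?G w \<partial>lborel) \<noteq> 0"
  proof
    assume "(\<integral>\<^sup>+w. ?G w \<partial>lborel) = 0"
    then have "AE w in lborel. ?G w = 0" by (subst (asm) nn_integral_0_iff_AE) measurable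
    then have "AE w in lborel. w \<notin> ball 0 (d / real m) - {0 :: real^'n}"
      by eventually_elim (use Gpos in blast)
    then have "ball 0 (d / real m) - {0 :: real^'n} \<in> null_sets lborel"
      by (subst AE_iff_null_sets) auto
    then have "negligible (ball 0 (d / real m) - {0 :: real^'n})"
      by (simp add: negligible_iff_null_sets null_sets_completionI)
    then have "negligible (ball 0 (d / real m) :: (real^'n) set)"
      using negligible_insert[of 0 "ball 0 (d / real m) - {0 :: real^'n}"] d(1) m by (simp add: insert_absorb)
    moreover have "(0 :: real^'n) \<in> ball 0 (d / real m)" using d(1) m by simp
    ultimately show False
      using open_not_negligible[OF open_ball, of "0 :: real^'n" "d / real m"] by blast
  qed
  then show ?thesis by (simp add: zero_less_iff_neq_zero)
qed

section \<open>Moments of the number of points\<close>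

definition point_sum :: "(real^'n \<Rightarrow> ennreal) \<Rightarrow> 'n::finite aff \<Rightarrow> ennreal" where
  "point_sum f a = (\<integral>\<^sup>+k. f (aff_act a k) \<partial>Zs)"

lemma point_sum_measurable [measurable]:
  assumes [measurable]: "f \<in> borel_measurable borel"
  shows "point_sum f \<in> borel_measurable borel"
  unfolding point_sum_def[abs_def] aff_act_def
  by (intro measurable_count_space_sum countable_integer_vectors) measurable

lemma ASL_linear_eq_0:
  assumes "a \<in> ASL"
  shows "fst a *v l = 0 \<longleftrightarrow> l = 0"
proof -
  have "invertible (fst a)"
    using assms by (simp add: ASL_def invertible_det_nz)
  then obtain h where h: "h ** fst a = mat 1" by (auto simp: invertible_def)
  have "h *v (fst a *v l) = l" by (simp add: matrix_vector_mul_assoc h)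
  then show ?thesis by (metis matrix_vector_mult_0_right)
qed

lemma zero_integer_vectors: "0 \<in> integer_vectors"
  by (simp add: integer_vectors_def)

lemma nn_integral_Zs_single:
  "(\<integral>\<^sup>+l. (if l = 0 then c else 0) \<partial>(Zs :: (real^'n::finite) measure)) = c"
proof -
  have "(\<integral>\<^sup>+l. (if l = 0 then c else 0) \<partial>(Zs :: (real^'n) measure)) = (\<integral>\<^sup>+l. c * indicator {0} l \<partial>(Zs :: (real^'n) measure))"
    by (intro nn_integral_cong) (auto simp: indicator_def)
  also have "\<dots> = c"
    using zero_integer_vectors by (subst nn_integral_cmult_indicator) auto
  finally show ?thesis .
qed

lemma bij_translate_integer_vectors:
  assumes "k \<in> integer_vectors"
  shows "bij_betw ((+) k) integer_vectors integer_vectors"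
  by (rule bij_betw_byWitness[of _ "\<lambda>v. v - k"]) (use assms in \<open>auto simp: integer_vectors_def\<close>)

text \<open>Write the second point of each pair as \<open>k + l\<close>. The terms with
  \<open>l = 0\<close> give the count itself, because indicators are idempotent; they are split off
  since the pair formula needs a function vanishing at \<open>w = 0\<close>.\<close>

lemma point_sum_square:
  assumes a: "a \<in> ASL"
  shows "point_sum (indicator A) a * point_sum (indicator A) a =
    pair_sum (\<lambda>(u, w). if w = 0 then 0 else indicator A u * indicator A (u + w)) a + point_sum (indicator A) a"
proof -
  let ?N = "point_sum (indicator A) a"
  let ?x = "\<lambda>k. indicator A (aff_act a k) :: ennreal"
  have act: "aff_act a (k + l) = aff_act a k + fst a *v l" for k l
    by (simp add: aff_act_def matrix_vector_right_distrib)
  have "?N * ?N = (\<integral>\<^sup>+k. ?x k * ?N \<partial>Zs)"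
    by (simp add: nn_integral_multc point_sum_def)
  also have "\<dots> = (\<integral>\<^sup>+k. \<integral>\<^sup>+l. ?x k * ?x (k + l) \<partial>Zs \<partial>Zs)"
  proof (intro nn_integral_cong)
    fix k :: "real^'a" assume "k \<in> space Zs"
    then have k: "k \<in> integer_vectors" by simp
    have "?N = (\<integral>\<^sup>+l. ?x (k + l) \<partial>Zs)"
      unfolding point_sum_def by (rule nn_integral_bij_count_space[OF bij_translate_integer_vectors[OF k], symmetric])
    then show "?x k * ?N = (\<integral>\<^sup>+l. ?x k * ?x (k + l) \<partial>Zs)" by (simp add: nn_integral_cmult)
  qed
  also have "\<dots> = (\<integral>\<^sup>+l. \<integral>\<^sup>+k. ?x k * ?x (k + l) \<partial>Zs \<partial>Zs)"
    by (rule nn_integral_count_space_swap[OF countable_integer_vectors]) simp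
  also have "\<dots> = (\<integral>\<^sup>+l. (\<integral>\<^sup>+k. (if fst a *v l = 0 then 0 else ?x k * indicator A (aff_act a k + fst a *v l)) \<partial>Zs)
       + (if l = 0 then ?N else 0) \<partial>Zs)"
    by (intro nn_integral_cong) (auto simp: ASL_linear_eq_0[OF a] act point_sum_def indicator_def intro!: nn_integral_cong)
  also have "\<dots> = pair_sum (\<lambda>(u, w). if w = 0 then 0 else indicator A u * indicator A (u + w)) a + ?N"
    by (subst nn_integral_add) (auto simp: nn_integral_Zs_single pair_sum_def)
  finally show ?thesis .
qed

text \<open>A single nonzero term of the sum yields \<open>k\<close> and \<open>l \<noteq> 0\<close>
  such that the \<open>m\<close> distinct vectors \<open>k + j l\<close> are all mapped into
  \<open>A\<close>.\<close>

lemma point_sum_progression: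
  fixes A :: "(real^'n::finite) set"
  assumes a: "a \<in> ASL"
    and nz: "pair_sum (\<lambda>(u, w). if w \<noteq> 0 then \<Prod>j<m. indicator A (u + real j *\<^sub>R w) else 0) a \<noteq> 0"
  shows "of_nat m \<le> point_sum (indicator A) a"
proof -
  let ?f = "\<lambda>(u, w). if w \<noteq> 0 then \<Prod>j<m. indicator A (u + real j *\<^sub>R w) else (0 :: ennreal)"
  have "\<exists>l\<in>integer_vectors. \<exists>k\<in>integer_vectors. ?f (aff_act a k, fst a *v l) \<noteq> 0"
  proof (rule ccontr)
    assume "\<not> ?thesis"
    then have "pair_sum ?f a = (\<integral>\<^sup>+l. \<integral>\<^sup>+k. 0 \<partial>(Zs :: (real^'n) measure) \<partial>(Zs :: (real^'n) measure))"
      unfolding pair_sum_def by (intro nn_integral_cong) auto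
    then show False using nz by simp
  qed
  then obtain k l where k: "k \<in> integer_vectors" "l \<in> integer_vectors" and
      f: "?f (aff_act a k, fst a *v l) \<noteq> 0" by blast
  have l0: "l \<noteq> 0" using f ASL_linear_eq_0[OF a] by (auto split: if_splits)
  have inA: "aff_act a (k + real j *\<^sub>R l) \<in> A" if "j < m" for j
  proof -
    have "aff_act a (k + real j *\<^sub>R l) = aff_act a k + real j *\<^sub>R (fst a *v l)"
      by (simp add: aff_act_def matrix_vector_right_distrib vector_scaleR_matrix_ac matrix_vector_mult_scaleR)
    moreover have "indicator A (aff_act a k + real j *\<^sub>R (fst a *v l)) \<noteq> (0 :: ennreal)"
      using f that by (auto split: if_splits)
    ultimately show ?thesis by (auto simp: indicator_def split: if_splits)
  qed
  let ?B = "(\<lambda>j. k + real j *\<^sub>R l) ` {..<m}"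
  have B: "?B \<subseteq> integer_vectors" using k by (auto simp: integer_vectors_def)
  have "inj_on (\<lambda>j. k + real j *\<^sub>R l) {..<m}" using l0 by (auto simp: inj_on_def)
  then have "of_nat m = emeasure (Zs :: (real^'n) measure) ?B"
    using B by (simp add: emeasure_count_space card_image)
  also have "\<dots> = (\<integral>\<^sup>+v. indicator ?B v \<partial>Zs)" using B by simp
  also have "\<dots> \<le> point_sum (indicator A) a"
    unfolding point_sum_def by (intro nn_integral_mono) (auto simp: indicator_def inA)
  finally show ?thesis .
qed

context ASL_average
begin

text \<open>Averaging over translations integrates out the first point; what is left is the Siegel
  transform of a function of the difference vector.\<close>

lemma nn_integral_pair_sum:
  fixes f :: "(real^'n) \<times> (real^'n) \<Rightarrow> ennreal"
  assumes "CARD('n) \<ge> 2" and [measurable]: "f \<in> borel_measurable borel" and f0: "\<And>u. f (u, 0) = 0"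
  shows "(\<integral>\<^sup>+a. pair_sum f a \<partial>P) = (\<integral>\<^sup>+w. \<integral>\<^sup>+u. f (u, w) \<partial>lborel \<partial>lborel)"
proof -
  have "(\<integral>\<^sup>+a. pair_sum f a \<partial>P) = (\<integral>\<^sup>+a. linear_sum (\<lambda>w. \<integral>\<^sup>+u. f (u, w) \<partial>lborel) a \<partial>P)"
    unfolding linear_sum_def by (rule nn_integral_pair_sum_fst) measurable
  also have "\<dots> = (\<integral>\<^sup>+w. \<integral>\<^sup>+u. f (u, w) \<partial>lborel \<partial>lborel)"
    by (rule siegel_formula[OF assms(1)]) (auto simp: f0)
  finally show ?thesis .
qed

text \<open>A sum over points is a pair sum concentrated on \<open>l = 0\<close>, so the average
  over translations is all that is needed.\<close>

lemma nn_integral_point_sum: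
  fixes f :: "real^'n \<Rightarrow> ennreal"
  assumes [measurable]: "f \<in> borel_measurable borel"
  shows "(\<integral>\<^sup>+a. point_sum f a \<partial>P) = (\<integral>\<^sup>+u. f u \<partial>lborel)"
proof -
  let ?f = "\<lambda>x :: (real^'n) \<times> (real^'n). if snd x = 0 then f (fst x) else 0"
  have "(\<integral>\<^sup>+a. point_sum f a \<partial>P) = (\<integral>\<^sup>+a. pair_sum ?f a \<partial>P)"
  proof (rule nn_integral_cong_AE, use AE_ASL in eventually_elim)
    fix a :: "'n aff" assume a: "a \<in> ASL"
    have "pair_sum ?f a = (\<integral>\<^sup>+l. (if l = 0 then point_sum f a else 0) \<partial>(Zs :: (real^'n) measure))"
      unfolding pair_sum_def by (intro nn_integral_cong) (simp add: ASL_linear_eq_0[OF a] point_sum_def)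
    then show "point_sum f a = pair_sum ?f a" by (simp add: nn_integral_Zs_single)
  qed
  also have "\<dots> = (\<integral>\<^sup>+a. (\<integral>\<^sup>+l. \<integral>\<^sup>+u. ?f (u, fst a *v l) \<partial>lborel \<partial>Zs) \<partial>P)"
    by (rule nn_integral_pair_sum_fst) measurable
  also have "\<dots> = (\<integral>\<^sup>+a. (\<integral>\<^sup>+u. f u \<partial>lborel) \<partial>P)"
  proof (rule nn_integral_cong_AE, use AE_ASL in eventually_elim)
    fix a :: "'n aff" assume a: "a \<in> ASL"
    have "(\<integral>\<^sup>+l. \<integral>\<^sup>+u. ?f (u, fst a *v l) \<partial>lborel \<partial>Zs) =
       (\<integral>\<^sup>+l. (if l = 0 then (\<integral>\<^sup>+u. f u \<partial>lborel) else 0) \<partial>(Zs :: (real^'n) measure))"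
      by (intro nn_integral_cong) (simp add: ASL_linear_eq_0[OF a])
    then show "(\<integral>\<^sup>+l. \<integral>\<^sup>+u. ?f (u, fst a *v l) \<partial>lborel \<partial>Zs) = (\<integral>\<^sup>+u. f u \<partial>lborel)"
      by (simp add: nn_integral_Zs_single)
  qed
  also have "\<dots> = (\<integral>\<^sup>+u. f u \<partial>lborel)" by (simp add: emeasure_space_1)
  finally show ?thesis .
qed

lemma second_moment:
  assumes dim: "CARD('n) \<ge> 2" and [measurable]: "A \<in> sets borel"
  shows "(\<integral>\<^sup>+a. point_sum (indicator A) a * point_sum (indicator A) a \<partial>P) =
    emeasure lborel A * emeasure lborel A + emeasure lborel A"
proof -
  let ?f = "\<lambda>(u :: real^'n, w). if w = 0 then 0 else indicator A u * indicator A (u + w) :: ennreal"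
  have [measurable]: "?f \<in> borel_measurable borel"
    unfolding split_beta' by measurable
  have "(\<integral>\<^sup>+a. point_sum (indicator A) a * point_sum (indicator A) a \<partial>P) =
      (\<integral>\<^sup>+a. pair_sum ?f a + point_sum (indicator A) a \<partial>P)"
    by (rule nn_integral_cong_AE, use AE_ASL in eventually_elim) (rule point_sum_square)
  also have "\<dots> = (\<integral>\<^sup>+a. pair_sum ?f a \<partial>P) + emeasure lborel A"
    by (subst nn_integral_add) (auto simp: nn_integral_point_sum)
  also have "(\<integral>\<^sup>+a. pair_sum ?f a \<partial>P) = (\<integral>\<^sup>+w. \<integral>\<^sup>+u. ?f (u, w) \<partial>lborel \<partial>lborel)"
    by (rule nn_integral_pair_sum[OF dim]) auto
  \<comment> \<open>The excluded diagonal \<open>w = 0\<close> matters for the sum but is null for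
    the integral.\<close>
  also have "\<dots> = (\<integral>\<^sup>+w. \<integral>\<^sup>+u. indicator A u * indicator A (u + w) \<partial>lborel \<partial>lborel)"
    by (rule nn_integral_cong_AE, use AE_lborel_singleton[of 0] in eventually_elim) simp
  also have "\<dots> = (\<integral>\<^sup>+u. \<integral>\<^sup>+w. indicator A u * indicator A (u + w) \<partial>lborel \<partial>lborel)"
    by (rule lborel_pair.Fubini') measurable
  also have "\<dots> = (\<integral>\<^sup>+u. indicator A u * emeasure lborel A \<partial>lborel)"
  proof (rule nn_integral_cong)
    fix u :: "real^'n"
    have "(\<integral>\<^sup>+w. indicator A (w + u) \<partial>lborel) = emeasure lborel A"
      by (subst nn_integral_translate) auto
    then show "(\<integral>\<^sup>+w. indicator A u * indicator A (u + w) \<partial>lborel) = indicator A u * emeasure lborel A"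
      by (simp add: nn_integral_cmult add.commute)
  qed
  also have "\<dots> = emeasure lborel A * emeasure lborel A"
    by (simp add: nn_integral_multc)
  finally show ?thesis .
qed

lemma avoidance_bound:
  assumes dim: "CARD('n) \<ge> 2" and A [measurable]: "A \<in> sets borel"
    and \<alpha>: "emeasure lborel A = ennreal \<alpha>" "\<alpha> > 0"
  shows "measure P {a \<in> ASL. point_sum (indicator A) a = 0} < 1 / (1 + \<alpha>)"
proof -
  let ?N = "point_sum (indicator A)"
  define c where "c = 1 + \<alpha>"
  obtain m :: nat where m: "c + 1 \<le> real m" using real_arch_simple by blast
  have m0: "0 < m" using m \<alpha> by (cases m) (auto simp: c_def)
  let ?f = "\<lambda>(u :: real^'n, w). if w \<noteq> 0 then \<Prod>j<m. indicator A (u + real j *\<^sub>R w) else (0 :: ennreal)"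
  have [measurable]: "?f \<in> borel_measurable borel"
    unfolding split_beta' by measurable
  let ?M = "pair_sum ?f"
  define E where "E = {a. ?N a = 0}"
  define H where "H = {a \<in> ASL. ?M a \<noteq> 0}"
  have [measurable]: "E \<in> sets borel" "H \<in> sets borel" unfolding E_def H_def by measurable
  have "(\<integral>\<^sup>+a. ?M a \<partial>P) = (\<integral>\<^sup>+w. \<integral>\<^sup>+u. ?f (u, w) \<partial>lborel \<partial>lborel)"
    by (rule nn_integral_pair_sum[OF dim]) auto
  also have "\<dots> > 0"
    using progressions_positive[OF A _ m0] \<alpha> by simp
  finally have "(\<integral>\<^sup>+a. ?M a \<partial>P) \<noteq> 0" by simp
  then have "\<not> (AE a in P. ?M a = 0)" by (subst (asm) nn_integral_0_iff_AE) measurable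
  moreover have "AE a in P. ?M a = 0" if "emeasure P H = 0"
  proof -
    have "H \<in> null_sets P" using that by (intro null_setsI) auto
    from AE_not_in[OF this] AE_ASL show ?thesis by eventually_elim (simp add: H_def)
  qed
  ultimately have H: "measure P H > 0"
    by (metis emeasure_eq_measure ennreal_0 measure_nonneg order_le_less)
  \<comment> \<open>This is \<open>(N - c)^2 \<ge> c^2\<close> on \<open>E\<close> and
    \<open>(N - c)^2 \<ge> 1\<close> on the disjoint set \<open>H\<close>, with the mixed term moved
    to the left to avoid truncated subtraction. Where \<open>N\<close> is infinite, so is the
    right-hand side.\<close>
  have pt: "ennreal (c^2) * indicator E a + ennreal (2 * c) * ?N a + indicator H a \<le> ?N a * ?N a + ennreal (c^2)" for a
  proof (cases "?N a")
    case top
    then show ?thesis by (simp add: ennreal_mult_top)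
  next
    case (real x)
    have H: "c + 1 \<le> x" if "a \<in> H"
    proof -
      have "of_nat m \<le> ?N a" using that by (intro point_sum_progression) (auto simp: H_def)
      then have "real m \<le> x" using real by (simp add: ennreal_of_nat_eq_real_of_nat)
      then show ?thesis using m by simp
    qed
    have E: "a \<in> E \<longleftrightarrow> x = 0" using real by (simp add: E_def)
    have c: "c > 0" using \<alpha> by (simp add: c_def)
    have "c^2 * indicator E a + 2 * c * x + indicator H a \<le> x * x + c^2"
    proof (cases "a \<in> H")
      case True
      have "1 * 1 \<le> (x - c) * (x - c)" using H[OF True] by (intro mult_mono) auto
      then show ?thesis using True E H[OF True] c by (simp add: algebra_simps power2_eq_square)
    next
      case False
      have "0 \<le> (x - c) * (x - c)" by simp
      then show ?thesis using False E by (cases "a \<in> E") (simp_all add: algebra_simps power2_eq_square)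
    qed
    then have "ennreal (c^2 * indicator E a + 2 * c * x + indicator H a) \<le> ennreal (x * x + c^2)"
      by (rule ennreal_leI)
    moreover have "ennreal (c^2 * indicator E a + 2 * c * x + indicator H a) =
        ennreal (c^2) * indicator E a + ennreal (2 * c) * ?N a + indicator H a"
      using c real by (simp add: ennreal_plus ennreal_mult ennreal_indicator)
    moreover have "ennreal (x * x + c^2) = ?N a * ?N a + ennreal (c^2)"
      using real by (simp add: ennreal_plus ennreal_mult)
    ultimately show ?thesis by simp
  qed
  have "(\<integral>\<^sup>+a. ennreal (c^2) * indicator E a + ennreal (2 * c) * ?N a + indicator H a \<partial>P) \<le>
      (\<integral>\<^sup>+a. ?N a * ?N a + ennreal (c^2) \<partial>P)"
    by (intro nn_integral_mono pt)
  also have "(\<integral>\<^sup>+a. ennreal (c^2) * indicator E a + ennreal (2 * c) * ?N a + indicator H a \<partial>P) =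
      ennreal (c^2) * emeasure P E + ennreal (2 * c) * ennreal \<alpha> + emeasure P H"
    by (simp add: nn_integral_add nn_integral_cmult nn_integral_cmult_indicator nn_integral_point_sum \<alpha>)
  also have "(\<integral>\<^sup>+a. ?N a * ?N a + ennreal (c^2) \<partial>P) = ennreal \<alpha> * ennreal \<alpha> + ennreal \<alpha> + ennreal (c^2)"
    by (simp add: nn_integral_add second_moment[OF dim] \<alpha> emeasure_space_1)
  finally have "ennreal (c^2 * measure P E + 2 * c * \<alpha> + measure P H) \<le> ennreal (\<alpha> * \<alpha> + \<alpha> + c^2)"
    using \<alpha>(2) by (simp add: emeasure_eq_measure ennreal_mult ennreal_plus c_def)
  then have "c^2 * measure P E + 2 * c * \<alpha> + measure P H \<le> \<alpha> * \<alpha> + \<alpha> + c^2"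
    using \<alpha>(2) by (subst (asm) ennreal_le_iff) auto
  \<comment> \<open>For \<open>c = 1 + \<alpha>\<close> the value of
    \<open>\<alpha>^2 + \<alpha> + c^2 - 2 c \<alpha>\<close> is \<open>c\<close>, and
    \<open>measure P H > 0\<close> makes the inequality strict.\<close>
  then have "c^2 * measure P E < c"
    using H by (simp add: c_def power2_eq_square algebra_simps)
  then have "c * measure P E < 1"
    using \<alpha>(2) by (simp add: c_def power2_eq_square)
  then have "measure P E < 1 / (1 + \<alpha>)"
    using \<alpha>(2) by (simp add: c_def field_simps)
  moreover have "measure P {a \<in> ASL. ?N a = 0} = measure P E"
    by (rule finite_measure_eq_AE) (use AE_ASL in \<open>auto simp: E_def\<close>)
  ultimately show ?thesis by simp
qed

end

section \<open>Return to the space of lattices\<close>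

lemma point_sum_eq_0_iff:
  "point_sum (indicator A) a = 0 \<longleftrightarrow> affine_lattice a \<inter> A = {}"
  unfolding point_sum_def
  by (subst nn_integral_0_iff_AE) (auto simp: AE_count_space affine_lattice_def indicator_def)

context affine_lattice_haar
begin

lemma avoiding_sets:
  assumes [measurable]: "A \<in> sets borel"
  shows "{\<Lambda> \<in> affine_lattices. \<Lambda> \<inter> A = {}} \<in> sets \<mu>"
proof -
  have "{a \<in> ASL. affine_lattice a \<in> {\<Lambda> \<in> affine_lattices. \<Lambda> \<inter> A = {}}} = {a \<in> ASL. point_sum (indicator A) a = 0}"
    by (auto simp: point_sum_eq_0_iff affine_lattices_def)
  also have "\<dots> \<in> sets borel" by measurable
  finally show ?thesis by (simp add: sets_mu affine_lattice_sets_def)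
qed

text \<open>A Lebesgue set is a Borel set \<open>B\<close> up to a subset of a Borel null set
  \<open>N'\<close>. The expected number of points in \<open>N'\<close> is 0, so almost every
  lattice misses \<open>N'\<close>, and for such lattices avoiding \<open>A\<close> and avoiding
  \<open>B\<close> are the same. This is why the event is measurable for the completion of
  \<open>\<mu>\<close>.\<close>

lemma avoidance_bound_lattices:
  assumes dim: "CARD('n) \<ge> 2" and A: "A \<in> sets lebesgue"
    and pos: "0 < emeasure lebesgue A" and fin: "emeasure lebesgue A < \<infinity>"
  shows "{\<Lambda> \<in> affine_lattices. \<Lambda> \<inter> A = {}} \<in> sets (completion \<mu>) \<and>
    measure (completion \<mu>) {\<Lambda> \<in> affine_lattices. \<Lambda> \<inter> A = {}} < 1 / (1 + measure lebesgue A)"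
proof -
  obtain P :: "'n aff measure" where "ASL_average P"
    and P: "\<And>S. S \<in> sets \<mu> \<Longrightarrow> emeasure P {a \<in> ASL. affine_lattice a \<in> S} = emeasure \<mu> S"
    using lift_ex by blast
  then interpret ASL_average P by simp
  interpret mu: prob_space \<mu> by (rule prob)
  let ?S = "\<lambda>A. {\<Lambda> \<in> affine_lattices. \<Lambda> \<inter> A = {}}"
  have lift: "emeasure P {a \<in> ASL. point_sum (indicator B) a = 0} = emeasure \<mu> (?S B)" if "B \<in> sets borel" for B
  proof -
    have "{a \<in> ASL. affine_lattice a \<in> ?S B} = {a \<in> ASL. point_sum (indicator B) a = 0}"
      by (auto simp: point_sum_eq_0_iff affine_lattices_def)
    then show ?thesis using P[OF avoiding_sets[OF that]] by simp
  qed
  obtain B N N' where AB: "A = B \<union> N" "N \<subseteq> N'" "N' \<in> null_sets lborel" and B: "B \<in> sets lborel"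
    using sets_completionE[OF A] by metis
  have Bm [measurable]: "B \<in> sets borel" using B by simp
  have N'm [measurable]: "N' \<in> sets borel" using AB(3) by auto
  have "N \<in> null_sets lebesgue" using AB(2,3) null_sets_completion_iff2 by blast
  then have AeqB: "emeasure lebesgue A = emeasure lborel B"
    using emeasure_Un_null_set[of B lebesgue N] B by (simp add: AB(1))
  define \<alpha> where "\<alpha> = measure lebesgue A"
  have e\<alpha>: "emeasure lborel B = ennreal \<alpha>"
    using fin AeqB by (simp add: \<alpha>_def measure_def)
  have "\<alpha> > 0" using e\<alpha> pos AeqB by simp
  have N0: "?S N' \<in> sets \<mu>" "?S B \<in> sets \<mu>" by (simp_all add: avoiding_sets)
  have "(\<integral>\<^sup>+a. point_sum (indicator N') a \<partial>P) = 0"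
    using null_setsD1[OF AB(3)] by (simp add: nn_integral_point_sum)
  then have "AE a in P. point_sum (indicator N') a = 0"
    by (subst (asm) nn_integral_0_iff_AE) measurable
  with AE_ASL have "AE a in P. a \<in> {a \<in> ASL. point_sum (indicator N') a = 0}" by eventually_elim simp
  then have "emeasure P {a \<in> ASL. point_sum (indicator N') a = 0} = 1"
    by (intro emeasure_eq_1_AE) measurable
  then have "emeasure \<mu> (?S N') = 1" by (simp add: lift)
  then have AE: "AE \<Lambda> in \<mu>. \<Lambda> \<in> ?S N'"
    by (intro mu.AE_I_eq_1) (use N0 in \<open>auto simp: space_mu\<close>)
  have null: "space \<mu> - ?S N' \<in> null_sets \<mu>"
  proof -
    have "AE \<Lambda> in \<mu>. \<Lambda> \<notin> space \<mu> - ?S N'" using AE by eventually_elim simp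
    then show ?thesis using N0 AE_iff_null_sets[of "space \<mu> - ?S N'" \<mu>] by auto
  qed
  have sets: "?S A \<in> sets (completion \<mu>)"
  proof (rule sets_completionI)
    show "?S A = (?S B \<inter> ?S N') \<union> (?S A \<inter> (space \<mu> - ?S N'))"
      using AB(2) by (auto simp: AB(1) space_mu)
    show "space \<mu> - ?S N' \<in> null_sets \<mu>" by (rule null)
  qed (use N0 in auto)
  have "emeasure (completion \<mu>) (?S A) = emeasure (completion \<mu>) (?S B)"
  proof (rule emeasure_eq_AE)
    show "AE \<Lambda> in completion \<mu>. \<Lambda> \<in> ?S A \<longleftrightarrow> \<Lambda> \<in> ?S B"
      using AE_completion[OF AE] by eventually_elim (use AB(2) in \<open>auto simp: AB(1)\<close>)
  qed (use sets N0 in auto)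
  also have "\<dots> = emeasure P {a \<in> ASL. point_sum (indicator B) a = 0}"
    using N0 by (simp add: lift)
  finally have "measure (completion \<mu>) (?S A) = measure P {a \<in> ASL. point_sum (indicator B) a = 0}"
    by (simp add: measure_def)
  then show ?thesis
    using sets avoidance_bound[OF dim Bm e\<alpha> \<open>\<alpha> > 0\<close>] by (simp add: \<alpha>_def)
qed

end

text \<open>For a null set \<open>A\<close> almost every lattice avoids \<open>A\<close> and the
  strict bound would read \<open>1 < 1\<close>, hence the positivity assumption. For a set of
  infinite measure \<open>measure lebesgue A\<close> is 0 by convention, and the right-hand side
  would no longer express \<open>1 / (1 + |A|)\<close>.\<close>

theorem theorem1:
  fixes \<mu> :: "(real^'n::finite) set measure" and A :: "(real^'n) set"
  assumes "CARD('n) \<ge> 2"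
    and "haar_probability \<mu>"
    and "A \<in> sets lebesgue"
    and "0 < emeasure lebesgue A" and "emeasure lebesgue A < \<infinity>"
  shows "{\<Lambda> \<in> affine_lattices. \<Lambda> \<inter> A = {}} \<in> sets (completion \<mu>) \<and>
    measure (completion \<mu>) {\<Lambda> \<in> affine_lattices. \<Lambda> \<inter> A = {}} < 1 / (1 + measure lebesgue A)"
proof -
  obtain m where "affine_lattice_haar \<mu> m"
    using assms(2) unfolding haar_probability_def affine_lattice_haar_def by blast
  then show ?thesis
    using affine_lattice_haar.avoidance_bound_lattices assms by blast
qed

end
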